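(* Let $K_t$, $t\in[a,b]$, be a non-degenerate shadow system in $\mathbb{R}^d=\mathbb{R}^{d-1}\times\mathbb{R}$ along the direction of the $d$-th coordinate unit vector. Then the following are equivalent: 1) $t\mapsto |K_t|$ and $t\mapsto |K_t^*|^{-1}$ are both affine functions of $t\in[a,b]$. 2) There exist real numbers $v$ and $u$, and a vector $V\in\mathbb{R}^{d-1}$, such that for all $t\in[a,b]$, $K_t$ is the image of $K_{\frac{a+b}{2}}$ under the affine transformation $A_t:\mathbb{R}^d\to\mathbb{R}^d$ given, for $(X,x)\in\mathbb{R}^{d-1}\times\mathbb{R}$, by $$A_t(X,x)=\left(X,\;x+\left(t-\frac{a+b}{2}\right)\bigl(vx+\langle V,X\rangle+u\bigr)\right).$$
   Context: A convex body in $\mathbb{R}^d$ is a compact convex set with non-empty interior, and $|\cdot|$ denotes volume. For a convex body $K$ and an interior point $z$ of $K$, the polar body of $K$ with respect to $z$ is $K^{*z}=\{y\in\mathbb{R}^d : \langle y,x-z\rangle\le 1 \text{ for all } x\in K\}$. There is a unique point $S(K)\in\operatorname{int}K$, the Santaló point of $K$, such that $|K^{*S(K)}|=\min_{z\in\operatorname{int}K}|K^{*z}|$; write $K^*=K^{*S(K)}$. A shadow system along a direction $\theta\in\mathbb{S}^{d-1}$ is a family of sets $K_t=\operatorname{conv}\{x+\alpha(x)t\theta : x\in M\}$, where $M\subset\mathbb{R}^d$ is a bounded set, $\alpha:M\to\mathbb{R}$ is a bounded function, $t$ ranges over an interval of $\mathbb{R}$, and $\operatorname{conv}$ denotes the closed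 convex hull. It is non-degenerate if $K_t$ has non-empty interior for every $t$ in the interval. *)

theory Defs
  imports "HOL-Analysis.Analysis"
begin

definition polar_body :: "'a::euclidean_space set \<Rightarrow> 'a \<Rightarrow> 'a set" where
  "polar_body K z = {y. \<forall>x\<in>K. y \<bullet> (x - z) \<le> 1}"

(* The description is proper when K is a convex body: the minimiser then exists and is unique.
   For z in the interior of K the polar body is compact, so its measure is its volume. *)
definition santalo_point :: "'a::euclidean_space set \<Rightarrow> 'a" where
  "santalo_point K = (THE z. z \<in> interior K \<and>
     (\<forall>w\<in>interior K. measure lebesgue (polar_body K z) \<le> measure lebesgue (polar_body K w)))"

definition santalo_polar :: "'a::euclidean_space set \<Rightarrow> 'a set" where
  "santalo_polar K = polar_body K (santalo_point K)"

definition shadow_system :: "real set \<Rightarrow> 'a::euclidean_space \<Rightarrow> (real \<Rightarrow> 'a set) \<Rightarrow> bool" where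
  "shadow_system I \<theta> K \<longleftrightarrow> is_interval I \<and> norm \<theta> = 1 \<and>
     (\<exists>M \<alpha>. bounded M \<and> bounded (\<alpha> ` M) \<and>
       (\<forall>t\<in>I. K t = closure (convex hull ((\<lambda>x. x + (\<alpha> x * t) *\<^sub>R \<theta>) ` M))))"

definition nondegenerate_shadow_system ::
    "real set \<Rightarrow> 'a::euclidean_space \<Rightarrow> (real \<Rightarrow> 'a set) \<Rightarrow> bool" where
  "nondegenerate_shadow_system I \<theta> K \<longleftrightarrow>
     shadow_system I \<theta> K \<and> (\<forall>t\<in>I. interior (K t) \<noteq> {})"

definition affine_function_on :: "real set \<Rightarrow> (real \<Rightarrow> real) \<Rightarrow> bool" where
  "affine_function_on I f \<longleftrightarrow> (\<exists>p q. \<forall>t\<in>I. f t = p * t + q)"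

(* For a unit vector e, a point z of the space is identified with the pair (X, x), where
   x = z \<bullet> e is its e-coordinate and X, its orthogonal projection to the hyperplane
   e^\<bottom>, holds the other coordinates.  The map below is
   (X, x) \<mapsto> (X, x + s (v x + <V, X> + u)). *)
definition shear_map ::
    "'a::euclidean_space \<Rightarrow> real \<Rightarrow> real \<Rightarrow> 'a \<Rightarrow> real \<Rightarrow> 'a \<Rightarrow> 'a" where
  "shear_map e v u V s z =
     (let x = z \<bullet> e; X = z - x *\<^sub>R e
      in X + (x + s * (v * x + V \<bullet> X + u)) *\<^sub>R e)"

end

theory Submission
  imports Defs "HOL-Probability.Probability"
begin

text \<open>
  Write \<open>g K z\<close> for the support function of \<open>K - z\<close>. On each of the two half-spaces bounded by the
  hyperplane orthogonal to \<open>e\<close>, homogeneity turns the volume of the polar body, up to a factor, into the integral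
  of \<open>g K z (W + s e) ^ (- d)\<close> over the hyperplane, where \<open>s\<close> is \<open>1\<close> or \<open>-1\<close>. For a shadow system this
  integrand comes from a function that is jointly convex in \<open>W\<close> and \<open>t\<close>, so the extremal
  Borell-Brascamp-Lieb inequality makes the reciprocal of each half volume convex in \<open>t\<close>. The
  two halves are added by an intermediate value argument that chooses base points in \<open>K a\<close> and \<open>K b\<close>
  for which their ratios agree.

  If the reciprocal of the total is affine, equality holds everywhere. The equality case of the
  inequality, proved one coordinate at a time with monotone transport, says that \<open>g (K b)\<close> is a dilated
  and translated copy of \<open>g (K a)\<close> on each half. The translations of the two halves fit together
  because polar bodies at Santalo points are centred, so that \<open>K b\<close> is a shear of \<open>K a\<close>. Every
  intermediate body lies in the interpolated shear of \<open>K a\<close>, and it has the same volume because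
  \<open>|K t|\<close> is affine.
\<close>

subsection \<open>The Borell-Brascamp-Lieb inequality on the line\<close>

text \<open>The obstacle is that a point moving along \<open>e\<close> pairs with \<open>y\<close>
  as \<open>t * (y \<bullet> e)\<close>, which is bilinear. Fixing \<open>y \<bullet> e = s\<close>
  makes it affine in \<open>t\<close>, and the rays that meet such a hyperplane fill only a
  half-space: hence the two halves. The exponent \<open>d\<close> on a hyperplane of dimension
  \<open>d - 1\<close> is the one that sinks in step with the dimension under integration, so that
  finally a number of degree one is left, for which the inequality is additive. Total polar volumes
  are treated as integrals of \<open>exp (- g K z y)\<close>, because moving \<open>z\<close> then
  only multiplies the integrand by the exponential of a linear function; existence, uniqueness and
  centring of the Santalo point all rest on this. The base points in \<open>K a\<close> and
  \<open>K b\<close> are moved in opposite directions along \<open>e\<close>, which leaves their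
  midpoint at the Santalo point of the middle body. Hence the polar volumes at the two ends and at
  the middle suffice to relate \<open>K b\<close> to \<open>K a\<close>.\<close>

lemma continuous_nn_integral_zero:
  fixes f :: "'a::euclidean_space \<Rightarrow> real"
  assumes cont: "continuous_on UNIV f" and zero: "(\<integral>\<^sup>+x. ennreal (f x) \<partial>lborel) = 0"
  shows "f x \<le> 0"
proof -
  have [measurable]: "f \<in> borel_measurable borel"
    using cont by (rule borel_measurable_continuous_onI)
  have "AE x in lborel. f x \<le> 0"
    using zero by (subst (asm) nn_integral_0_iff_AE) (auto simp: ennreal_eq_0_iff)
  then have "AE x in lebesgue. x \<in> {x. f x \<le> 0}"
    by (subst AE_completion_iff) auto
  moreover have "closed {x. f x \<le> 0}"
    by (intro closed_Collect_le continuous_intros cont)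
  ultimately have "x \<in> {x. f x \<le> 0}"
    by (rule mem_closed_if_AE_lebesgue[rotated])
  then show ?thesis by simp
qed

text \<open>Strict positivity makes the distribution function a strictly increasing bijection onto
  an open interval, so that \<open>monotone_transport\<close> can invert it at every value it meets,
  with a differentiable inverse.\<close>

lemma positive_density_cdf:
  fixes f :: "real \<Rightarrow> real"
  assumes cont: "continuous_on UNIV f" and pos: "\<And>x. f x > 0"
    and int: "(\<integral>\<^sup>+x. ennreal (f x) \<partial>lborel) = ennreal I" and "I > 0"
  obtains F where "\<And>x. (F has_real_derivative f x) (at x)"
    "strict_mono F" "range F = {0<..<I}"
proof -
  define M where "M = density lborel (\<lambda>x. ennreal (f x))"
  have fm[measurable]: "f \<in> borel_measurable borel"
    using cont by (rule borel_measurable_continuous_onI)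
  interpret finite_borel_measure M
  proof (intro finite_borel_measure.intro finite_borel_measure_axioms.intro finite_measureI)
    show "emeasure M (space M) \<noteq> \<infinity>"
      unfolding M_def by (subst emeasure_density) (auto simp: int)
    show "sets M = sets borel" unfolding M_def by simp
  qed
  define F where "F = cdf M"
  have diff: "F y - F x = integral {x..y} f" if "x \<le> y" for x y
  proof (cases "x = y")
    case False
    have "F y - F x = measure M {x<..y}" unfolding F_def using that False by (intro cdf_diff_eq) auto
    also have "emeasure M {x<..y} = (\<integral>\<^sup>+z. ennreal (f z) * indicator {x<..y} z \<partial>lborel)"
      unfolding M_def by (subst emeasure_density) auto
    then have "measure M {x<..y} = enn2real (\<integral>\<^sup>+z. ennreal (f z) * indicator {x<..y} z \<partial>lborel)"
      by (simp add: measure_def)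
    also have "(\<integral>\<^sup>+z. ennreal (f z) * indicator {x<..y} z \<partial>lborel)
        = (\<integral>\<^sup>+z. ennreal (f z) * indicator {x..y} z \<partial>lborel)"
      using AE_lborel_singleton[of x]
      by (intro nn_integral_cong_AE) (auto elim!: eventually_mono simp: indicator_def)
    also have "\<dots> = ennreal (integral {x..y} f)"
      using pos by (intro nn_integral_has_integral_lebesgue' integrable_integral integrable_continuous_real
        continuous_on_subset[OF cont]) (auto intro: less_imp_le)
    finally show ?thesis using pos by (simp add: integral_nonneg integrable_continuous_real
        continuous_on_subset[OF cont] less_imp_le)
  qed auto
  have der: "(F has_real_derivative f x) (at x)" for x
  proof -
    \<comment> \<open>The fundamental theorem is used on a compact interval around \<open>x\<close>.
      The base point \<open>x - 1\<close> only costs the constant \<open>F (x - 1)\<close>.\<close>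
    have "((\<lambda>y. integral {x-1..y} f) has_real_derivative f x) (at x within {x-1..x+1})"
      by (rule integral_has_real_derivative) (auto intro: continuous_on_subset[OF cont])
    then have "((\<lambda>y. F (x-1) + integral {x-1..y} f) has_real_derivative f x) (at x within {x-1<..<x+1})"
      by (auto intro!: derivative_eq_intros elim: has_field_derivative_subset)
    then have "(F has_real_derivative f x) (at x within {x-1<..<x+1})"
      by (rule has_field_derivative_transform_within[where d=1])
        (auto simp: diff[symmetric] dist_real_def)
    then show ?thesis by (simp add: at_within_open[of x "{x-1<..<x+1}"])
  qed
  have sm: "strict_mono F"
    by (rule strict_monoI, rule DERIV_pos_imp_increasing) (use der pos in auto)
  have top: "(F \<longlongrightarrow> I) at_top"
  proof -
    have "measure M (space M) = I"
      unfolding M_def measure_def by (subst emeasure_density) (use \<open>I > 0\<close> in \<open>auto simp: int\<close>)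
    then show ?thesis using cdf_lim_at_top unfolding F_def by simp
  qed
  have bot: "(F \<longlongrightarrow> 0) at_bot" unfolding F_def by (rule cdf_lim_at_bot)
  have lt: "F x < I" for x
  proof -
    have "eventually (\<lambda>y. F (x+1) \<le> F y) at_top"
      by (rule eventually_mono[OF eventually_ge_at_top[of "x+1"]])
        (use sm in \<open>auto simp: strict_mono_less_eq\<close>)
    then have "F (x+1) \<le> I" using tendsto_lowerbound[OF top] by auto
    moreover have "F x < F (x+1)" using sm by (simp add: strict_mono_less)
    ultimately show ?thesis by simp
  qed
  have gt: "F x > 0" for x
  proof -
    have "eventually (\<lambda>y. F (x-1) \<ge> F y) at_bot"
      by (rule eventually_mono[OF eventually_le_at_bot[of "x-1"]])
        (use sm in \<open>auto simp: strict_mono_less_eq\<close>)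
    then have "F (x-1) \<ge> 0" using tendsto_upperbound[OF bot] by auto
    moreover have "F (x-1) < F x" using sm by (simp add: strict_mono_less)
    ultimately show ?thesis by simp
  qed
  have surj: "y \<in> range F" if "0 < y" "y < I" for y
  proof -
    obtain u where u: "F u < y"
      using order_tendstoD(2)[OF bot \<open>0 < y\<close>] by (auto simp: eventually_at_bot_linorder)
    obtain v where v: "F v > y"
      using order_tendstoD(1)[OF top \<open>y < I\<close>] by (auto simp: eventually_at_top_linorder)
    have "u \<le> v" using u v sm by (meson less_trans not_le strict_mono_less less_asym)
    then obtain x where "F x = y"
      using IVT[of F u y v] u v der by (metis DERIV_isCont less_imp_le)
    then show ?thesis by auto
  qed
  show thesis
    by (rule that[OF der sm]) (use lt gt surj in auto)
qed

text \<open>\<open>T\<close> is the inverse of the second distribution function applied to the first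
  one, rescaled by \<open>I1 / I0\<close> to match the total masses. Only the differential equation
  is exported: it is what a change of variables needs.\<close>

lemma monotone_transport:
  fixes f0 f1 :: "real \<Rightarrow> real"
  assumes "continuous_on UNIV f0" "\<And>x. f0 x > 0"
    and "(\<integral>\<^sup>+x. ennreal (f0 x) \<partial>lborel) = ennreal I0" "I0 > 0"
    and "continuous_on UNIV f1" "\<And>x. f1 x > 0"
    and "(\<integral>\<^sup>+x. ennreal (f1 x) \<partial>lborel) = ennreal I1" "I1 > 0"
  obtains T where "\<And>x. (T has_real_derivative (I1 / I0 * (f0 x / f1 (T x)))) (at x)"
proof -
  obtain F0 where F0: "\<And>x. (F0 has_real_derivative f0 x) (at x)" "strict_mono F0" "range F0 = {0<..<I0}"
    using positive_density_cdf[OF assms(1-4)] by blast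
  obtain F1 where F1: "\<And>x. (F1 has_real_derivative f1 x) (at x)" "strict_mono F1" "range F1 = {0<..<I1}"
    using positive_density_cdf[OF assms(5-8)] by blast
  define G where "G = inv F1"
  have inj: "inj F1" using F1(2) by (rule strict_mono_imp_inj_on)
  have GF: "G (F1 x) = x" for x unfolding G_def using inj by simp
  have FG: "F1 (G y) = y" if "0 < y" "y < I1" for y
    unfolding G_def by (rule f_inv_into_f) (use that F1(3) in auto)
  have Gder: "(G has_real_derivative inverse (f1 (G y))) (at y)" if y: "0 < y" "y < I1" for y
  proof (rule DERIV_inverse_function[where f=F1 and a=0 and b=I1])
    show "isCont G y"
    proof -
      have "isCont G (F1 (G y))"
        by (rule isCont_inverse_function[where d=1 and f=F1]) (auto simp: GF intro: DERIV_isCont[OF F1(1)])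
      then show ?thesis using FG[OF y] by simp
    qed
    show "f1 (G y) \<noteq> 0" using assms(6)[of "G y"] by simp
  qed (use F1(1) FG y in auto)
  define T where "T = (\<lambda>x. G (I1 / I0 * F0 x))"
  have "(T has_real_derivative (I1 / I0 * (f0 x / f1 (T x)))) (at x)" for x
  proof -
    have "F0 x \<in> {0<..<I0}" using F0(3) by auto
    then have r: "0 < I1 / I0 * F0 x" "I1 / I0 * F0 x < I1"
      using assms(4,8) by (auto simp: field_simps)
    have "((\<lambda>x. I1 / I0 * F0 x) has_real_derivative I1 / I0 * f0 x) (at x)"
      by (rule DERIV_cmult[OF F0(1)])
    from DERIV_chain2[OF Gder[OF r] this] show ?thesis
      unfolding T_def by (simp add: divide_inverse mult_ac)
  qed
  then show thesis using that by blast
qed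

text \<open>With \<open>u = \<beta> / c\<close> and the weight \<open>q = l * c / s\<close>,
  division by \<open>s ^ Suc N\<close> leaves
  \<open>(1 - q + q * u) ^ Suc N \<le> 1 - q + q * u ^ Suc N\<close>, the convexity of a power. It
  is strict unless \<open>u = 1\<close>, which is how the equality case pins \<open>\<beta>\<close>
  to the constant \<open>c\<close>.\<close>

lemma weighted_power_convex:
  fixes \<beta> c l :: real
  assumes "0 < l" "l < 1" "c > 0" "\<beta> > 0" "N \<ge> 1"
  shows "((1 - l) + l * \<beta>) ^ Suc N \<le> (1 - l + l * (\<beta> ^ Suc N / c ^ N)) * (1 - l + l * c) ^ N"
    and "((1 - l) + l * \<beta>) ^ Suc N = (1 - l + l * (\<beta> ^ Suc N / c ^ N)) * (1 - l + l * c) ^ N \<Longrightarrow> \<beta> = c"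
proof -
  define s where "s = 1 - l + l * c"
  have s: "s > 0" unfolding s_def using assms by (simp add: add_pos_pos)
  define q where "q = l * c / s"
  have q: "0 < q" "q < 1" unfolding q_def using assms s by (auto simp: s_def field_simps)
  have q1: "1 - q = (1 - l) / s" unfolding q_def using s by (simp add: s_def field_simps)
  define u where "u = \<beta> / c"
  have u: "u > 0" unfolding u_def using assms by simp
  have bern: "(1 + (u - 1) * q) ^ Suc n \<le> 1 - q + q * u ^ Suc n \<and>
     (n \<ge> 1 \<longrightarrow> u \<noteq> 1 \<longrightarrow> (1 + (u - 1) * q) ^ Suc n < 1 - q + q * u ^ Suc n)" for n
  proof (induction n)
    case 0 then show ?case by (simp add: algebra_simps)
  next
    case (Suc n)
    have w: "1 + (u - 1) * q > 0"
    proof -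
      have "1 + (u - 1) * q = (1 - q) + u * q" by (simp add: algebra_simps)
      also have "\<dots> > 0" using q u by (intro add_pos_pos mult_pos_pos) auto
      finally show ?thesis .
    qed
    \<comment> \<open>The induction step loses exactly this product, which is nonnegative because
      \<open>u\<close> and its powers lie on the same side of \<open>1\<close>.\<close>
    have id: "(1 - q + q * u ^ Suc (Suc n)) - (1 + (u - 1) * q) * (1 - q + q * u ^ Suc n)
        = q * (1 - q) * (u - 1) * (u ^ Suc n - 1)"
      by (simp add: algebra_simps)
    have nn: "(u - 1) * (u ^ Suc n - 1) \<ge> 0"
    proof (cases "u \<ge> 1")
      case True then have "u ^ Suc n \<ge> 1" by (rule one_le_power)
      with True show ?thesis by simp
    next
      case False then have "u ^ Suc n \<le> 1" using u by (intro power_le_one) auto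
      with False show ?thesis by (simp add: mult_nonpos_nonpos)
    qed
    have st: "(u - 1) * (u ^ Suc n - 1) > 0" if "u \<noteq> 1"
    proof (cases "u > 1")
      case True then have "u ^ Suc n > 1" by (intro one_less_power) auto
      with True show ?thesis by simp
    next
      case False then have "u < 1" using that by auto
      then have "u ^ Suc n < 1" using u by (intro power_Suc_less_one) auto
      with \<open>u < 1\<close> show ?thesis by (simp add: mult_neg_neg)
    qed
    have 1: "(1 + (u - 1) * q) ^ Suc (Suc n) \<le> (1 + (u - 1) * q) * (1 - q + q * u ^ Suc n)"
      using Suc w by (simp add: mult_left_mono)
    have 2: "q * (1 - q) * (u - 1) * (u ^ Suc n - 1) \<ge> 0"
      using nn q by (simp add: mult.assoc)
    have 3: "u \<noteq> 1 \<Longrightarrow> q * (1 - q) * (u - 1) * (u ^ Suc n - 1) > 0"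
      using st q by (simp add: mult.assoc)
    show ?case using 1 2 3 id by auto
  qed
  have lhs: "((1 - l) + l * \<beta>) ^ Suc N = (1 + (u - 1) * q) ^ Suc N * s ^ Suc N"
  proof -
    have "(1 + (u - 1) * q) * s = (1 - l) + l * \<beta>"
    proof -
      have "(u - 1) * q * s = (\<beta> / c - 1) * (l * c)" unfolding u_def q_def using s by simp
      also have "\<dots> = l * \<beta> - l * c" using assms by (simp add: field_simps)
      finally show ?thesis by (simp add: algebra_simps s_def)
    qed
    then show ?thesis by (metis power_mult_distrib)
  qed
  have rhs: "(1 - l + l * (\<beta> ^ Suc N / c ^ N)) * s ^ N = (1 - q + q * u ^ Suc N) * s ^ Suc N"
  proof -
    have "(1 - q + q * u ^ Suc N) * s = 1 - l + l * (\<beta> ^ Suc N / c ^ N)"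
      unfolding q1 unfolding q_def u_def using s assms by (simp add: field_simps power_divide)
    then show ?thesis by (simp add: mult_ac)
  qed
  show "((1 - l) + l * \<beta>) ^ Suc N \<le> (1 - l + l * (\<beta> ^ Suc N / c ^ N)) * (1 - l + l * c) ^ N"
    unfolding s_def[symmetric] lhs rhs using bern[of N] s by simp
  assume "((1 - l) + l * \<beta>) ^ Suc N = (1 - l + l * (\<beta> ^ Suc N / c ^ N)) * (1 - l + l * c) ^ N"
  then have "u = 1" unfolding s_def[symmetric] lhs rhs using bern[of N] s assms(5) by force
  then show "\<beta> = c" unfolding u_def using assms by simp
qed

lemma nn_integral_le_of_intervals:
  fixes G :: "real \<Rightarrow> ennreal"
  assumes [measurable]: "G \<in> borel_measurable borel"
    and le: "\<And>n::nat. (\<integral>\<^sup>+x. G x * indicator {- real n..real n} x \<partial>lborel) \<le> C"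
  shows "(\<integral>\<^sup>+x. G x \<partial>lborel) \<le> C"
proof -
  have "G x = (SUP n. G x * indicator {- real n..real n} x)" for x
  proof (rule antisym)
    obtain n :: nat where "\<bar>x\<bar> \<le> real n" using real_arch_simple by blast
    then have "G x \<le> G x * indicator {- real n..real n} x" by (auto simp: indicator_def)
    then show "G x \<le> (SUP n. G x * indicator {- real n..real n} x)" by (rule SUP_upper2[rotated]) simp
    show "(SUP n. G x * indicator {- real n..real n} x) \<le> G x"
      by (rule SUP_least) (auto simp: indicator_def)
  qed
  then have "(\<integral>\<^sup>+x. G x \<partial>lborel) = (\<integral>\<^sup>+x. (SUP n. G x * indicator {- real n..real n} x) \<partial>lborel)"
    by (intro nn_integral_cong) blast
  also have "\<dots> = (SUP n. \<integral>\<^sup>+x. G x * indicator {- real n..real n} x \<partial>lborel)"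
    by (rule nn_integral_monotone_convergence_SUP)
      (auto simp: incseq_def le_fun_def indicator_def)
  also have "\<dots> \<le> C" by (rule SUP_least) (rule le)
  finally show ?thesis .
qed

text \<open>
  After transporting one density to the other by a monotone map \<open>T\<close>, the pointwise inequality
  becomes the convexity of a power; strict convexity forces \<open>T' = b / a\<close> in the equality case.
\<close>

lemma borell_brascamp_lieb_real:
  fixes \<phi>0 \<phi>1 \<phi>m :: "real \<Rightarrow> real"
  assumes cont: "continuous_on UNIV \<phi>0" "continuous_on UNIV \<phi>1" "continuous_on UNIV \<phi>m"
    and pos: "\<And>x. \<phi>0 x > 0" "\<And>x. \<phi>1 x > 0" "\<And>x. \<phi>m x > 0"
    and l: "0 < l" "l < 1" and N: "N \<ge> 1" and ab: "a > 0" "b > 0"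
    and mid: "\<And>x y. \<phi>m ((1 - l) * x + l * y) \<le> (1 - l) * \<phi>0 x + l * \<phi>1 y"
    and int0: "(\<integral>\<^sup>+x. ennreal (1 / \<phi>0 x ^ Suc N) \<partial>lborel) = ennreal (1 / a ^ N)"
    and int1: "(\<integral>\<^sup>+x. ennreal (1 / \<phi>1 x ^ Suc N) \<partial>lborel) = ennreal (1 / b ^ N)"
  shows "ennreal (1 / ((1 - l) * a + l * b) ^ N) \<le> (\<integral>\<^sup>+x. ennreal (1 / \<phi>m x ^ Suc N) \<partial>lborel)"
    and "(\<integral>\<^sup>+x. ennreal (1 / \<phi>m x ^ Suc N) \<partial>lborel) = ennreal (1 / ((1 - l) * a + l * b) ^ N) \<Longrightarrow>
      \<exists>w. \<forall>x. \<phi>1 (b / a * x + w) = b / a * \<phi>0 x \<and>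
        \<phi>m ((1 - l) * x + l * (b / a * x + w)) = (1 - l + l * (b / a)) * \<phi>0 x"
proof -
  define f0 f1 fm where "f0 = (\<lambda>x. 1 / \<phi>0 x ^ Suc N)" and "f1 = (\<lambda>x. 1 / \<phi>1 x ^ Suc N)"
    and "fm = (\<lambda>x. 1 / \<phi>m x ^ Suc N)"
  have int0': "(\<integral>\<^sup>+x. ennreal (f0 x) \<partial>lborel) = ennreal (1 / a ^ N)"
    using int0 unfolding f0_def .
  have fpos: "f0 x > 0" "f1 x > 0" "fm x > 0" for x unfolding f0_def f1_def fm_def using pos by auto
  have nz: "\<phi>0 x \<noteq> 0" "\<phi>1 x \<noteq> 0" "\<phi>m x \<noteq> 0" for x using pos[of x] by auto
  have fcont: "continuous_on UNIV f0" "continuous_on UNIV f1" "continuous_on UNIV fm"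
    unfolding f0_def f1_def fm_def using nz
    by (auto intro!: continuous_intros cont simp del: power_Suc)
  have fm_meas[measurable]: "fm \<in> borel_measurable borel" and f0_meas[measurable]: "f0 \<in> borel_measurable borel"
    using fcont by (auto intro: borel_measurable_continuous_onI)
  define c where "c = b / a"
  have c: "c > 0" unfolding c_def using ab by simp
  obtain T where T: "\<And>x. (T has_real_derivative ((1 / b ^ N) / (1 / a ^ N) * (f0 x / f1 (T x)))) (at x)"
    by (rule monotone_transport[OF fcont(1) fpos(1) _ _ fcont(2) fpos(2), of "1 / a ^ N" "1 / b ^ N"])
      (use int0 int1 ab in \<open>auto simp: f0_def f1_def\<close>)
  \<comment> \<open>Everything is expressed by this ratio: the derivative of \<open>T\<close> is
    \<open>\<beta> x ^ Suc N / c ^ N\<close>, and the midpoint inequality becomes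
    \<open>\<phi>m (R x) \<le> \<phi>0 x * e x\<close>.\<close>
  define \<beta> where "\<beta> = (\<lambda>x. \<phi>1 (T x) / \<phi>0 x)"
  have \<beta>: "\<beta> x > 0" for x unfolding \<beta>_def using pos by simp
  have T': "(T has_real_derivative (\<beta> x ^ Suc N / c ^ N)) (at x)" for x
  proof -
    have "(1 / b ^ N) / (1 / a ^ N) * (f0 x / f1 (T x)) = \<beta> x ^ Suc N / c ^ N"
      unfolding f0_def f1_def \<beta>_def c_def using ab nz by (simp add: field_simps power_divide)
    then show ?thesis using T[of x] by simp
  qed
  define R where "R = (\<lambda>x. (1 - l) * x + l * T x)"
  define R' where "R' = (\<lambda>x. 1 - l + l * (\<beta> x ^ Suc N / c ^ N))"
  have R'pos: "R' x > 0" for x unfolding R'_def using l \<beta>[of x] c by (auto intro!: add_pos_pos)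
  have Rder: "(R has_real_derivative R' x) (at x)" for x
    unfolding R_def R'_def by (auto intro!: derivative_eq_intros T')
  have Tcont: "continuous_on UNIV T"
    using T' DERIV_isCont by (auto simp: continuous_on_eq_continuous_at)
  have Rcont: "continuous_on UNIV R"
    unfolding R_def by (auto intro!: continuous_intros Tcont)
  have \<beta>cont: "continuous_on UNIV \<beta>"
    unfolding \<beta>_def using nz
    by (auto intro!: continuous_intros cont continuous_on_compose2[OF cont(2) Tcont])
  have R'cont: "continuous_on UNIV R'"
    unfolding R'_def using c by (auto intro!: continuous_intros \<beta>cont simp del: power_Suc)
  \<comment> \<open>The middle density pulled back along the interpolation \<open>R\<close> of the
    identity and \<open>T\<close>, so that it can be compared pointwise with
    \<open>f0\<close>.\<close>
  define G where "G = (\<lambda>x. fm (R x) * R' x)"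
  have Gcont: "continuous_on UNIV G"
    unfolding G_def by (auto intro!: continuous_intros R'cont continuous_on_compose2[OF fcont(3) Rcont])
  have [measurable]: "G \<in> borel_measurable borel"
    using Gcont by (rule borel_measurable_continuous_onI)
  define s where "s = 1 - l + l * c"
  have s: "s > 0" unfolding s_def using l c by (auto intro!: add_pos_pos)
  define e where "e = (\<lambda>x. (1 - l) + l * \<beta> x)"
  have epos: "e x > 0" for x unfolding e_def using l \<beta>[of x] by (auto intro!: add_pos_pos)
  have mid_e: "\<phi>m (R x) \<le> \<phi>0 x * e x" for x
  proof -
    have "\<phi>m (R x) \<le> (1 - l) * \<phi>0 x + l * \<phi>1 (T x)" unfolding R_def by (rule mid)
    also have "\<dots> = \<phi>0 x * e x" unfolding e_def \<beta>_def using nz[of x] by (simp add: field_simps)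
    finally show ?thesis .
  qed
  have fm_e: "f0 x / e x ^ Suc N \<le> fm (R x)" for x
  proof -
    have "\<phi>m (R x) ^ Suc N \<le> (\<phi>0 x * e x) ^ Suc N"
      by (rule power_mono[OF mid_e]) (use pos less_imp_le in blast)
    then have "1 / (\<phi>0 x * e x) ^ Suc N \<le> 1 / \<phi>m (R x) ^ Suc N"
      using pos[of "R x"] pos[of x] epos[of x] by (intro divide_left_mono mult_pos_pos zero_less_power) auto
    then show ?thesis unfolding f0_def fm_def by (simp only: power_mult_distrib divide_divide_eq_left)
  qed
  have wp: "e x ^ Suc N \<le> R' x * s ^ N" for x
    using weighted_power_convex(1)[OF l c \<beta>[of x] N] unfolding e_def R'_def s_def .
  have key: "f0 x / s ^ N \<le> f0 x / e x ^ Suc N * R' x" for x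
  proof -
    have "f0 x * e x ^ Suc N \<le> f0 x * (R' x * s ^ N)"
      using wp fpos(1)[of x] by (intro mult_left_mono) auto
    then show ?thesis using s epos[of x] by (simp add: field_simps del: power_Suc)
  qed
  have G_ge: "f0 x / s ^ N \<le> G x" for x
    unfolding G_def using key[of x] fm_e[of x] R'pos[of x]
    by (meson less_imp_le mult_right_mono order_trans)
  \<comment> \<open>Substitution on compact intervals yields the mass of \<open>fm\<close> over an
    interval of values of \<open>R\<close>. An inequality suffices here, so \<open>R\<close> is not
    shown to be onto.\<close>
  have GI: "(\<integral>\<^sup>+x. ennreal (G x) \<partial>lborel) \<le> (\<integral>\<^sup>+x. ennreal (fm x) \<partial>lborel)"
  proof (rule nn_integral_le_of_intervals)
    fix n :: nat
    have "(\<integral>\<^sup>+x. ennreal (G x) * indicator {- real n..real n} x \<partial>lborel)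
        = (\<integral>\<^sup>+x. ennreal (fm (R x) * R' x * indicator {- real n..real n} x) \<partial>lborel)"
      by (intro nn_integral_cong) (auto simp: G_def indicator_def)
    also have "\<dots> = (\<integral>\<^sup>+x. ennreal (fm x * indicator {R (- real n)..R (real n)} x) \<partial>lborel)"
      by (rule nn_integral_substitution[symmetric])
        (use Rder R'pos in \<open>auto intro: less_imp_le continuous_on_subset[OF R'cont] simp: set_borel_measurable_def\<close>)
    also have "\<dots> \<le> (\<integral>\<^sup>+x. ennreal (fm x) \<partial>lborel)"
      using fpos by (intro nn_integral_mono) (auto simp: indicator_def less_imp_le)
    finally show "(\<integral>\<^sup>+x. ennreal (G x) * indicator {- real n..real n} x \<partial>lborel)
      \<le> (\<integral>\<^sup>+x. ennreal (fm x) \<partial>lborel)" .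
  qed simp
  have I0: "(\<integral>\<^sup>+x. ennreal (f0 x / s ^ N) \<partial>lborel) = ennreal (1 / ((1 - l) * a + l * b) ^ N)"
  proof -
    have "(\<integral>\<^sup>+x. ennreal (f0 x / s ^ N) \<partial>lborel) = (\<integral>\<^sup>+x. ennreal (1 / s ^ N) * ennreal (f0 x) \<partial>lborel)"
      using s fpos by (intro nn_integral_cong) (simp add: ennreal_mult[symmetric] less_imp_le)
    also have "\<dots> = ennreal (1 / s ^ N) * ennreal (1 / a ^ N)"
      by (subst nn_integral_cmult) (simp_all add: int0')
    also have "\<dots> = ennreal (1 / (s * a) ^ N)"
      using s ab by (simp add: ennreal_mult[symmetric] power_mult_distrib)
    also have "s * a = (1 - l) * a + l * b" unfolding s_def c_def using ab by (simp add: field_simps)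
    finally show ?thesis .
  qed
  show "ennreal (1 / ((1 - l) * a + l * b) ^ N) \<le> (\<integral>\<^sup>+x. ennreal (1 / \<phi>m x ^ Suc N) \<partial>lborel)"
  proof -
    have "(\<integral>\<^sup>+x. ennreal (f0 x / s ^ N) \<partial>lborel) \<le> (\<integral>\<^sup>+x. ennreal (G x) \<partial>lborel)"
      using G_ge by (intro nn_integral_mono ennreal_leI)
    with GI I0 show ?thesis unfolding fm_def by simp
  qed
  assume eq: "(\<integral>\<^sup>+x. ennreal (1 / \<phi>m x ^ Suc N) \<partial>lborel) = ennreal (1 / ((1 - l) * a + l * b) ^ N)"
  have "(\<integral>\<^sup>+x. ennreal (G x) \<partial>lborel) =
      (\<integral>\<^sup>+x. ennreal (f0 x / s ^ N) + ennreal (G x - f0 x / s ^ N) \<partial>lborel)"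
    using G_ge s fpos by (intro nn_integral_cong) (simp add: ennreal_plus[symmetric] less_imp_le del: ennreal_plus)
  also have "\<dots> = (\<integral>\<^sup>+x. ennreal (f0 x / s ^ N) \<partial>lborel) + (\<integral>\<^sup>+x. ennreal (G x - f0 x / s ^ N) \<partial>lborel)"
    by (rule nn_integral_add) auto
  finally have "ennreal (1 / ((1 - l) * a + l * b) ^ N) + (\<integral>\<^sup>+x. ennreal (G x - f0 x / s ^ N) \<partial>lborel)
      \<le> ennreal (1 / ((1 - l) * a + l * b) ^ N) + 0"
    using GI eq I0 unfolding fm_def by simp
  then have "(\<integral>\<^sup>+x. ennreal (G x - f0 x / s ^ N) \<partial>lborel) = 0"
    by (subst (asm) ennreal_add_left_cancel_le) auto
  moreover have "continuous_on UNIV (\<lambda>x. G x - f0 x / s ^ N)"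
    using s by (intro continuous_intros Gcont fcont) auto
  \<comment> \<open>The gap is nonnegative and continuous with integral zero, so equality holds at
    every point and not only almost everywhere.\<close>
  ultimately have "G x - f0 x / s ^ N \<le> 0" for x
    by (intro continuous_nn_integral_zero)
  then have Geq: "G x = f0 x / s ^ N" for x using G_ge[of x] by (intro antisym) auto
  have betac: "\<beta> x = c" for x
  proof -
    \<comment> \<open>This term lies between \<open>f0 x / s ^ N\<close> and \<open>G x\<close>. The
      squeeze gives equality in \<open>weighted_power_convex\<close>, hence
      \<open>\<beta> x = c\<close>.\<close>
    have "f0 x / e x ^ Suc N * R' x \<le> f0 x / s ^ N"
      using fm_e[of x] R'pos[of x] Geq[of x] unfolding G_def by (metis less_imp_le mult_right_mono)
    with key[of x] have "f0 x / e x ^ Suc N * R' x = f0 x / s ^ N" by simp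
    then have "R' x * s ^ N = e x ^ Suc N"
      using fpos(1)[of x] s epos[of x] by (simp add: field_simps del: power_Suc)
    then show ?thesis using weighted_power_convex(2)[OF l c \<beta>[of x] N] unfolding e_def R'_def s_def by simp
  qed
  \<comment> \<open>Now the derivative of \<open>T\<close> is the constant \<open>c\<close>, and
    \<open>w\<close> is the constant of integration.\<close>
  have "((\<lambda>x. T x - c * x) has_real_derivative 0) (at x)" for x
    using c by (auto intro!: derivative_eq_intros T' simp: betac)
  then obtain w where w: "\<And>x. T x - c * x = w"
    using DERIV_isconst_all[of "\<lambda>x. T x - c * x"] by metis
  have Tx: "T x = c * x + w" for x using w[of x] by simp
  have "\<phi>1 (c * x + w) = c * \<phi>0 x \<and> \<phi>m ((1 - l) * x + l * (c * x + w)) = (1 - l + l * c) * \<phi>0 x" for x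
  proof
    show "\<phi>1 (c * x + w) = c * \<phi>0 x"
      using betac[of x] nz[of x] unfolding \<beta>_def Tx by (simp add: field_simps)
    have es: "e x = s" unfolding e_def betac s_def ..
    have "R' x * s ^ N = s ^ Suc N" unfolding R'_def betac s_def using c by simp
    then have "R' x = s" using s by simp
    then have "fm (R x) * s = f0 x / s ^ N" using Geq[of x] unfolding G_def by simp
    then have "\<phi>m (R x) ^ Suc N = (s * \<phi>0 x) ^ Suc N"
      unfolding fm_def f0_def using s nz[of x] nz[of "R x"] by (simp add: field_simps power_mult_distrib)
    then have "\<phi>m (R x) = s * \<phi>0 x"
      using power_inject_base[of "\<phi>m (R x)" N "s * \<phi>0 x"] pos s by (simp add: less_imp_le)
    then show "\<phi>m ((1 - l) * x + l * (c * x + w)) = (1 - l + l * c) * \<phi>0 x"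
      unfolding R_def Tx s_def .
  qed
  then show "\<exists>w. \<forall>x. \<phi>1 (b / a * x + w) = b / a * \<phi>0 x \<and>
        \<phi>m ((1 - l) * x + l * (b / a * x + w)) = (1 - l + l * (b / a)) * \<phi>0 x"
    unfolding c_def by blast
qed

subsection \<open>Iterated integrals over coordinate subspaces\<close>

text \<open>
  The function \<open>itint B f\<close> is defined on the whole space, although it only integrates over \<open>span B\<close>.
  This allows induction on \<open>B\<close> without spaces of varying dimension.
\<close>

definition itint :: "'a::euclidean_space set \<Rightarrow> ('a \<Rightarrow> ennreal) \<Rightarrow> 'a \<Rightarrow> ennreal" where
  "itint B f y = (\<integral>\<^sup>+g. f (y + (\<Sum>b\<in>B. g b *\<^sub>R b)) \<partial>(\<Pi>\<^sub>M b\<in>B. lborel))"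

interpretation lborel_product: product_sigma_finite "\<lambda>b::'a::euclidean_space. lborel :: real measure"
  by standard

lemma itint_empty: "itint {} f y = f y"
  unfolding itint_def by (simp add: PiM_empty nn_integral_count_space_finite)

lemma measurable_line_integral[measurable (raw)]:
  fixes f :: "'a::euclidean_space \<Rightarrow> ennreal"
  assumes [measurable]: "f \<in> borel_measurable borel"
  shows "(\<lambda>y. \<integral>\<^sup>+x. f (y + x *\<^sub>R k) \<partial>lborel) \<in> borel_measurable borel"
  by measurable

lemma measurable_PiM_combination[measurable]:
  "(\<lambda>g. \<Sum>b\<in>B. g b *\<^sub>R b) \<in> borel_measurable (\<Pi>\<^sub>M b\<in>B. (lborel :: real measure))"
  for B :: "'a::euclidean_space set"
  by (intro borel_measurable_sum borel_measurable_scaleR) 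
    (auto intro: measurable_compose[OF measurable_component_singleton])

lemma itint_insert_inner:
  fixes f :: "'a::euclidean_space \<Rightarrow> ennreal"
  assumes [measurable]: "f \<in> borel_measurable borel" and B: "finite B" "k \<notin> B"
  shows "itint (insert k B) f y = itint B (\<lambda>y. \<integral>\<^sup>+x. f (y + x *\<^sub>R k) \<partial>lborel) y"
proof -
  have sum: "(\<Sum>b\<in>insert k B. (g(k := x)) b *\<^sub>R b) = (\<Sum>b\<in>B. g b *\<^sub>R b) + x *\<^sub>R k" for g x
    using B by (simp add: add.commute) (intro sum.cong, auto)
  show ?thesis unfolding itint_def
    by (subst lborel_product.product_nn_integral_insert[OF B], measurable) (simp only: sum add.assoc)
qed

lemma itint_insert_outer:
  fixes f :: "'a::euclidean_space \<Rightarrow> ennreal"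
  assumes [measurable]: "f \<in> borel_measurable borel" and B: "finite B" "k \<notin> B"
  shows "itint (insert k B) f y = (\<integral>\<^sup>+x. itint B f (y + x *\<^sub>R k) \<partial>lborel)"
proof -
  have sum: "y + (\<Sum>b\<in>insert k B. (g(k := x)) b *\<^sub>R b) = y + x *\<^sub>R k + (\<Sum>b\<in>B. g b *\<^sub>R b)" for g x
  proof -
    have "(\<Sum>b\<in>B. (g(k := x)) b *\<^sub>R b) = (\<Sum>b\<in>B. g b *\<^sub>R b)"
      using B by (intro sum.cong) auto
    then show ?thesis using B by simp
  qed
  show ?thesis unfolding itint_def
    by (subst lborel_product.product_nn_integral_insert_rev[OF B], measurable) (simp only: sum)
qed

lemma measurable_itint[measurable (raw)]:
  assumes "f \<in> borel_measurable borel" "finite B"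
  shows "itint B f \<in> borel_measurable borel"
  using assms(2,1)
proof (induction B arbitrary: f rule: finite_induct)
  case empty then show ?case by (simp add: itint_empty[abs_def])
next
  case (insert k B)
  note [measurable] = insert.prems
  have "itint (insert k B) f = itint B (\<lambda>y. \<integral>\<^sup>+x. f (y + x *\<^sub>R k) \<partial>lborel)"
    using insert by (intro ext itint_insert_inner)
  also have "\<dots> \<in> borel_measurable borel" by (rule insert.IH) measurable
  finally show ?case .
qed

section \<open>Change of variables in iterated integrals\<close>

lemma itint_cong:
  assumes "finite B" "\<And>v. v \<in> span B \<Longrightarrow> f (y + v) = g (y + v)"
  shows "itint B f y = itint B g y"
  unfolding itint_def
  by (intro nn_integral_cong assms(2)) (rule span_sum, rule span_scale, rule span_base)

lemma itint_cmult:
  assumes [measurable]: "f \<in> borel_measurable borel"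
  shows "itint B (\<lambda>y. c * f y) y = c * itint B f y"
  unfolding itint_def by (rule nn_integral_cmult) measurable

lemma itint_scale:
  fixes f :: "'a::euclidean_space \<Rightarrow> ennreal"
  assumes "f \<in> borel_measurable borel" "finite B" "t > 0"
  shows "itint B (\<lambda>y. f (t *\<^sub>R y)) y = ennreal (1 / t ^ card B) * itint B f (t *\<^sub>R y)"
  using assms(2,1)
proof (induction B arbitrary: f rule: finite_induct)
  case empty then show ?case by (simp add: itint_empty)
next
  case (insert k B)
  note [measurable] = insert.prems
  have "itint (insert k B) (\<lambda>y. f (t *\<^sub>R y)) y = itint B (\<lambda>y. \<integral>\<^sup>+x. f (t *\<^sub>R (y + x *\<^sub>R k)) \<partial>lborel) y"
    by (rule itint_insert_inner) (use insert in measurable)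
  also have "(\<lambda>y. \<integral>\<^sup>+x. f (t *\<^sub>R (y + x *\<^sub>R k)) \<partial>lborel)
      = (\<lambda>y. ennreal (1 / t) * (\<integral>\<^sup>+x. f (t *\<^sub>R y + x *\<^sub>R k) \<partial>lborel))"
  proof
    fix y
    have "(\<integral>\<^sup>+x. f (t *\<^sub>R y + x *\<^sub>R k) \<partial>lborel)
        = ennreal \<bar>t\<bar> * (\<integral>\<^sup>+x. f (t *\<^sub>R y + (0 + t * x) *\<^sub>R k) \<partial>lborel)"
      by (rule nn_integral_real_affine) (use assms in auto)
    also have "\<dots> = ennreal t * (\<integral>\<^sup>+x. f (t *\<^sub>R (y + x *\<^sub>R k)) \<partial>lborel)"
      using assms by (simp add: scaleR_add_right)
    finally have "ennreal (1 / t) * (\<integral>\<^sup>+x. f (t *\<^sub>R y + x *\<^sub>R k) \<partial>lborel)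
        = (ennreal (1 / t) * ennreal t) * (\<integral>\<^sup>+x. f (t *\<^sub>R (y + x *\<^sub>R k)) \<partial>lborel)"
      by (simp only: mult.assoc)
    also have "ennreal (1 / t) * ennreal t = 1" using assms by (simp add: ennreal_mult[symmetric])
    finally show "(\<integral>\<^sup>+x. f (t *\<^sub>R (y + x *\<^sub>R k)) \<partial>lborel)
        = ennreal (1 / t) * (\<integral>\<^sup>+x. f (t *\<^sub>R y + x *\<^sub>R k) \<partial>lborel)" by simp
  qed
  also have "itint B \<dots> y = ennreal (1 / t) * itint B (\<lambda>y. \<integral>\<^sup>+x. f (t *\<^sub>R y + x *\<^sub>R k) \<partial>lborel) y"
    by (rule itint_cmult) measurable
  also have "itint B (\<lambda>y. \<integral>\<^sup>+x. f (t *\<^sub>R y + x *\<^sub>R k) \<partial>lborel) y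
      = ennreal (1 / t ^ card B) * itint B (\<lambda>y. \<integral>\<^sup>+x. f (y + x *\<^sub>R k) \<partial>lborel) (t *\<^sub>R y)"
    by (rule insert.IH[of "\<lambda>y. \<integral>\<^sup>+x. f (y + x *\<^sub>R k) \<partial>lborel"]) measurable
  also have "itint B (\<lambda>y. \<integral>\<^sup>+x. f (y + x *\<^sub>R k) \<partial>lborel) (t *\<^sub>R y) = itint (insert k B) f (t *\<^sub>R y)"
    by (rule itint_insert_inner[symmetric]) (use insert in auto)
  also have "ennreal (1 / t) * (ennreal (1 / t ^ card B) * itint (insert k B) f (t *\<^sub>R y))
      = ennreal (1 / t ^ card (insert k B)) * itint (insert k B) f (t *\<^sub>R y)"
    using insert assms by (simp add: mult.assoc[symmetric] ennreal_mult[symmetric])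
  finally show ?case .
qed

lemma itint_translate:
  fixes f :: "'a::euclidean_space \<Rightarrow> ennreal"
  assumes "finite B" "f \<in> borel_measurable borel" "w \<in> span B"
  shows "itint B f (y + w) = itint B f y"
  using assms
proof (induction B arbitrary: y w rule: finite_induct)
  case empty then show ?case by simp
next
  case (insert k B)
  note [measurable] = insert.prems(1)
  have m[measurable]: "itint B f \<in> borel_measurable borel" using insert by (intro measurable_itint)
  obtain \<alpha> where \<alpha>: "w - \<alpha> *\<^sub>R k \<in> span B" using insert.prems span_breakdown_eq by blast
  have "itint (insert k B) f (y + w) = (\<integral>\<^sup>+x. itint B f ((y + (\<alpha> + 1 * x) *\<^sub>R k) + (w - \<alpha> *\<^sub>R k)) \<partial>lborel)"
    by (subst itint_insert_outer) (use insert in \<open>auto simp: algebra_simps\<close>)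
  also have "\<dots> = (\<integral>\<^sup>+x. itint B f (y + (\<alpha> + 1 * x) *\<^sub>R k) \<partial>lborel)"
    using insert.IH[OF insert.prems(1) \<alpha>] by simp
  also have "\<dots> = (\<integral>\<^sup>+x. itint B f (y + x *\<^sub>R k) \<partial>lborel)"
    using nn_integral_real_affine[of "\<lambda>x. itint B f (y + x *\<^sub>R k)" 1 \<alpha>] by simp
  also have "\<dots> = itint (insert k B) f y"
    by (subst itint_insert_outer) (use insert in auto)
  finally show ?case .
qed

lemma nn_integral_lborel_slices:
  fixes f :: "'a::euclidean_space \<Rightarrow> ennreal"
  assumes [measurable]: "f \<in> borel_measurable borel" and e: "e \<in> Basis"
  shows "(\<integral>\<^sup>+y. f y \<partial>lborel) = (\<integral>\<^sup>+r. itint (Basis - {e}) f (r *\<^sub>R e) \<partial>lborel)"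
    and "(\<integral>\<^sup>+y. f y \<partial>lborel) = itint (Basis - {e}) (\<lambda>y. \<integral>\<^sup>+r. f (y + r *\<^sub>R e) \<partial>lborel) 0"
proof -
  have *: "(\<integral>\<^sup>+y. f y \<partial>lborel) = itint (insert e (Basis - {e})) f 0"
    using e unfolding itint_def by (subst lborel_eq) (simp add: nn_integral_distr insert_absorb)
  show "(\<integral>\<^sup>+y. f y \<partial>lborel) = (\<integral>\<^sup>+r. itint (Basis - {e}) f (r *\<^sub>R e) \<partial>lborel)"
    unfolding * by (subst itint_insert_outer) auto
  show "(\<integral>\<^sup>+y. f y \<partial>lborel) = itint (Basis - {e}) (\<lambda>y. \<integral>\<^sup>+r. f (y + r *\<^sub>R e) \<partial>lborel) 0"
    unfolding * by (subst itint_insert_inner) auto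
qed

subsection \<open>The Borell-Brascamp-Lieb inequality with its equality case\<close>

text \<open>The sum of the second differences along a subdivision telescopes and tends to \<open>0\<close> with the mesh.\<close>

lemma constant_if_small_second_differences:
  fixes g \<omega> :: "real \<Rightarrow> real"
  assumes conv: "convex_on UNIV g" and c: "c > 0" and K: "K \<ge> 0"
    and le: "\<And>s \<epsilon>. 0 \<le> s \<Longrightarrow> s \<le> 1 \<Longrightarrow> \<epsilon> > 0 \<Longrightarrow>
      \<bar>\<omega> (s + \<epsilon>) - \<omega> s\<bar> \<le> K * (g (s - c * \<epsilon>) + c * g (s + \<epsilon>) - (1 + c) * g s)"
  shows "\<omega> 1 = \<omega> 0"
proof -
  \<comment> \<open>The uneven steps \<open>c * \<epsilon>\<close> and \<open>\<epsilon>\<close> are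
    replaced by a common step \<open>m * \<epsilon>\<close>: difference quotients of a convex
    function at \<open>s\<close> grow with the step. An integer \<open>m\<close> keeps the points on
    the grid of mesh \<open>1 / n\<close>.\<close>
  obtain m :: nat where m: "real m \<ge> max 1 c" using real_arch_simple by blast
  have m0: "real m > 0" "real m \<ge> 1" "real m \<ge> c" using m by auto
  have cont: "isCont g x" for x
    using convex_on_continuous[OF open_UNIV conv] by (simp add: continuous_on_eq_continuous_at)
  have cv: "g ((1 - t) * x + t * y) \<le> (1 - t) * g x + t * g y" if "0 \<le> t" "t \<le> 1" for t x y
    using convex_onD[OF conv that, of x y] by simp
  have step: "\<bar>\<omega> (s + \<epsilon>) - \<omega> s\<bar> \<le> K * (c / real m) * (g (s + real m * \<epsilon>) + g (s - real m * \<epsilon>) - 2 * g s)"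
    if s: "0 \<le> s" "s \<le> 1" "\<epsilon> > 0" for s \<epsilon> :: real
  proof -
    have "g ((1 - c / real m) * s + c / real m * (s - real m * \<epsilon>)) \<le> (1 - c / real m) * g s + c / real m * g (s - real m * \<epsilon>)"
      using m0 c by (intro cv) auto
    also have "(1 - c / real m) * s + c / real m * (s - real m * \<epsilon>) = s - c * \<epsilon>" using m0 by (simp add: field_simps)
    finally have 1: "g (s - c * \<epsilon>) - g s \<le> c / real m * (g (s - real m * \<epsilon>) - g s)" by (simp add: algebra_simps)
    have "g ((1 - 1 / real m) * s + 1 / real m * (s + real m * \<epsilon>)) \<le> (1 - 1 / real m) * g s + 1 / real m * g (s + real m * \<epsilon>)"
      using m0 by (intro cv) auto
    also have "(1 - 1 / real m) * s + 1 / real m * (s + real m * \<epsilon>) = s + \<epsilon>" using m0 by (simp add: field_simps)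
    finally have "g (s + \<epsilon>) - g s \<le> 1 / real m * (g (s + real m * \<epsilon>) - g s)" by (simp add: algebra_simps)
    then have 2: "c * (g (s + \<epsilon>) - g s) \<le> c * (1 / real m * (g (s + real m * \<epsilon>) - g s))"
      using c by (intro mult_left_mono) auto
    have "g (s - c * \<epsilon>) + c * g (s + \<epsilon>) - (1 + c) * g s = (g (s - c * \<epsilon>) - g s) + c * (g (s + \<epsilon>) - g s)"
      by (simp add: algebra_simps)
    also have "\<dots> \<le> c / real m * (g (s - real m * \<epsilon>) - g s) + c * (1 / real m * (g (s + real m * \<epsilon>) - g s))"
      using 1 2 by linarith
    also have "\<dots> = (c / real m) * (g (s + real m * \<epsilon>) + g (s - real m * \<epsilon>) - 2 * g s)"
      by (simp add: algebra_simps)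
    finally have "K * (g (s - c * \<epsilon>) + c * g (s + \<epsilon>) - (1 + c) * g s)
      \<le> K * ((c / real m) * (g (s + real m * \<epsilon>) + g (s - real m * \<epsilon>) - 2 * g s))"
      using K by (rule mult_left_mono)
    with le[OF s] show ?thesis by simp
  qed
  \<comment> \<open>A forward difference over \<open>m\<close> grid cells. The second difference at
    \<open>j\<close> is \<open>d n j - d n (j - m)\<close>; split into \<open>m\<close> unit steps
    and summed over \<open>j\<close>, it leaves the boundary terms of \<open>S\<close>, whose points
    all approach \<open>0\<close> or \<open>1\<close>.\<close>
  define d where "d = (\<lambda>n s. g ((s + real m) / real n) - g (s / real n))"
  define S where "S = (\<lambda>n. \<Sum>i<m. d n (real n - 1 - real i) - d n (- 1 - real i))"
  have bound: "\<bar>\<omega> 1 - \<omega> 0\<bar> \<le> K * (c / m) * S n" if n: "n \<ge> 1" for n :: nat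
  proof -
    have "\<omega> 1 - \<omega> 0 = (\<Sum>j<n. \<omega> (real (Suc j) / n) - \<omega> (real j / n))"
      using n by (subst sum_lessThan_telescope) auto
    then have "\<bar>\<omega> 1 - \<omega> 0\<bar> \<le> (\<Sum>j<n. \<bar>\<omega> (real (Suc j) / n) - \<omega> (real j / n)\<bar>)"
      by (simp only: sum_abs)
    also have "\<dots> \<le> (\<Sum>j<n. K * (c / m) * (d n (real j) - d n (real j - real m)))"
    proof (rule sum_mono)
      fix j assume "j \<in> {..<n}"
      then have "\<bar>\<omega> (real j / n + 1 / n) - \<omega> (real j / n)\<bar> \<le> K * (c / m) *
          (g (real j / n + real m * (1 / n)) + g (real j / n - real m * (1 / n)) - 2 * g (real j / n))"
        by (intro step) auto
      moreover have "real j / n + 1 / n = real (Suc j) / n" by (simp add: add_divide_distrib)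
      ultimately show "\<bar>\<omega> (real (Suc j) / n) - \<omega> (real j / n)\<bar> \<le> K * (c / m) * (d n (real j) - d n (real j - real m))"
        unfolding d_def by (simp add: add_divide_distrib diff_divide_distrib)
    qed
    also have "\<dots> = K * (c / m) * (\<Sum>j<n. d n (real j) - d n (real j - real m))"
      by (simp only: sum_distrib_left)
    also have "(\<Sum>j<n. d n (real j) - d n (real j - real m))
        = (\<Sum>j<n. \<Sum>i<m. d n (real j - real i) - d n (real j - real (Suc i)))"
      by (subst sum_lessThan_telescope') auto
    also have "\<dots> = (\<Sum>i<m. \<Sum>j<n. d n (real (Suc j) - 1 - real i) - d n (real j - 1 - real i))"
      by (subst sum.swap) (intro sum.cong refl, simp add: algebra_simps)
    also have "\<dots> = S n"
      unfolding S_def by (subst sum_lessThan_telescope) auto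
    finally show ?thesis .
  qed
  have lim: "S \<longlonglongrightarrow> 0"
  proof -
    have f0: "(\<lambda>n. (r + s * real n) / real n) \<longlonglongrightarrow> s" for r s
    proof -
      have "(\<lambda>n. r * (1 / real n) + s) \<longlonglongrightarrow> r * 0 + s"
        by (intro tendsto_intros lim_1_over_n)
      moreover have "\<forall>\<^sub>F n in sequentially. r * (1 / real n) + s = (r + s * real n) / real n"
        using eventually_gt_at_top[of 0] by eventually_elim (simp add: field_simps)
      ultimately show ?thesis by (simp add: tendsto_cong)
    qed
    have f: "(\<lambda>n. g ((r + s * real n) / real n)) \<longlonglongrightarrow> g s" for r s
      by (rule isCont_tendsto_compose[OF cont f0])
    have "S \<longlonglongrightarrow> (\<Sum>i<m. (g 1 - g 1) - (g 0 - g 0))"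
      unfolding S_def d_def
    proof (intro tendsto_sum tendsto_diff)
      fix i
      show "(\<lambda>n. g ((real n - 1 - real i + real m) / real n)) \<longlonglongrightarrow> g 1"
        using f[of "- 1 - real i + real m" 1] by (simp add: algebra_simps)
      show "(\<lambda>n. g ((real n - 1 - real i) / real n)) \<longlonglongrightarrow> g 1"
        using f[of "- 1 - real i" 1] by (simp add: algebra_simps)
      show "(\<lambda>n. g ((- 1 - real i + real m) / real n)) \<longlonglongrightarrow> g 0"
        using f[of "- 1 - real i + real m" 0] by (simp add: algebra_simps)
      show "(\<lambda>n. g ((- 1 - real i) / real n)) \<longlonglongrightarrow> g 0"
        using f[of "- 1 - real i" 0] by (simp add: algebra_simps)
    qed
    then show ?thesis by simp
  qed
  have "(\<lambda>n. K * (c / m) * S n) \<longlonglongrightarrow> K * (c / m) * 0"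
    by (intro tendsto_intros lim)
  then have "\<bar>\<omega> 1 - \<omega> 0\<bar> \<le> K * (c / m) * 0"
    using bound by (intro LIMSEQ_le_const) auto
  then show ?thesis by simp
qed

text \<open>
  Equality on every line in direction \<open>k\<close> leaves a shift \<open>\<omega>\<close> that may depend on the line. Far out on
  the lines \<open>\<phi>0\<close> has a definite slope, so the midpoint inequality, applied to neighbouring lines
  there, bounds the increments of \<open>\<omega>\<close> by second differences of a convex function.
\<close>

lemma marginal_shift_constant:
  fixes \<phi>0 \<phi>1 \<phi>m :: "'a::euclidean_space \<Rightarrow> real" and \<omega> :: "'a \<Rightarrow> real"
  assumes conv: "convex_on UNIV \<phi>0" and \<delta>: "\<delta> > 0" and growth: "\<And>y. \<delta> * \<bar>y \<bullet> k\<bar> \<le> \<phi>0 y"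
    and k: "norm k = 1" and S: "subspace S" "\<And>W. W \<in> S \<Longrightarrow> W \<bullet> k = 0" and c: "c > 0"
    and T1: "\<And>W x. W \<in> S \<Longrightarrow> \<phi>1 (c *\<^sub>R W + w + (c * x + \<omega> W) *\<^sub>R k) = c * \<phi>0 (W + x *\<^sub>R k)"
    and Tm: "\<And>W x. W \<in> S \<Longrightarrow>
      \<phi>m ((1/2) *\<^sub>R ((W + x *\<^sub>R k) + (c *\<^sub>R W + w + (c * x + \<omega> W) *\<^sub>R k))) = (1 + c) / 2 * \<phi>0 (W + x *\<^sub>R k)"
    and mid: "\<And>U V. \<phi>m ((1/2) *\<^sub>R (U + V)) \<le> (\<phi>0 U + \<phi>1 V) / 2"
    and W: "W \<in> S"
  shows "\<omega> W = \<omega> 0"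
proof -
  have cv: "\<phi>0 ((1 - t) *\<^sub>R x + t *\<^sub>R y) \<le> (1 - t) * \<phi>0 x + t * \<phi>0 y" if "0 \<le> t" "t \<le> 1" for t x y
    using convex_onD[OF conv that, of x y] by simp
  have kk: "k \<bullet> k = 1" using k by (simp add: norm_eq_1)
  have nn: "\<phi>0 y \<ge> 0" for y using growth[of y] \<delta> by (meson abs_ge_zero less_imp_le mult_nonneg_nonneg order_trans)
  \<comment> \<open>By convexity an upper bound for \<open>\<phi>0\<close> on the whole segment from
    \<open>0\<close> to \<open>W\<close>.\<close>
  define C where "C = \<phi>0 0 + \<phi>0 W"
  have C: "C \<ge> 0" unfolding C_def using nn by simp
  have Cs: "\<phi>0 (s *\<^sub>R W) \<le> C" if "0 \<le> s" "s \<le> 1" for s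
  proof -
    have "\<phi>0 (s *\<^sub>R W) \<le> (1 - s) * \<phi>0 0 + s * \<phi>0 W" using cv[OF that, of 0 W] by simp
    also have "\<dots> \<le> 1 * \<phi>0 0 + 1 * \<phi>0 W" using that nn by (intro add_mono mult_right_mono) auto
    finally show ?thesis unfolding C_def by simp
  qed
  \<comment> \<open>At distance \<open>X\<close> in direction \<open>k\<close> the growth gives
    \<open>\<phi>0 \<ge> \<delta> * X \<ge> 2 * C\<close>, so convexity forces an outward slope of
    at least \<open>\<delta> / 2\<close> beyond it, uniformly along the segment.\<close>
  define X where "X = 2 * C / \<delta> + 1"
  have X: "X > 0" "C \<le> \<delta> * X / 2" unfolding X_def using C \<delta> by (auto simp: field_simps add_pos_nonneg add_nonneg_pos)
  have slope: "\<phi>0 (s *\<^sub>R W + (\<sigma> * X) *\<^sub>R k) + \<delta> / 2 * \<eta> \<le> \<phi>0 (s *\<^sub>R W + (\<sigma> * (X + \<eta>)) *\<^sub>R k)"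
    if s: "0 \<le> s" "s \<le> 1" and \<eta>: "\<eta> \<ge> 0" and \<sigma>: "\<bar>\<sigma>\<bar> = 1" for s \<eta> \<sigma>
  proof -
    define A where "A = \<phi>0 (s *\<^sub>R W + (\<sigma> * X) *\<^sub>R k)"
    define B where "B = \<phi>0 (s *\<^sub>R W + (\<sigma> * (X + \<eta>)) *\<^sub>R k)"
    define t where "t = X / (X + \<eta>)"
    have t: "0 \<le> t" "t \<le> 1" unfolding t_def using X \<eta> by auto
    have tX: "t * (X + \<eta>) = X" unfolding t_def using X \<eta> by auto
    have "\<phi>0 ((1 - t) *\<^sub>R (s *\<^sub>R W) + t *\<^sub>R (s *\<^sub>R W + (\<sigma> * (X + \<eta>)) *\<^sub>R k)) \<le> (1 - t) * \<phi>0 (s *\<^sub>R W) + t * B"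
      unfolding B_def by (rule cv[OF t])
    also have "(1 - t) *\<^sub>R (s *\<^sub>R W) + t *\<^sub>R (s *\<^sub>R W + (\<sigma> * (X + \<eta>)) *\<^sub>R k) = s *\<^sub>R W + (\<sigma> * (t * (X + \<eta>))) *\<^sub>R k"
      by (simp add: algebra_simps)
    finally have "A \<le> (1 - t) * \<phi>0 (s *\<^sub>R W) + t * B" unfolding tX A_def .
    also have "\<dots> \<le> (1 - t) * C + t * B" using Cs[OF s] t by (intro add_mono mult_left_mono) auto
    finally have "A * (X + \<eta>) \<le> ((1 - t) * C + t * B) * (X + \<eta>)" using X \<eta> by (intro mult_right_mono) auto
    also have "\<dots> = (X + \<eta>) * C - t * (X + \<eta>) * C + t * (X + \<eta>) * B" by (simp add: algebra_simps)
    also have "\<dots> = \<eta> * C + X * B" unfolding tX by (simp add: algebra_simps)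
    finally have 1: "X * A + \<eta> * A - \<eta> * C \<le> X * B" by (simp add: algebra_simps)
    have "\<delta> * X \<le> A"
    proof -
      have "(s *\<^sub>R W + (\<sigma> * X) *\<^sub>R k) \<bullet> k = \<sigma> * X" using S(2)[OF W] kk by (simp add: inner_add_left)
      then have "\<delta> * \<bar>\<sigma> * X\<bar> \<le> A" unfolding A_def using growth by metis
      then show ?thesis using \<sigma> X by (simp add: abs_mult)
    qed
    then have "\<eta> * (\<delta> * X / 2) \<le> \<eta> * (A - C)" using X \<eta> by (intro mult_left_mono) auto
    with 1 have "X * A + \<eta> * (\<delta> * X / 2) \<le> X * B" by (simp add: algebra_simps)
    then have "X * (A + \<delta> / 2 * \<eta>) \<le> X * B" by (simp add: algebra_simps)
    then show ?thesis using X unfolding A_def B_def by simp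
  qed
  \<comment> \<open>Both ends \<open>X\<close> and \<open>- X\<close> are added, because the sign of
    the increment of \<open>\<omega>\<close> decides at which of them the slope is felt.\<close>
  define g where "g = (\<lambda>s. \<phi>0 (s *\<^sub>R W + X *\<^sub>R k) + \<phi>0 (s *\<^sub>R W + (- X) *\<^sub>R k))"
  have line: "convex_on UNIV (\<lambda>s. \<phi>0 (s *\<^sub>R W + v))" for v
  proof (rule convex_onI)
    fix t x y :: real assume "0 < t" "t < 1"
    then show "\<phi>0 (((1 - t) *\<^sub>R x + t *\<^sub>R y) *\<^sub>R W + v) \<le> (1 - t) * \<phi>0 (x *\<^sub>R W + v) + t * \<phi>0 (y *\<^sub>R W + v)"
      using cv[of t "x *\<^sub>R W + v" "y *\<^sub>R W + v"] by (simp add: algebra_simps)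
  qed auto
  have comb: "(1 - t) *\<^sub>R (a *\<^sub>R W + v) + t *\<^sub>R (b *\<^sub>R W + v) = ((1 - t) * a + t * b) *\<^sub>R W + v" for t a b v
    by (simp add: algebra_simps)
  have second: "0 \<le> \<phi>0 ((s - c * \<epsilon>) *\<^sub>R W + v) + c * \<phi>0 ((s + \<epsilon>) *\<^sub>R W + v) - (1 + c) * \<phi>0 (s *\<^sub>R W + v)" for s \<epsilon> v
  proof -
    define q A B where "q = c / (1 + c)" and "A = \<phi>0 ((s - c * \<epsilon>) *\<^sub>R W + v)" and "B = \<phi>0 ((s + \<epsilon>) *\<^sub>R W + v)"
    have q: "0 \<le> q" "q \<le> 1" "(1 + c) * q = c" unfolding q_def using c by auto
    have q': "(1 + c) * (1 - q) = 1" unfolding right_diff_distrib q(3) by simp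
    have split: "(1 + c) * ((1 - q) * x + q * y) = x + c * y" for x y
    proof -
      have "(1 + c) * ((1 - q) * x + q * y) = ((1 + c) * (1 - q)) * x + ((1 + c) * q) * y"
        by (simp only: distrib_left mult.assoc)
      then show ?thesis unfolding q q' by simp
    qed
    have s: "(1 - q) * (s - c * \<epsilon>) + q * (s + \<epsilon>) = s"
    proof -
      have "(1 + c) * ((1 - q) * (s - c * \<epsilon>) + q * (s + \<epsilon>)) = (1 + c) * s"
        unfolding split by (simp add: algebra_simps)
      then show ?thesis using c by simp
    qed
    have "\<phi>0 (s *\<^sub>R W + v) \<le> (1 - q) * A + q * B"
      using cv[OF q(1,2), of "(s - c * \<epsilon>) *\<^sub>R W + v" "(s + \<epsilon>) *\<^sub>R W + v"] unfolding comb s A_def B_def .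
    then have "(1 + c) * \<phi>0 (s *\<^sub>R W + v) \<le> (1 + c) * ((1 - q) * A + q * B)"
      using c by (intro mult_left_mono) auto
    then show ?thesis unfolding split A_def B_def by simp
  qed
  \<comment> \<open>\<open>U\<close> lies over \<open>s - c * \<epsilon>\<close>, and
    \<open>V\<close> is the image of a point over \<open>s + \<epsilon>\<close>. Their sum is that
    of a point over \<open>s\<close> and its own image, except that the height is shifted by the
    increment of \<open>\<omega>\<close> divided by \<open>1 + c\<close>.\<close>
  have cmp: "(1 + c) * \<phi>0 (s *\<^sub>R W + (x + (\<omega> ((s + \<epsilon>) *\<^sub>R W) - \<omega> (s *\<^sub>R W)) / (1 + c)) *\<^sub>R k)
      \<le> \<phi>0 ((s - c * \<epsilon>) *\<^sub>R W + x *\<^sub>R k) + c * \<phi>0 ((s + \<epsilon>) *\<^sub>R W + x *\<^sub>R k)" for s \<epsilon> x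
  proof -
    have inS: "r *\<^sub>R W \<in> S" for r using S(1) W by (rule subspace_scale)
    define \<eta> where "\<eta> = (\<omega> ((s + \<epsilon>) *\<^sub>R W) - \<omega> (s *\<^sub>R W)) / (1 + c)"
    have \<eta>: "\<omega> ((s + \<epsilon>) *\<^sub>R W) = \<omega> (s *\<^sub>R W) + (1 + c) * \<eta>" unfolding \<eta>_def using c by simp
    define U where "U = (s - c * \<epsilon>) *\<^sub>R W + x *\<^sub>R k"
    define V where "V = c *\<^sub>R ((s + \<epsilon>) *\<^sub>R W) + w + (c * x + \<omega> ((s + \<epsilon>) *\<^sub>R W)) *\<^sub>R k"
    have "U + V = (s *\<^sub>R W + (x + \<eta>) *\<^sub>R k) + (c *\<^sub>R (s *\<^sub>R W) + w + (c * (x + \<eta>) + \<omega> (s *\<^sub>R W)) *\<^sub>R k)"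
      unfolding U_def V_def \<eta> by (simp add: algebra_simps)
    then have "(1 + c) / 2 * \<phi>0 (s *\<^sub>R W + (x + \<eta>) *\<^sub>R k) \<le> (\<phi>0 U + \<phi>1 V) / 2"
      using mid[of U V] Tm[OF inS, of s "x + \<eta>"] by simp
    also have "\<phi>1 V = c * \<phi>0 ((s + \<epsilon>) *\<^sub>R W + x *\<^sub>R k)" unfolding V_def by (rule T1[OF inS])
    finally show ?thesis unfolding U_def \<eta>_def by simp
  qed
  have "(\<lambda>s. \<omega> (s *\<^sub>R W)) 1 = (\<lambda>s. \<omega> (s *\<^sub>R W)) 0"
  proof (rule constant_if_small_second_differences[where g=g and c=c and K="2 / \<delta>"])
    show "convex_on UNIV g" unfolding g_def by (intro convex_on_add line)
    fix s \<epsilon> :: real assume s: "0 \<le> s" "s \<le> 1" and "\<epsilon> > 0"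
    define \<eta> where "\<eta> = (\<omega> ((s + \<epsilon>) *\<^sub>R W) - \<omega> (s *\<^sub>R W)) / (1 + c)"
    have ab: "\<bar>\<omega> ((s + \<epsilon>) *\<^sub>R W) - \<omega> (s *\<^sub>R W)\<bar> = (1 + c) * \<bar>\<eta>\<bar>" 
    proof -
      have "\<omega> ((s + \<epsilon>) *\<^sub>R W) - \<omega> (s *\<^sub>R W) = (1 + c) * \<eta>" unfolding \<eta>_def using c by simp
      then show ?thesis using c by (simp add: abs_mult)
    qed
    define E where "E = (\<lambda>x. \<phi>0 ((s - c * \<epsilon>) *\<^sub>R W + x *\<^sub>R k) + c * \<phi>0 ((s + \<epsilon>) *\<^sub>R W + x *\<^sub>R k)
        - (1 + c) * \<phi>0 (s *\<^sub>R W + x *\<^sub>R k))"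
    have E0: "E x \<ge> 0" for x unfolding E_def by (rule second)
    \<comment> \<open>The end at which a shift by \<open>\<eta>\<close> points outward.\<close>
    define \<sigma> :: real where "\<sigma> = (if \<eta> \<ge> 0 then 1 else - 1)"
    have \<sigma>: "\<bar>\<sigma>\<bar> = 1" "\<sigma> * \<bar>\<eta>\<bar> = \<eta>" "\<sigma> = 1 \<or> \<sigma> = - 1" unfolding \<sigma>_def by auto
    have "\<phi>0 (s *\<^sub>R W + (\<sigma> * X) *\<^sub>R k) + \<delta> / 2 * \<bar>\<eta>\<bar> \<le> \<phi>0 (s *\<^sub>R W + (\<sigma> * X + \<eta>) *\<^sub>R k)"
      using slope[OF s, of "\<bar>\<eta>\<bar>" \<sigma>] \<sigma>(1,2) by (simp add: distrib_left)
    then have "(1 + c) * (\<phi>0 (s *\<^sub>R W + (\<sigma> * X) *\<^sub>R k) + \<delta> / 2 * \<bar>\<eta>\<bar>) \<le> (1 + c) * \<phi>0 (s *\<^sub>R W + (\<sigma> * X + \<eta>) *\<^sub>R k)"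
      using c by (intro mult_left_mono) auto
    also have "\<dots> \<le> \<phi>0 ((s - c * \<epsilon>) *\<^sub>R W + (\<sigma> * X) *\<^sub>R k) + c * \<phi>0 ((s + \<epsilon>) *\<^sub>R W + (\<sigma> * X) *\<^sub>R k)"
      using cmp[of s "\<sigma> * X" \<epsilon>] unfolding \<eta>_def .
    finally have "\<delta> / 2 * ((1 + c) * \<bar>\<eta>\<bar>) \<le> E (\<sigma> * X)"
      unfolding E_def distrib_left by (simp add: mult.left_commute)
    also have "\<dots> \<le> E X + E (- X)" using \<sigma>(3) by (elim disjE) (simp_all add: E0)
    also have "\<dots> = g (s - c * \<epsilon>) + c * g (s + \<epsilon>) - (1 + c) * g s" unfolding E_def g_def by (simp add: distrib_left)
    finally have "\<delta> / 2 * ((1 + c) * \<bar>\<eta>\<bar>) \<le> g (s - c * \<epsilon>) + c * g (s + \<epsilon>) - (1 + c) * g s" .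
    then have "2 / \<delta> * (\<delta> / 2 * ((1 + c) * \<bar>\<eta>\<bar>)) \<le> 2 / \<delta> * (g (s - c * \<epsilon>) + c * g (s + \<epsilon>) - (1 + c) * g s)"
      using \<delta> by (intro mult_left_mono) auto
    then show "\<bar>\<omega> ((s + \<epsilon>) *\<^sub>R W) - \<omega> (s *\<^sub>R W)\<bar> \<le> 2 / \<delta> * (g (s - c * \<epsilon>) + c * g (s + \<epsilon>) - (1 + c) * g s)"
      unfolding ab using \<delta> by simp
  qed (use c \<delta> in auto)
  then show ?thesis by simp
qed

text \<open>Linear growth in the coordinates of \<open>B\<close> makes the power with exponent
  \<open>- Suc (card B)\<close> integrable over \<open>span B\<close>. The summand \<open>1\<close>
  keeps \<open>\<phi>\<close> away from zero; in the charts it is the modulus of the fixed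
  coordinate along \<open>e\<close>. Convexity is required on the whole space, to match
  \<open>itint\<close>.\<close>

definition coercive_convex :: "'a::euclidean_space set \<Rightarrow> ('a \<Rightarrow> real) \<Rightarrow> bool" where
  "coercive_convex B \<phi> \<longleftrightarrow> convex_on UNIV \<phi> \<and> (\<exists>\<delta>>0. \<forall>y. \<delta> * (1 + (\<Sum>b\<in>B. \<bar>y \<bullet> b\<bar>)) \<le> \<phi> y)"

lemma ennreal_inverse_power_le_imp:
  fixes x y :: real
  assumes "ennreal (1 / x ^ N) \<le> ennreal (1 / y ^ N)" and pos: "x > 0" "y > 0" and "N \<ge> 1"
  shows "y \<le> x"
proof (rule ccontr)
  assume "\<not> y \<le> x"
  then have "x ^ N < y ^ N" using assms by (intro power_strict_mono) auto
  then have "1 / y ^ N < 1 / x ^ N" using pos by (intro divide_strict_left_mono mult_pos_pos zero_less_power) auto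
  then have "ennreal (1 / y ^ N) < ennreal (1 / x ^ N)" using pos by (intro ennreal_lessI) auto
  with assms(1) show False by (rule leD[THEN notE])
qed

lemma coercive_convex_pos:
  assumes "coercive_convex B \<phi>" shows "\<phi> y > 0"
proof -
  obtain \<delta> where \<delta>: "\<delta> > 0" "\<delta> * (1 + (\<Sum>b\<in>B. \<bar>y \<bullet> b\<bar>)) \<le> \<phi> y"
    using assms unfolding coercive_convex_def by blast
  have "0 < \<delta> * (1 + (\<Sum>b\<in>B. \<bar>y \<bullet> b\<bar>))"
    using \<delta>(1) by (intro mult_pos_pos add_pos_nonneg sum_nonneg) auto
  with \<delta>(2) show ?thesis by simp
qed

lemma coercive_convex_continuous: "coercive_convex B \<phi> \<Longrightarrow> continuous_on UNIV \<phi>"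
  unfolding coercive_convex_def using convex_on_continuous[OF open_UNIV] by blast

lemma measurable_inverse_power_coercive_convex:
  assumes "coercive_convex B \<phi>"
  shows "(\<lambda>y. ennreal (1 / \<phi> y ^ n)) \<in> borel_measurable borel"
proof -
  have [measurable]: "\<phi> \<in> borel_measurable borel"
    using coercive_convex_continuous[OF assms] by (rule borel_measurable_continuous_onI)
  show ?thesis by measurable
qed

text \<open>The exponent drops by one through the substitution of \<open>g * x\<close> for
  \<open>x\<close>. This model integral turns linear growth of a function along lines into linear
  growth of its marginal.\<close>

lemma nn_integral_inverse_power_finite:
  assumes "N \<ge> 1"
  obtains C where "C > 0" "\<And>g. g > 0 \<Longrightarrow>
    (\<integral>\<^sup>+x. ennreal (1 / (g + \<bar>x\<bar>) ^ Suc N) \<partial>lborel) = ennreal (C / g ^ N)"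
proof -
  define J where "J = (\<integral>\<^sup>+x. ennreal (1 / (1 + \<bar>x\<bar>) ^ Suc N) \<partial>(lborel :: real measure))"
  have "set_integrable lborel (einterval (- \<infinity>) \<infinity>) (\<lambda>x. inverse (1 + x\<^sup>2))"
    by (rule integrable_inverse_1_plus_square)
  then have "integrable lborel (\<lambda>x. inverse (1 + x\<^sup>2) :: real)"
    by (simp add: set_integrable_def einterval_def)
  then have fin: "(\<integral>\<^sup>+x. ennreal (inverse (1 + x\<^sup>2)) \<partial>(lborel :: real measure)) < \<infinity>"
    by (subst nn_integral_eq_integral) auto
  have "J \<le> (\<integral>\<^sup>+x. ennreal (inverse (1 + x\<^sup>2)) \<partial>(lborel :: real measure))"
    unfolding J_def
  proof (intro nn_integral_mono ennreal_leI)
    fix x :: real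
    have "1 + x\<^sup>2 \<le> (1 + \<bar>x\<bar>)\<^sup>2" by (simp add: power2_sum)
    also have "\<dots> \<le> (1 + \<bar>x\<bar>) ^ Suc N" using assms by (intro power_increasing) auto
    finally show "1 / (1 + \<bar>x\<bar>) ^ Suc N \<le> inverse (1 + x\<^sup>2)"
      unfolding inverse_eq_divide by (intro divide_left_mono mult_pos_pos) (auto intro!: add_pos_nonneg simp del: power_Suc)
  qed
  then have "J < \<infinity>" using fin by (rule le_less_trans)
  moreover have "J \<noteq> 0"
  proof
    assume "J = 0"
    moreover have "continuous_on UNIV (\<lambda>x::real. 1 / (1 + \<bar>x\<bar>) ^ Suc N)"
      by (intro continuous_intros) (auto simp: add_nonneg_eq_0_iff)
    ultimately have "1 / (1 + \<bar>0::real\<bar>) ^ Suc N \<le> 0"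
      unfolding J_def by (intro continuous_nn_integral_zero)
    then show False by simp
  qed
  ultimately obtain C where C: "J = ennreal C" "C > 0"
    by (cases J rule: ennreal_cases) (auto simp: ennreal_eq_0_iff)
  show thesis
  proof (rule that[OF C(2)])
    fix g :: real assume g: "g > 0"
    have "(\<integral>\<^sup>+x. ennreal (1 / (g + \<bar>x\<bar>) ^ Suc N) \<partial>lborel)
        = ennreal \<bar>g\<bar> * (\<integral>\<^sup>+x. ennreal (1 / (g + \<bar>0 + g * x\<bar>) ^ Suc N) \<partial>lborel)"
      using g by (intro nn_integral_real_affine) auto
    also have "(\<lambda>x. ennreal (1 / (g + \<bar>0 + g * x\<bar>) ^ Suc N)) = (\<lambda>x. ennreal (1 / g ^ Suc N) * ennreal (1 / (1 + \<bar>x\<bar>) ^ Suc N))"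
    proof
      fix x
      have "g + \<bar>0 + g * x\<bar> = g * (1 + \<bar>x\<bar>)" using g by (simp add: abs_mult algebra_simps)
      then show "ennreal (1 / (g + \<bar>0 + g * x\<bar>) ^ Suc N) = ennreal (1 / g ^ Suc N) * ennreal (1 / (1 + \<bar>x\<bar>) ^ Suc N)"
        using g by (simp only: power_mult_distrib) (simp add: ennreal_mult[symmetric] del: power_Suc)
    qed
    also have "(\<integral>\<^sup>+x. ennreal (1 / g ^ Suc N) * ennreal (1 / (1 + \<bar>x\<bar>) ^ Suc N) \<partial>lborel) = ennreal (1 / g ^ Suc N) * J"
      unfolding J_def by (rule nn_integral_cmult) simp
    also have "ennreal \<bar>g\<bar> * (ennreal (1 / g ^ Suc N) * J) = ennreal (C / g ^ N)"
      unfolding C(1) using g C(2) by (simp add: ennreal_mult[symmetric] field_simps)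
    finally show "(\<integral>\<^sup>+x. ennreal (1 / (g + \<bar>x\<bar>) ^ Suc N) \<partial>lborel) = ennreal (C / g ^ N)" .
  qed
qed

lemma coercive_convex_line:
  assumes "coercive_convex B \<phi>"
  shows "continuous_on UNIV (\<lambda>x. \<phi> (y + x *\<^sub>R k))"
  by (intro continuous_on_compose2[OF coercive_convex_continuous[OF assms]] continuous_intros) auto

text \<open>The class is closed under integrating out one coordinate while the exponent drops by
  one. Convexity of \<open>\<psi>\<close> is the Borell-Brascamp-Lieb inequality for the
  restrictions of \<open>\<phi>\<close> to parallel lines; its growth comes from the model
  integral.\<close>

lemma coercive_convex_marginal:
  fixes \<phi> :: "'a::euclidean_space \<Rightarrow> real"
  assumes \<phi>: "coercive_convex (insert k B) \<phi>" and B: "insert k B \<subseteq> Basis" "k \<notin> B" and N: "N \<ge> 1"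
  obtains \<psi> where "coercive_convex B \<psi>"
    "\<And>y. (\<integral>\<^sup>+x. ennreal (1 / \<phi> (y + x *\<^sub>R k) ^ Suc N) \<partial>lborel) = ennreal (1 / \<psi> y ^ N)"
proof -
  have fB: "finite B" using finite_subset[OF B(1) finite_Basis] by simp
  note pos = coercive_convex_pos[OF \<phi>]
  have conv: "convex_on UNIV \<phi>" using \<phi> unfolding coercive_convex_def by blast
  obtain \<delta> where \<delta>: "\<delta> > 0" "\<And>y. \<delta> * (1 + (\<Sum>b\<in>insert k B. \<bar>y \<bullet> b\<bar>)) \<le> \<phi> y"
    using \<phi> unfolding coercive_convex_def by blast
  obtain C where C: "C > 0" "\<And>g. g > 0 \<Longrightarrow>
    (\<integral>\<^sup>+x. ennreal (1 / (g + \<bar>x\<bar>) ^ Suc N) \<partial>lborel) = ennreal (C / g ^ N)"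
    using nn_integral_inverse_power_finite[OF N] by blast
  define G where "G = (\<lambda>y. 1 + (\<Sum>b\<in>B. \<bar>y \<bullet> b\<bar>))"
  have G: "G y > 0" for y unfolding G_def by (intro add_pos_nonneg sum_nonneg) auto
  have kk: "k \<bullet> k = 1" "\<And>b. b \<in> B \<Longrightarrow> k \<bullet> b = 0"
    using B by (auto simp: inner_Basis subset_iff)
  have lb: "\<delta> * (G y + \<bar>y \<bullet> k + x\<bar>) \<le> \<phi> (y + x *\<^sub>R k)" for y x
  proof -
    have "(\<Sum>b\<in>insert k B. \<bar>(y + x *\<^sub>R k) \<bullet> b\<bar>) = \<bar>y \<bullet> k + x\<bar> + (\<Sum>b\<in>B. \<bar>y \<bullet> b\<bar>)"
      using fB B kk by (simp add: inner_add_left)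
    then show ?thesis using \<delta>(2)[of "y + x *\<^sub>R k"] unfolding G_def by (simp add: algebra_simps)
  qed
  define J where "J = (\<lambda>y. \<integral>\<^sup>+x. ennreal (1 / \<phi> (y + x *\<^sub>R k) ^ Suc N) \<partial>lborel)"
  have meas[measurable]: "(\<lambda>x. ennreal (1 / \<phi> (y + x *\<^sub>R k) ^ Suc N)) \<in> borel_measurable borel" for y
    using borel_measurable_continuous_onI[OF coercive_convex_line[OF \<phi>, of y k]] by measurable
  have Jle: "J y \<le> ennreal (C / (\<delta> ^ Suc N * G y ^ N))" for y
  proof -
    have "J y \<le> (\<integral>\<^sup>+x. ennreal (1 / \<delta> ^ Suc N) * ennreal (1 / (G y + \<bar>y \<bullet> k + 1 * x\<bar>) ^ Suc N) \<partial>lborel)"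
      unfolding J_def
    proof (rule nn_integral_mono)
      fix x
      have p: "0 < G y + \<bar>y \<bullet> k + 1 * x\<bar>" using G by (simp add: add_pos_nonneg)
      have "(\<delta> * (G y + \<bar>y \<bullet> k + 1 * x\<bar>)) ^ Suc N \<le> \<phi> (y + x *\<^sub>R k) ^ Suc N"
        using lb[of y x] p \<delta>(1) by (intro power_mono) auto
      then have "1 / \<phi> (y + x *\<^sub>R k) ^ Suc N \<le> 1 / (\<delta> * (G y + \<bar>y \<bullet> k + 1 * x\<bar>)) ^ Suc N"
        using p pos \<delta>(1) by (intro divide_left_mono mult_pos_pos zero_less_power) auto
      also have "\<dots> = (1 / \<delta> ^ Suc N) * (1 / (G y + \<bar>y \<bullet> k + 1 * x\<bar>) ^ Suc N)"
        by (simp only: power_mult_distrib) simp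
      finally show "ennreal (1 / \<phi> (y + x *\<^sub>R k) ^ Suc N)
          \<le> ennreal (1 / \<delta> ^ Suc N) * ennreal (1 / (G y + \<bar>y \<bullet> k + 1 * x\<bar>) ^ Suc N)"
        using \<delta>(1) p by (simp add: ennreal_mult[symmetric] ennreal_leI del: power_Suc)
    qed
    also have "\<dots> = ennreal (1 / \<delta> ^ Suc N) * (\<integral>\<^sup>+x. ennreal (1 / (G y + \<bar>y \<bullet> k + 1 * x\<bar>) ^ Suc N) \<partial>lborel)"
      by (rule nn_integral_cmult) simp
    also have "(\<integral>\<^sup>+x. ennreal (1 / (G y + \<bar>y \<bullet> k + 1 * x\<bar>) ^ Suc N) \<partial>lborel)
        = (\<integral>\<^sup>+x. ennreal (1 / (G y + \<bar>x\<bar>) ^ Suc N) \<partial>lborel)"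
      using nn_integral_real_affine[of "\<lambda>x. ennreal (1 / (G y + \<bar>x\<bar>) ^ Suc N)" 1 "y \<bullet> k"] by simp
    also have "\<dots> = ennreal (C / G y ^ N)" by (rule C(2)[OF G])
    finally show ?thesis using \<delta>(1) C(1) G[of y] by (simp add: ennreal_mult[symmetric] less_imp_le)
  qed
  have J0: "J y \<noteq> 0" for y
  proof
    assume "J y = 0"
    moreover have "continuous_on UNIV (\<lambda>x. 1 / \<phi> (y + x *\<^sub>R k) ^ Suc N)"
      by (intro continuous_intros coercive_convex_line[OF \<phi>]) (simp add: pos less_imp_neq[OF pos, symmetric])
    ultimately have "1 / \<phi> (y + 0 *\<^sub>R k) ^ Suc N \<le> 0"
      unfolding J_def by (intro continuous_nn_integral_zero)
    then show False using zero_less_power[OF pos, of "y + 0 *\<^sub>R k" "Suc N"] by (simp add: divide_le_0_iff del: power_Suc)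
  qed
  define j where "j = (\<lambda>y. enn2real (J y))"
  have j: "J y = ennreal (j y)" "j y > 0" for y
  proof -
    have "J y < \<infinity>" using Jle[of y] by (auto simp: less_top[symmetric] top_unique)
    then show "J y = ennreal (j y)" "j y > 0"
      unfolding j_def using J0[of y] by (auto simp: enn2real_positive_iff less_top zero_less_iff_neq_zero)
  qed
  define \<psi> where "\<psi> = (\<lambda>y. 1 / root N (j y))"
  have N0: "N > 0" using N by simp
  have \<psi>pos: "\<psi> y > 0" for y unfolding \<psi>_def using j(2) N0 by simp
  have \<psi>N: "\<psi> y ^ N = 1 / j y" for y
    unfolding \<psi>_def using j(2)[of y] N0 by (simp add: power_divide less_imp_le)
  have J\<psi>: "J y = ennreal (1 / \<psi> y ^ N)" for y using j(1)[of y] \<psi>N[of y] by simp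
  show thesis
  proof (rule that[of \<psi>])
    show "(\<integral>\<^sup>+x. ennreal (1 / \<phi> (y + x *\<^sub>R k) ^ Suc N) \<partial>lborel) = ennreal (1 / \<psi> y ^ N)" for y
      using J\<psi> unfolding J_def .
    show "coercive_convex B \<psi>"
      unfolding coercive_convex_def
    proof (intro conjI exI allI)
      \<comment> \<open>Read off from \<open>Jle\<close>: the marginal is at most
        \<open>C / (\<delta> ^ Suc N * G y ^ N)\<close>, so \<open>\<psi> y ^ N\<close> is at least
        \<open>\<delta> ^ Suc N / C * G y ^ N\<close>.\<close>
      define \<delta>' where "\<delta>' = root N (\<delta> ^ Suc N / C)"
      show "\<delta>' > 0" unfolding \<delta>'_def using \<delta> C N0 by simp
      have \<delta>'N: "\<delta>' ^ N = \<delta> ^ Suc N / C" unfolding \<delta>'_def using \<delta> C N0 by (simp add: less_imp_le)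
      show "\<delta>' * (1 + (\<Sum>b\<in>B. \<bar>y \<bullet> b\<bar>)) \<le> \<psi> y" for y
      proof -
        have "j y \<le> C / (\<delta> ^ Suc N * G y ^ N)"
          using Jle[of y] j[of y] C \<delta> G[of y] by (simp add: ennreal_le_iff less_imp_le)
        then have "j y * (\<delta> ^ Suc N * G y ^ N) \<le> C" 
          using \<delta> G[of y] by (simp add: pos_le_divide_eq)
        then have "\<delta> ^ Suc N / C * G y ^ N \<le> 1 / j y"
          using j(2)[of y] C(1) by (simp add: field_simps)
        then have "(\<delta>' * G y) ^ N \<le> \<psi> y ^ N" unfolding power_mult_distrib \<delta>'N \<psi>N .
        moreover have "\<delta>' * G y \<ge> 0" using \<open>\<delta>' > 0\<close> G[of y] by simp
        ultimately have "\<delta>' * G y \<le> \<psi> y" using N0 \<psi>pos[of y] by (simp add: power_mono_iff)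
        then show ?thesis unfolding G_def .
      qed
      show "convex_on UNIV \<psi>"
      proof (rule convex_onI)
        fix t :: real and x y :: 'a assume t: "0 < t" "t < 1"
        have "ennreal (1 / ((1 - t) * \<psi> x + t * \<psi> y) ^ N) \<le> J ((1 - t) *\<^sub>R x + t *\<^sub>R y)"
          unfolding J_def
        proof (rule borell_brascamp_lieb_real(1)[of "\<lambda>s. \<phi> (x + s *\<^sub>R k)" "\<lambda>s. \<phi> (y + s *\<^sub>R k)" "\<lambda>s. \<phi> ((1 - t) *\<^sub>R x + t *\<^sub>R y + s *\<^sub>R k)"])
          fix r s :: real
          show "\<phi> ((1 - t) *\<^sub>R x + t *\<^sub>R y + ((1 - t) * r + t * s) *\<^sub>R k) \<le> (1 - t) * \<phi> (x + r *\<^sub>R k) + t * \<phi> (y + s *\<^sub>R k)"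
            using convex_onD[OF conv, of t "x + r *\<^sub>R k" "y + s *\<^sub>R k"] t by (simp add: algebra_simps)
        qed (use t N \<psi>pos pos J\<psi> coercive_convex_line[OF \<phi>] in \<open>auto simp: J_def simp del: power_Suc\<close>)
        moreover have "(1 - t) * \<psi> x + t * \<psi> y > 0" using t \<psi>pos by (intro add_pos_pos mult_pos_pos) auto
        ultimately show "\<psi> ((1 - t) *\<^sub>R x + t *\<^sub>R y) \<le> (1 - t) * \<psi> x + t * \<psi> y"
          unfolding J\<psi> using \<psi>pos N by (intro ennreal_inverse_power_le_imp[of _ N])
      qed auto
    qed
  qed
qed

text \<open>The exponent \<open>Suc (card B)\<close> has sunk to \<open>1\<close> once all
  coordinates are integrated out. So the result is naturally a reciprocal \<open>1 / j\<close>, and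
  \<open>j\<close> scales like \<open>\<phi>\<close>: these are the numbers for which the inequality
  below is additive.\<close>

lemma itint_inverse_power_finite:
  fixes \<phi> :: "'a::euclidean_space \<Rightarrow> real"
  assumes "B \<subseteq> Basis" "coercive_convex B \<phi>"
  shows "\<exists>j>0. itint B (\<lambda>y. ennreal (1 / \<phi> y ^ Suc (card B))) 0 = ennreal (1 / j)"
proof -
  have "finite B" using assms(1) finite_Basis by (rule finite_subset)
  then show ?thesis using assms
  proof (induction B arbitrary: \<phi> rule: finite_induct)
    case empty
    then show ?case using coercive_convex_pos[of "{}" \<phi> 0] by (auto simp: itint_empty)
  next
    case (insert k B)
    obtain \<psi> where \<psi>: "coercive_convex B \<psi>"
      "\<And>y. (\<integral>\<^sup>+x. ennreal (1 / \<phi> (y + x *\<^sub>R k) ^ Suc (Suc (card B))) \<partial>lborel) = ennreal (1 / \<psi> y ^ Suc (card B))"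
      using coercive_convex_marginal[of k B \<phi> "Suc (card B)"] insert by auto
    have "itint (insert k B) (\<lambda>y. ennreal (1 / \<phi> y ^ Suc (card (insert k B)))) 0
        = itint B (\<lambda>y. ennreal (1 / \<psi> y ^ Suc (card B))) 0"
      using insert by (subst itint_insert_inner) (simp_all add: measurable_inverse_power_coercive_convex \<psi>(2) del: power_Suc)
    then show ?case using insert.IH[OF _ \<psi>(1)] insert.prems by simp
  qed
qed

text \<open>By induction on \<open>B\<close>, passing to marginals in direction \<open>k\<close>.
  Equality for the marginals makes every pair of lines over \<open>W\<close> and
  \<open>c *\<^sub>R W + w\<close> an equality case of the inequality on the line; each pair brings
  its own shift, and \<open>marginal_shift_constant\<close> merges the shifts into one
  translation.\<close>

theorem borell_brascamp_lieb_itint: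
  fixes \<phi>0 \<phi>1 \<phi>m :: "'a::euclidean_space \<Rightarrow> real"
  assumes "B \<subseteq> Basis" "coercive_convex B \<phi>0" "coercive_convex B \<phi>1" "coercive_convex B \<phi>m"
    and "\<And>U V. \<phi>m ((1/2) *\<^sub>R (U + V)) \<le> (\<phi>0 U + \<phi>1 V) / 2"
    and "itint B (\<lambda>y. ennreal (1 / \<phi>0 y ^ Suc (card B))) 0 = ennreal (1 / j0)"
    and "itint B (\<lambda>y. ennreal (1 / \<phi>1 y ^ Suc (card B))) 0 = ennreal (1 / j1)"
    and "itint B (\<lambda>y. ennreal (1 / \<phi>m y ^ Suc (card B))) 0 = ennreal (1 / jm)"
    and j: "j0 > 0" "j1 > 0" "jm > 0"
  shows "jm \<le> (j0 + j1) / 2 \<and> (jm = (j0 + j1) / 2 \<longrightarrow>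
     (\<exists>w\<in>span B. \<forall>W\<in>span B. \<phi>1 ((j1 / j0) *\<^sub>R W + w) = j1 / j0 * \<phi>0 W \<and>
        \<phi>m ((1/2) *\<^sub>R (W + ((j1 / j0) *\<^sub>R W + w))) = (1 + j1 / j0) / 2 * \<phi>0 W))"
proof -
  have "finite B" using assms(1) finite_Basis by (rule finite_subset)
  then show ?thesis using assms(1-8)
  proof (induction B arbitrary: \<phi>0 \<phi>1 \<phi>m rule: finite_induct)
    case empty
    note pos = empty(2-4)[THEN coercive_convex_pos, of 0]
    have "\<phi>0 0 = j0" "\<phi>1 0 = j1" "\<phi>m 0 = jm"
      using empty(6-8) pos j by (simp_all add: itint_empty)
    then show ?case using empty(5)[of 0 0] j by (simp add: field_simps)
  next
    case (insert k B)
    define N where "N = Suc (card B)"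
    have N: "N \<ge> 1" unfolding N_def by simp
    have kB: "insert k B \<subseteq> Basis" "k \<notin> B" using insert by auto
    have cardk: "Suc (card (insert k B)) = Suc N" using insert unfolding N_def by simp
    obtain \<psi>0 where \<psi>0: "coercive_convex B \<psi>0"
      "\<And>y. (\<integral>\<^sup>+x. ennreal (1 / \<phi>0 (y + x *\<^sub>R k) ^ Suc N) \<partial>lborel) = ennreal (1 / \<psi>0 y ^ N)"
      using coercive_convex_marginal[OF insert.prems(2) kB N] by blast
    obtain \<psi>1 where \<psi>1: "coercive_convex B \<psi>1"
      "\<And>y. (\<integral>\<^sup>+x. ennreal (1 / \<phi>1 (y + x *\<^sub>R k) ^ Suc N) \<partial>lborel) = ennreal (1 / \<psi>1 y ^ N)"
      using coercive_convex_marginal[OF insert.prems(3) kB N] by blast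
    obtain \<psi>m where \<psi>m: "coercive_convex B \<psi>m"
      "\<And>y. (\<integral>\<^sup>+x. ennreal (1 / \<phi>m (y + x *\<^sub>R k) ^ Suc N) \<partial>lborel) = ennreal (1 / \<psi>m y ^ N)"
      using coercive_convex_marginal[OF insert.prems(4) kB N] by blast
    note pos = insert.prems(2-4)[THEN coercive_convex_pos]
    note \<psi>pos = \<psi>0(1)[THEN coercive_convex_pos] \<psi>1(1)[THEN coercive_convex_pos] \<psi>m(1)[THEN coercive_convex_pos]
    note cont = insert.prems(2-4)[THEN coercive_convex_line]
    have line: "\<phi>m ((1/2) *\<^sub>R (U + V) + ((1 - 1/2) * x + 1/2 * y) *\<^sub>R k) \<le> (1 - 1/2) * \<phi>0 (U + x *\<^sub>R k) + 1/2 * \<phi>1 (V + y *\<^sub>R k)" for U V x y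
      using insert.prems(5)[of "U + x *\<^sub>R k" "V + y *\<^sub>R k"] by (simp add: algebra_simps)
    have half: "0 < (1/2::real)" "(1/2::real) < 1" by auto
    note fibre = borell_brascamp_lieb_real[OF cont(1) cont(2) cont(3) pos(1) pos(2) pos(3) half N \<psi>pos(1) \<psi>pos(2) line \<psi>0(2) \<psi>1(2)]
    have mid\<psi>: "\<psi>m ((1/2) *\<^sub>R (U + V)) \<le> (\<psi>0 U + \<psi>1 V) / 2" for U V
    proof -
      have p: "(1 - 1/2) * \<psi>0 U + 1/2 * \<psi>1 V > 0"
        by (intro add_pos_pos mult_pos_pos \<psi>pos) simp_all
      have "\<psi>m ((1/2) *\<^sub>R (U + V)) \<le> (1 - 1/2) * \<psi>0 U + 1/2 * \<psi>1 V"
        by (rule ennreal_inverse_power_le_imp[OF fibre(1)[of U V, unfolded \<psi>m(2)] p \<psi>pos(3) N])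
      then show ?thesis by simp
    qed
    have J: "itint (insert k B) (\<lambda>y. ennreal (1 / \<phi> y ^ Suc (card (insert k B)))) 0 = itint B (\<lambda>y. ennreal (1 / \<psi> y ^ Suc (card B))) 0"
      if "coercive_convex (insert k B) \<phi>"
        "\<And>y. (\<integral>\<^sup>+x. ennreal (1 / \<phi> (y + x *\<^sub>R k) ^ Suc N) \<partial>lborel) = ennreal (1 / \<psi> y ^ N)" for \<phi> \<psi>
      unfolding cardk N_def[symmetric]
      by (subst itint_insert_inner[OF measurable_inverse_power_coercive_convex[OF that(1)] insert(1,2)]) (simp only: that(2))
    have BB: "B \<subseteq> Basis" using kB(1) by simp
    note IH = insert.IH[OF BB \<psi>0(1) \<psi>1(1) \<psi>m(1) mid\<psi> insert.prems(6)[unfolded J[OF insert.prems(2) \<psi>0(2)]]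
      insert.prems(7)[unfolded J[OF insert.prems(3) \<psi>1(2)]] insert.prems(8)[unfolded J[OF insert.prems(4) \<psi>m(2)]]]
    have IH1: "jm \<le> (j0 + j1) / 2" by (rule IH[THEN conjunct1])
    define c where "c = j1 / j0"
    have c: "c > 0" unfolding c_def using j by simp
    have "\<exists>w\<in>span (insert k B). \<forall>W\<in>span (insert k B). \<phi>1 (c *\<^sub>R W + w) = c * \<phi>0 W \<and>
        \<phi>m ((1/2) *\<^sub>R (W + (c *\<^sub>R W + w))) = (1 + c) / 2 * \<phi>0 W" if eq: "jm = (j0 + j1) / 2"
    proof -
      obtain w where w: "w \<in> span B" "\<And>W. W \<in> span B \<Longrightarrow> \<psi>1 (c *\<^sub>R W + w) = c * \<psi>0 W"
        "\<And>W. W \<in> span B \<Longrightarrow> \<psi>m ((1/2) *\<^sub>R (W + (c *\<^sub>R W + w))) = (1 + c) / 2 * \<psi>0 W"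
        using IH[THEN conjunct2, THEN mp, OF eq] unfolding c_def by blast
      let ?P = "\<lambda>W v. \<forall>x. \<phi>1 (c *\<^sub>R W + w + (c * x + v) *\<^sub>R k) = c * \<phi>0 (W + x *\<^sub>R k) \<and>
          \<phi>m ((1/2) *\<^sub>R (W + (c *\<^sub>R W + w)) + ((1 - 1/2) * x + 1/2 * (c * x + v)) *\<^sub>R k) = (1 - 1/2 + 1/2 * c) * \<phi>0 (W + x *\<^sub>R k)"
      have "\<forall>W\<in>span B. \<exists>v. ?P W v"
      proof
        fix W assume W: "W \<in> span B"
        \<comment> \<open>The ratio of the marginals is the same \<open>c\<close> on every line, so
          the dilations along the lines agree with that of the base; only the shift \<open>v\<close>
          may still vary.\<close>
        have r: "\<psi>1 (c *\<^sub>R W + w) / \<psi>0 W = c" using w(2)[OF W] \<psi>pos(1)[of W] by simp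
        have "(1 - 1/2) * \<psi>0 W + 1/2 * \<psi>1 (c *\<^sub>R W + w) = \<psi>m ((1/2) *\<^sub>R (W + (c *\<^sub>R W + w)))"
          unfolding w(2)[OF W] w(3)[OF W] by (simp add: algebra_simps add_divide_distrib)
        then have "(\<integral>\<^sup>+x. ennreal (1 / \<phi>m ((1/2) *\<^sub>R (W + (c *\<^sub>R W + w)) + x *\<^sub>R k) ^ Suc N) \<partial>lborel)
            = ennreal (1 / ((1 - 1/2) * \<psi>0 W + 1/2 * \<psi>1 (c *\<^sub>R W + w)) ^ N)"
          unfolding \<psi>m(2) by (rule arg_cong[where f="\<lambda>t. ennreal (1 / t ^ N)", OF sym])
        from fibre(2)[OF this] show "\<exists>v. ?P W v" unfolding r .
      qed
      \<comment> \<open>No regularity in \<open>W\<close> is known for these shifts, which is why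
        \<open>marginal_shift_constant\<close> works with bare increments.\<close>
      then obtain \<omega> where P: "\<forall>W\<in>span B. ?P W (\<omega> W)" by (rule bchoice[THEN exE])
      have \<omega>: "\<phi>1 (c *\<^sub>R W + w + (c * x + \<omega> W) *\<^sub>R k) = c * \<phi>0 (W + x *\<^sub>R k)"
        "\<phi>m ((1/2) *\<^sub>R (W + (c *\<^sub>R W + w)) + ((1 - 1/2) * x + 1/2 * (c * x + \<omega> W)) *\<^sub>R k)
           = (1 - 1/2 + 1/2 * c) * \<phi>0 (W + x *\<^sub>R k)" if "W \<in> span B" for W x
        using bspec[OF P that, THEN spec[of _ x]] by (rule conjunct1, rule conjunct2)
      have \<omega>m: "\<phi>m ((1/2) *\<^sub>R ((W + x *\<^sub>R k) + (c *\<^sub>R W + w + (c * x + \<omega> W) *\<^sub>R k))) = (1 + c) / 2 * \<phi>0 (W + x *\<^sub>R k)"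
        if "W \<in> span B" for W x
      proof -
        have "(1/2) *\<^sub>R ((W + x *\<^sub>R k) + (c *\<^sub>R W + w + (c * x + \<omega> W) *\<^sub>R k))
          = (1/2) *\<^sub>R (W + (c *\<^sub>R W + w)) + ((1 - 1/2) * x + 1/2 * (c * x + \<omega> W)) *\<^sub>R k"
          by (simp add: algebra_simps)
        then show ?thesis using \<omega>(2)[OF that, of x] by (simp add: field_simps)
      qed
      obtain \<delta> where \<delta>: "\<delta> > 0" "\<And>y. \<delta> * (1 + (\<Sum>b\<in>insert k B. \<bar>y \<bullet> b\<bar>)) \<le> \<phi>0 y"
        using insert.prems(2) unfolding coercive_convex_def by blast
      have const: "\<omega> W = \<omega> 0" if W: "W \<in> span B" for W
      proof (rule marginal_shift_constant[of \<phi>0 \<delta> k "span B" c \<phi>1 w \<omega> \<phi>m W])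
        show "convex_on UNIV \<phi>0" using insert.prems(2) unfolding coercive_convex_def by blast
        show "\<delta> * \<bar>y \<bullet> k\<bar> \<le> \<phi>0 y" for y
        proof -
          have "\<bar>y \<bullet> k\<bar> \<le> 1 + (\<Sum>b\<in>insert k B. \<bar>y \<bullet> b\<bar>)"
            using insert(1,2) sum_nonneg[of B "\<lambda>b. \<bar>y \<bullet> b\<bar>"] by simp
          then show ?thesis using \<delta>(2)[of y] \<delta>(1) by (meson less_imp_le mult_left_mono order_trans)
        qed
        show "norm k = 1" using kB by simp
        show "\<delta> > 0" "c > 0" "W \<in> span B" by fact+
        show "subspace (span B)" by (rule subspace_span)
        show "W \<bullet> k = 0" if "W \<in> span B" for W
        proof -
          have "B \<subseteq> {x. x \<bullet> k = 0}" using kB by (auto simp: inner_Basis subset_iff)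
          then have "span B \<subseteq> {x. x \<bullet> k = 0}"
            by (rule span_minimal) (simp add: subspace_hyperplane2)
          then show ?thesis using that by auto
        qed
      qed (rule \<omega>(1) \<omega>m insert.prems(5), assumption?)+
      show ?thesis
      proof (intro bexI[of _ "w + \<omega> 0 *\<^sub>R k"] ballI)
        show "w + \<omega> 0 *\<^sub>R k \<in> span (insert k B)"
          by (intro span_add span_scale subsetD[OF span_mono w(1)] span_base) auto
        fix W assume "W \<in> span (insert k B)"
        then obtain x where x: "W - x *\<^sub>R k \<in> span B" using span_breakdown_eq by blast
        define W' where "W' = W - x *\<^sub>R k"
        have W: "W = W' + x *\<^sub>R k" unfolding W'_def by simp
        have W': "W' \<in> span B" using x unfolding W'_def .
        have T: "c *\<^sub>R W + (w + \<omega> 0 *\<^sub>R k) = c *\<^sub>R W' + w + (c * x + \<omega> W') *\<^sub>R k"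
          unfolding W const[OF W'] by (simp add: algebra_simps)
        show "\<phi>1 (c *\<^sub>R W + (w + \<omega> 0 *\<^sub>R k)) = c * \<phi>0 W \<and>
          \<phi>m ((1/2) *\<^sub>R (W + (c *\<^sub>R W + (w + \<omega> 0 *\<^sub>R k)))) = (1 + c) / 2 * \<phi>0 W"
          unfolding T using \<omega>(1)[OF W', of x] \<omega>m[OF W', of x] unfolding W[symmetric] by simp
      qed
    qed
    with IH1 show ?case unfolding c_def by (intro conjI impI)
  qed
qed

subsection \<open>Exponential integrals of homogeneous functions\<close>

lemma itint_nn_integral_swap:
  fixes h :: "real \<Rightarrow> 'a::euclidean_space \<Rightarrow> ennreal"
  assumes B: "finite B" and [measurable]: "case_prod h \<in> borel_measurable (borel \<Otimes>\<^sub>M borel)"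
  shows "(\<integral>\<^sup>+r. itint B (h r) y \<partial>lborel) = itint B (\<lambda>y. \<integral>\<^sup>+r. h r y \<partial>lborel) y"
proof -
  interpret P: sigma_finite_measure "\<Pi>\<^sub>M b\<in>B. (lborel :: real measure)"
    by (rule lborel_product.sigma_finite[OF B])
  interpret PP: pair_sigma_finite "\<Pi>\<^sub>M b\<in>B. (lborel :: real measure)" "lborel :: real measure" ..
  show ?thesis unfolding itint_def
    by (rule PP.Fubini'[where f="\<lambda>g r. h r (y + (\<Sum>b\<in>B. g b *\<^sub>R b))"]) measurable
qed

definition homogeneous :: "('a::real_vector \<Rightarrow> real) \<Rightarrow> bool" where
  "homogeneous g \<longleftrightarrow> (\<forall>t>0. \<forall>y. g (t *\<^sub>R y) = t * g y)"

lemma homogeneousD: "homogeneous g \<Longrightarrow> t > 0 \<Longrightarrow> g (t *\<^sub>R y) = t * g y"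
  unfolding homogeneous_def by blast

lemma nn_integral_power_exp:
  fixes c :: real
  assumes c: "c > 0"
  shows "(\<integral>\<^sup>+r. ennreal (r ^ n * exp (- r * c)) * indicator {0<..} r \<partial>lborel) = ennreal (fact n / c ^ Suc n)"
proof -
  have "ennreal (fact n) = (\<integral>\<^sup>+x. ennreal (x^n * exp (-x)) * indicator {0 ..} x \<partial>lborel)"
    by (subst nn_intergal_power_times_exp_Ici) simp
  also have "\<dots> = ennreal \<bar>c\<bar> * (\<integral>\<^sup>+x. ennreal ((0 + c * x)^n * exp (-(0 + c * x))) * indicator {0 ..} (0 + c * x) \<partial>lborel)"
    by (rule nn_integral_real_affine) (use c in auto)
  also have "(\<integral>\<^sup>+x. ennreal ((0 + c * x)^n * exp (-(0 + c * x))) * indicator {0 ..} (0 + c * x) \<partial>lborel)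
      = (\<integral>\<^sup>+r. ennreal (c ^ n) * (ennreal (r ^ n * exp (- r * c)) * indicator {0<..} r) \<partial>lborel)"
  proof (rule nn_integral_cong_AE, rule AE_mp[OF AE_lborel_singleton[of 0]], intro AE_I2 impI)
    fix x :: real assume "x \<noteq> 0"
    then have "indicator {0 ..} (0 + c * x) = (indicator {0<..} x :: ennreal)"
      using c by (auto simp: indicator_def zero_le_mult_iff)
    then show "ennreal ((0 + c * x)^n * exp (-(0 + c * x))) * indicator {0 ..} (0 + c * x)
        = ennreal (c ^ n) * (ennreal (x ^ n * exp (- x * c)) * indicator {0<..} x)"
      using c by (auto simp: indicator_def ennreal_mult[symmetric] power_mult_distrib mult_ac)
  qed
  also have "\<dots> = ennreal (c ^ n) * (\<integral>\<^sup>+r. ennreal (r ^ n * exp (- r * c)) * indicator {0<..} r \<partial>lborel)"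
    by (rule nn_integral_cmult) simp
  finally have "ennreal (1 / c ^ Suc n) * ennreal (fact n) = ennreal (1 / c ^ Suc n) * (ennreal \<bar>c\<bar> * (ennreal (c ^ n) * (\<integral>\<^sup>+r. ennreal (r ^ n * exp (- r * c)) * indicator {0<..} r \<partial>lborel)))"
    by simp
  also have "\<dots> = (ennreal (1 / c ^ Suc n) * ennreal (c * c ^ n)) * (\<integral>\<^sup>+r. ennreal (r ^ n * exp (- r * c)) * indicator {0<..} r \<partial>lborel)"
    using c by (simp add: ennreal_mult mult.assoc)
  also have "ennreal (1 / c ^ Suc n) * ennreal (c * c ^ n) = 1"
    using c by (simp add: ennreal_mult[symmetric])
  finally show ?thesis using c by (simp add: ennreal_mult[symmetric])
qed

text \<open>Coordinates \<open>y = r * (s * e + v)\<close> with \<open>v\<close> in the hyperplane: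
  the slice at height \<open>r\<close> is \<open>r\<close> times the slice at height
  \<open>1\<close>, with Jacobian \<open>r ^ (d - 1)\<close>, and homogeneity turns the integrand
  into \<open>exp (- r * g)\<close>. The gamma integral in \<open>r\<close> leaves the factorial of
  \<open>d - 1\<close> over \<open>g ^ d\<close>.\<close>

lemma exp_integral_halfspace:
  fixes g :: "'a::euclidean_space \<Rightarrow> real"
  assumes [measurable]: "g \<in> borel_measurable borel" and hom: "homogeneous g"
    and e: "e \<in> Basis" and s: "\<bar>s\<bar> = 1" and pos: "\<And>v. v \<in> span (Basis - {e}) \<Longrightarrow> g (s *\<^sub>R e + v) > 0"
  shows "(\<integral>\<^sup>+y. ennreal (exp (- g y)) * indicator {y. s * (y \<bullet> e) > 0} y \<partial>lborel)
    = ennreal (fact (DIM('a) - 1)) * itint (Basis - {e}) (\<lambda>y. ennreal (1 / g y ^ DIM('a))) (s *\<^sub>R e)"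
proof -
  let ?B = "Basis - {e} :: 'a set"
  define n where "n = DIM('a) - 1"
  have n: "card ?B = n" "DIM('a) = Suc n" unfolding n_def using e DIM_positive[where 'a='a]
    by (auto simp: card_Diff_singleton)
  have perp: "v \<bullet> e = 0" if "v \<in> span ?B" for v
  proof -
    have "?B \<subseteq> {x. x \<bullet> e = 0}" using e by (auto simp: inner_Basis)
    then have "span ?B \<subseteq> {x. x \<bullet> e = 0}" by (rule span_minimal) (simp add: subspace_hyperplane2)
    then show ?thesis using that by auto
  qed
  have ss: "s * s = 1" using s by (metis abs_mult_self_eq mult_1)
  have ee: "e \<bullet> e = 1" using e by simp
  define F where "F = (\<lambda>y. ennreal (exp (- g y)) * indicator {y. s * (y \<bullet> e) > 0} y)"
  have [measurable]: "F \<in> borel_measurable borel" unfolding F_def by measurable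
  have slice: "itint ?B F (r *\<^sub>R s *\<^sub>R e) = itint ?B (\<lambda>y. ennreal (r ^ n * exp (- r * g y)) * indicator {0<..} r) (s *\<^sub>R e)" for r
  proof (cases "r > 0")
    case True
    have "itint ?B F (r *\<^sub>R s *\<^sub>R e) = ennreal (r ^ n) * (ennreal (1 / r ^ n) * itint ?B F (r *\<^sub>R s *\<^sub>R e))"
      using True by (simp add: mult.assoc[symmetric] ennreal_mult[symmetric])
    also have "ennreal (1 / r ^ n) * itint ?B F (r *\<^sub>R s *\<^sub>R e) = itint ?B (\<lambda>y. F (r *\<^sub>R y)) (s *\<^sub>R e)"
      by (subst itint_scale) (use True n in auto)
    also have "ennreal (r ^ n) * \<dots> = itint ?B (\<lambda>y. ennreal (r ^ n) * F (r *\<^sub>R y)) (s *\<^sub>R e)"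
      by (subst itint_cmult) auto
    also have "\<dots> = itint ?B (\<lambda>y. ennreal (r ^ n * exp (- r * g y)) * indicator {0<..} r) (s *\<^sub>R e)"
    proof (rule itint_cong)
      fix v assume v: "v \<in> span ?B"
      have sr: "s * (r *\<^sub>R (s *\<^sub>R e + v) \<bullet> e) = r" using perp[OF v] ss ee by (simp add: inner_add_left mult.left_commute)
      have "indicator {y. s * (y \<bullet> e) > 0} (r *\<^sub>R (s *\<^sub>R e + v)) = (1 :: ennreal)"
        unfolding indicator_def mem_Collect_eq sr using True by simp
      then show "ennreal (r ^ n) * F (r *\<^sub>R (s *\<^sub>R e + v)) = ennreal (r ^ n * exp (- r * g (s *\<^sub>R e + v))) * indicator {0<..} r"
        unfolding F_def using True by (simp add: homogeneousD[OF hom True] ennreal_mult)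
    qed simp
    finally show ?thesis .
  next
    case False
    have "itint ?B F (r *\<^sub>R s *\<^sub>R e) = itint ?B (\<lambda>y. 0) (r *\<^sub>R s *\<^sub>R e)"
    proof (rule itint_cong)
      fix v assume v: "v \<in> span ?B"
      have "s * ((r *\<^sub>R s *\<^sub>R e + v) \<bullet> e) = r" using perp[OF v] ss ee by (simp add: inner_add_left mult.left_commute)
      then show "F (r *\<^sub>R s *\<^sub>R e + v) = 0" unfolding F_def using False by simp
    qed simp
    then show ?thesis using False by (simp add: itint_def)
  qed
  have "(\<integral>\<^sup>+y. F y \<partial>lborel) = (\<integral>\<^sup>+r. itint ?B F (r *\<^sub>R e) \<partial>lborel)"
    using e by (rule nn_integral_lborel_slices(1)[rotated]) simp
  also have "\<dots> = ennreal \<bar>s\<bar> * (\<integral>\<^sup>+r. itint ?B F ((0 + s * r) *\<^sub>R e) \<partial>lborel)"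
    by (rule nn_integral_real_affine[OF measurable_compose[OF _ measurable_itint]]) (use s in auto)
  also have "\<dots> = (\<integral>\<^sup>+r. itint ?B F (r *\<^sub>R s *\<^sub>R e) \<partial>lborel)"
    using s by (simp add: mult.commute)
  also have "\<dots> = (\<integral>\<^sup>+r. itint ?B (\<lambda>y. ennreal (r ^ n * exp (- r * g y)) * indicator {0<..} r) (s *\<^sub>R e) \<partial>lborel)"
    unfolding slice ..
  also have "\<dots> = itint ?B (\<lambda>y. \<integral>\<^sup>+r. ennreal (r ^ n * exp (- r * g y)) * indicator {0<..} r \<partial>lborel) (s *\<^sub>R e)"
    by (rule itint_nn_integral_swap) (simp, measurable)
  also have "\<dots> = itint ?B (\<lambda>y. ennreal (fact n) * ennreal (1 / g y ^ Suc n)) (s *\<^sub>R e)"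
  proof (rule itint_cong)
    fix v assume v: "v \<in> span ?B"
    show "(\<integral>\<^sup>+r. ennreal (r ^ n * exp (- r * g (s *\<^sub>R e + v))) * indicator {0<..} r \<partial>lborel)
      = ennreal (fact n) * ennreal (1 / g (s *\<^sub>R e + v) ^ Suc n)"
      using pos[OF v] by (subst nn_integral_power_exp) (auto simp: ennreal_mult[symmetric])
  qed simp
  also have "\<dots> = ennreal (fact n) * itint ?B (\<lambda>y. ennreal (1 / g y ^ Suc n)) (s *\<^sub>R e)"
    by (rule itint_cmult) simp
  finally show ?thesis unfolding F_def n(2) by simp
qed

text \<open>Layer cake: \<open>exp (- t)\<close> is the integral of \<open>exp (- s)\<close> over
  \<open>s \<ge> t\<close>, and the sublevel set at \<open>s\<close> has \<open>s ^ d\<close> times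
  the volume of that at \<open>1\<close>. The gamma integral of \<open>s ^ d\<close> is the
  factorial.\<close>

lemma exp_integral_eq_sublevel:
  fixes g :: "'a::euclidean_space \<Rightarrow> real"
  assumes [measurable]: "g \<in> borel_measurable borel" and hom: "homogeneous g" and nn: "\<And>y. g y \<ge> 0"
  shows "(\<integral>\<^sup>+y. ennreal (exp (- g y)) \<partial>lborel) = ennreal (fact (DIM('a))) * emeasure lborel {y. g y \<le> 1}"
proof -
  have exp: "ennreal (exp (- t)) = (\<integral>\<^sup>+s. ennreal (exp (- s)) * indicator {t..} s \<partial>lborel)" if "t \<ge> 0" for t
  proof -
    have "(\<integral>\<^sup>+s. ennreal (exp (- s)) * indicator {t..} s \<partial>lborel) = ennreal (0 - (- exp (- t)))"
    proof (rule nn_integral_FTC_atLeast)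
      show "((\<lambda>x. - exp (- x :: real)) \<longlongrightarrow> 0) at_top"
        using tendsto_minus[OF filterlim_compose[OF exp_at_bot filterlim_uminus_at_bot_at_top]] by simp
    qed (auto intro!: derivative_eq_intros)
    then show ?thesis by simp
  qed
  have scale: "emeasure lborel {y. g y \<le> s} = ennreal (s ^ DIM('a)) * emeasure lborel {y. g y \<le> 1}" if s: "s > 0" for s
  proof -
    have "emeasure lborel {y. g y \<le> 1} = (\<integral>\<^sup>+y. indicator {y. g y \<le> 1} y \<partial>(lborel :: 'a measure))" by simp
    also have "\<dots> = itint Basis (indicator {y. g y \<le> 1}) (0::'a)"
      unfolding itint_def by (subst lborel_eq, subst nn_integral_distr) auto
    also have "\<dots> = itint Basis (\<lambda>y. indicator {y. g y \<le> s} (s *\<^sub>R y)) (0::'a)"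
      using s by (intro itint_cong) (auto simp: indicator_def homogeneousD[OF hom])
    also have "\<dots> = ennreal (1 / s ^ DIM('a)) * itint Basis (indicator {y. g y \<le> s}) (0::'a)"
      using itint_scale[of "indicator {y. g y \<le> s}" "Basis :: 'a set" s 0] s by simp
    also have "itint Basis (indicator {y. g y \<le> s}) (0::'a) = (\<integral>\<^sup>+y. indicator {y. g y \<le> s} y \<partial>lborel)"
      unfolding itint_def by (subst lborel_eq, subst nn_integral_distr) auto
    finally show ?thesis using s by (simp add: mult.assoc[symmetric] ennreal_mult[symmetric])
  qed
  have "(\<integral>\<^sup>+y. ennreal (exp (- g y)) \<partial>lborel)
      = (\<integral>\<^sup>+y. \<integral>\<^sup>+s. ennreal (exp (- s)) * indicator {g y..} s \<partial>lborel \<partial>lborel)"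
    using nn by (intro nn_integral_cong exp)
  also have "\<dots> = (\<integral>\<^sup>+y. \<integral>\<^sup>+s. ennreal (exp (- s)) * indicator {y. g y \<le> s} y \<partial>lborel \<partial>lborel)"
    by (intro nn_integral_cong) (auto simp: indicator_def)
  also have "\<dots> = (\<integral>\<^sup>+s. \<integral>\<^sup>+y. ennreal (exp (- s)) * indicator {y. g y \<le> s} y \<partial>lborel \<partial>lborel)"
  proof (rule lborel_pair.Fubini')
    show "(\<lambda>(x, y). ennreal (exp (- x)) * indicator {y. g y \<le> x} y) \<in> borel_measurable (lborel \<Otimes>\<^sub>M (lborel :: 'a measure))"
      unfolding indicator_def by measurable
  qed
  also have "\<dots> = (\<integral>\<^sup>+s. emeasure lborel {y. g y \<le> 1} * (ennreal (s ^ DIM('a) * exp (- s * 1)) * indicator {0<..} s) \<partial>lborel)"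
  proof (rule nn_integral_cong_AE, rule AE_mp[OF AE_lborel_singleton[of 0]], intro AE_I2 impI)
    fix s :: real assume "s \<noteq> 0"
    show "(\<integral>\<^sup>+y. ennreal (exp (- s)) * indicator {y. g y \<le> s} y \<partial>lborel)
      = emeasure lborel {y. g y \<le> 1} * (ennreal (s ^ DIM('a) * exp (- s * 1)) * indicator {0<..} s)"
    proof (cases "s > 0")
      case True
      have "(\<integral>\<^sup>+y. ennreal (exp (- s)) * indicator {y. g y \<le> s} y \<partial>lborel)
          = ennreal (exp (- s)) * emeasure lborel {y. g y \<le> s}"
        by (subst nn_integral_cmult) auto
      also have "\<dots> = emeasure lborel {y. g y \<le> 1} * (ennreal (s ^ DIM('a)) * ennreal (exp (- s * 1)))"
        unfolding scale[OF True] by (simp add: mult_ac)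
      finally show ?thesis using True by (simp add: ennreal_mult)
    next
      case False
      then have "s < 0" using \<open>s \<noteq> 0\<close> by simp
      then have "{y. g y \<le> s} = {}" using nn by (auto simp: not_le intro: less_le_trans)
      then show ?thesis using False by simp
    qed
  qed
  also have "\<dots> = emeasure lborel {y. g y \<le> 1} * ennreal (fact (DIM('a)))"
    by (subst nn_integral_cmult) (use nn_integral_power_exp[of 1 "DIM('a)"] in simp_all)
  finally show ?thesis by (simp add: mult.commute)
qed

section \<open>Integrability and first variation of exponential integrals\<close>

lemma nn_integral_exp_norm_finite:
  assumes "\<kappa> > 0"
  shows "(\<integral>\<^sup>+y. ennreal (exp (- (\<kappa> * norm y))) \<partial>(lborel :: 'a::euclidean_space measure)) < \<infinity>"
proof -
  have eq: "{y::'a. \<kappa> * norm y \<le> 1} = cball 0 (1 / \<kappa>)" using assms by (auto simp: field_simps)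
  have "(\<integral>\<^sup>+y. ennreal (exp (- (\<kappa> * norm y))) \<partial>(lborel :: 'a measure))
      = ennreal (fact (DIM('a))) * emeasure lborel {y::'a. \<kappa> * norm y \<le> 1}"
    using assms by (intro exp_integral_eq_sublevel) (auto simp: homogeneous_def)
  also have "\<dots> < \<infinity>" unfolding eq using emeasure_bounded_finite[of "cball (0::'a) (1 / \<kappa>)"]
    by (simp add: ennreal_mult_less_top)
  finally show ?thesis .
qed

text \<open>Instead of differentiating under the integral sign, the perturbed integral is bounded by
  a quadratic polynomial in \<open>\<epsilon>\<close>. Minimality then gives
  \<open>0 \<le> \<epsilon> * A + \<epsilon>\<^sup>2 * M\<close> for small \<open>\<epsilon>\<close>
  of both signs, which forces \<open>A = 0\<close>.\<close>

lemma first_order_condition: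
  fixes g l :: "'a::euclidean_space \<Rightarrow> real"
  assumes [measurable]: "g \<in> borel_measurable borel" "l \<in> borel_measurable borel"
    and \<rho>: "\<rho> > 0" "\<And>y. \<rho> * norm y \<le> g y" and C: "\<And>y. \<bar>l y\<bar> \<le> C * norm y"
    and \<epsilon>0: "\<epsilon>0 > 0" and min: "\<And>\<epsilon>. \<bar>\<epsilon>\<bar> < \<epsilon>0 \<Longrightarrow> (\<integral>\<^sup>+y. ennreal (exp (- g y)) \<partial>lborel) \<le> (\<integral>\<^sup>+y. ennreal (exp (- g y + \<epsilon> * l y)) \<partial>lborel)"
  shows "integrable lborel (\<lambda>y. l y * exp (- g y))" "(\<integral>y. l y * exp (- g y) \<partial>lborel) = 0"
proof -
  \<comment> \<open>The decay \<open>exp (- \<rho> * norm y)\<close> is divided into four parts: two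
    absorb the square of \<open>l\<close>, one absorbs
    \<open>exp \<bar>\<epsilon> * l y\<bar>\<close>, and the last remains as the integrable
    \<open>h\<close>.\<close>
  define \<kappa> where "\<kappa> = \<rho> / 4"
  have \<kappa>: "\<kappa> > 0" "\<rho> = 4 * \<kappa>" unfolding \<kappa>_def using \<rho> by auto
  have C0: "C \<ge> 0"
  proof -
    obtain b :: 'a where "b \<in> Basis" using nonempty_Basis by blast
    then have "C * norm b \<ge> 0" using C[of b] by (meson abs_ge_zero order_trans)
    then show ?thesis using \<open>b \<in> Basis\<close> by simp
  qed
  define h where "h = (\<lambda>y::'a. exp (- (\<kappa> * norm y)))"
  have h[measurable]: "integrable lborel h"
    unfolding h_def using nn_integral_exp_norm_finite[OF \<kappa>(1)] by (intro integrableI_nonneg) auto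
  have lin: "norm y \<le> exp (\<kappa> * norm y) / \<kappa>" for y :: 'a
  proof -
    have "norm y * \<kappa> \<le> exp (\<kappa> * norm y)"
      using exp_ge_add_one_self[of "\<kappa> * norm y"] by (subst mult.commute) linarith
    then show ?thesis using \<kappa>(1) by (simp add: pos_le_divide_eq)
  qed
  have gle: "exp (- g y) \<le> exp (- (4 * (\<kappa> * norm y)))" for y
    using \<rho>(2)[of y] \<kappa>(2) by simp
  have I0: "integrable lborel (\<lambda>y. exp (- g y))"
  proof (rule Bochner_Integration.integrable_bound[OF h])
    show "AE y in lborel. norm (exp (- g y)) \<le> norm (h y)"
    proof (rule AE_I2)
      fix y :: 'a
      have "exp (- (4 * (\<kappa> * norm y))) \<le> exp (- (\<kappa> * norm y))" using \<kappa>(1) by simp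
      with gle[of y] show "norm (exp (- g y)) \<le> norm (h y)" unfolding h_def by simp
    qed
  qed measurable
  have lb: "\<bar>l y\<bar> \<le> C / \<kappa> * exp (\<kappa> * norm y)" for y
    using order_trans[OF C[of y] mult_left_mono[OF lin[of y] C0]] by simp
  have I1: "integrable lborel (\<lambda>y. l y * exp (- g y))"
  proof (rule Bochner_Integration.integrable_bound)
    show "integrable lborel (\<lambda>y. C / \<kappa> * h y)" using h by simp
    show "AE y in lborel. norm (l y * exp (- g y)) \<le> norm (C / \<kappa> * h y)"
    proof (rule AE_I2)
      fix y :: 'a
      have "norm (l y * exp (- g y)) \<le> (C / \<kappa> * exp (\<kappa> * norm y)) * exp (- (4 * (\<kappa> * norm y)))"
        unfolding norm_mult using lb[of y] gle[of y] by (intro mult_mono) (auto intro: order_trans[OF abs_ge_zero])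
      also have "\<dots> = C / \<kappa> * exp (- (3 * (\<kappa> * norm y)))" by (simp add: exp_add[symmetric])
      also have "\<dots> \<le> C / \<kappa> * h y" unfolding h_def using C0 \<kappa> by (intro mult_left_mono) auto
      finally show "norm (l y * exp (- g y)) \<le> norm (C / \<kappa> * h y)" using abs_ge_self order_trans by fastforce
    qed
  qed measurable
  show "integrable lborel (\<lambda>y. l y * exp (- g y))" by (rule I1)
  define M where "M = (\<integral>y. (C / \<kappa>)\<^sup>2 * h y \<partial>lborel)"
  have M0: "M \<ge> 0" unfolding M_def h_def by (intro integral_nonneg_AE) auto
  define A where "A = (\<integral>y. l y * exp (- g y) \<partial>lborel)"
  have taylor: "exp u \<le> 1 + u + u\<^sup>2 * exp \<bar>u\<bar>" for u :: real
  proof -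
    obtain t where t: "\<bar>t\<bar> \<le> \<bar>u\<bar>" "exp u = (\<Sum>m<2. (u ^ m) / fact m) + (exp t / fact 2) * u ^ 2"
      using Maclaurin_exp_le by blast
    have "exp t / fact 2 \<le> exp \<bar>u\<bar>"
    proof -
      have "exp t / fact 2 \<le> exp t" by (simp add: fact_2)
      also have "\<dots> \<le> exp \<bar>u\<bar>" using t(1) by simp
      finally show ?thesis .
    qed
    then have "(exp t / fact 2) * u\<^sup>2 \<le> exp \<bar>u\<bar> * u\<^sup>2" by (rule mult_right_mono) simp
    then show ?thesis using t(2) by (simp add: numeral_2_eq_2 mult.commute)
  qed
  have key: "0 \<le> \<epsilon> * A + \<epsilon>\<^sup>2 * M" if \<epsilon>: "\<bar>\<epsilon>\<bar> < \<epsilon>0" "\<bar>\<epsilon>\<bar> * C \<le> \<kappa>" for \<epsilon>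
  proof -
    have pw: "exp (- g y + \<epsilon> * l y) \<le> exp (- g y) + \<epsilon> * (l y * exp (- g y)) + \<epsilon>\<^sup>2 * ((C / \<kappa>)\<^sup>2 * h y)" for y
    proof -
      have el: "\<bar>\<epsilon> * l y\<bar> \<le> \<kappa> * norm y"
      proof -
        have "\<bar>\<epsilon> * l y\<bar> \<le> \<bar>\<epsilon>\<bar> * (C * norm y)" unfolding abs_mult by (rule mult_left_mono[OF C]) simp
        also have "\<dots> = (\<bar>\<epsilon>\<bar> * C) * norm y" by simp
        also have "\<dots> \<le> \<kappa> * norm y" using \<epsilon>(2) by (rule mult_right_mono) simp
        finally show ?thesis .
      qed
      have l2: "(l y)\<^sup>2 \<le> (C / \<kappa>)\<^sup>2 * exp (2 * (\<kappa> * norm y))"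
      proof -
        have "\<bar>l y\<bar>\<^sup>2 \<le> (C / \<kappa> * exp (\<kappa> * norm y))\<^sup>2" by (rule power_mono[OF lb]) simp
        also have "\<dots> = (C / \<kappa>)\<^sup>2 * exp (2 * (\<kappa> * norm y))"
          by (simp only: power_mult_distrib exp_double)
        finally show ?thesis by simp
      qed
      have "exp (- g y) * ((l y)\<^sup>2 * exp \<bar>\<epsilon> * l y\<bar>)
          \<le> exp (- (4 * (\<kappa> * norm y))) * (((C / \<kappa>)\<^sup>2 * exp (2 * (\<kappa> * norm y))) * exp (\<kappa> * norm y))"
        using gle[of y] l2 el by (intro mult_mono) auto
      also have "\<dots> = (C / \<kappa>)\<^sup>2 * h y"
      proof -
        have "exp (- (4 * (\<kappa> * norm y))) * (exp (2 * (\<kappa> * norm y)) * exp (\<kappa> * norm y)) = h y"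
          unfolding h_def by (simp add: exp_add[symmetric])
        then show ?thesis by (simp add: mult_ac)
      qed
      finally have q: "exp (- g y) * ((l y)\<^sup>2 * exp \<bar>\<epsilon> * l y\<bar>) \<le> (C / \<kappa>)\<^sup>2 * h y" .
      have "exp (- g y + \<epsilon> * l y) = exp (- g y) * exp (\<epsilon> * l y)" by (rule exp_add)
      also have "\<dots> \<le> exp (- g y) * (1 + \<epsilon> * l y + (\<epsilon> * l y)\<^sup>2 * exp \<bar>\<epsilon> * l y\<bar>)"
        by (rule mult_left_mono[OF taylor]) simp
      also have "\<dots> = exp (- g y) + \<epsilon> * (l y * exp (- g y)) + \<epsilon>\<^sup>2 * (exp (- g y) * ((l y)\<^sup>2 * exp \<bar>\<epsilon> * l y\<bar>))"
        by (simp add: distrib_left power_mult_distrib mult_ac)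
      also have "\<dots> \<le> exp (- g y) + \<epsilon> * (l y * exp (- g y)) + \<epsilon>\<^sup>2 * ((C / \<kappa>)\<^sup>2 * h y)"
        using q by (intro add_left_mono mult_left_mono) auto
      finally show ?thesis .
    qed
    have int: "integrable lborel (\<lambda>y. exp (- g y) + \<epsilon> * (l y * exp (- g y)) + \<epsilon>\<^sup>2 * ((C / \<kappa>)\<^sup>2 * h y))"
      using I0 I1 h by simp
    have nn: "0 \<le> exp (- g y) + \<epsilon> * (l y * exp (- g y)) + \<epsilon>\<^sup>2 * ((C / \<kappa>)\<^sup>2 * h y)" for y
      using pw[of y] by (rule order_trans[rotated]) simp
    have "ennreal (\<integral>y. exp (- g y) \<partial>lborel) = (\<integral>\<^sup>+y. ennreal (exp (- g y)) \<partial>lborel)"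
      by (subst nn_integral_eq_integral[OF I0]) auto
    also have "\<dots> \<le> (\<integral>\<^sup>+y. ennreal (exp (- g y + \<epsilon> * l y)) \<partial>lborel)" by (rule min[OF \<epsilon>(1)])
    also have "\<dots> \<le> (\<integral>\<^sup>+y. ennreal (exp (- g y) + \<epsilon> * (l y * exp (- g y)) + \<epsilon>\<^sup>2 * ((C / \<kappa>)\<^sup>2 * h y)) \<partial>lborel)"
      by (intro nn_integral_mono ennreal_leI pw)
    also have "\<dots> = ennreal (\<integral>y. exp (- g y) + \<epsilon> * (l y * exp (- g y)) + \<epsilon>\<^sup>2 * ((C / \<kappa>)\<^sup>2 * h y) \<partial>lborel)"
      using nn by (intro nn_integral_eq_integral[OF int]) auto
    also have "(\<integral>y. exp (- g y) + \<epsilon> * (l y * exp (- g y)) + \<epsilon>\<^sup>2 * ((C / \<kappa>)\<^sup>2 * h y) \<partial>lborel)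
        = (\<integral>y. exp (- g y) \<partial>lborel) + \<epsilon> * A + \<epsilon>\<^sup>2 * M"
      unfolding A_def M_def using I0 I1 h by simp
    finally have "(\<integral>y. exp (- g y) \<partial>lborel) \<le> (\<integral>y. exp (- g y) \<partial>lborel) + \<epsilon> * A + \<epsilon>\<^sup>2 * M"
    proof (subst (asm) ennreal_le_iff)
      have "0 \<le> (\<integral>y. exp (- g y) + \<epsilon> * (l y * exp (- g y)) + \<epsilon>\<^sup>2 * ((C / \<kappa>)\<^sup>2 * h y) \<partial>lborel)"
        using nn by (intro integral_nonneg_AE) auto
      also have "\<dots> = (\<integral>y. exp (- g y) \<partial>lborel) + \<epsilon> * A + \<epsilon>\<^sup>2 * M"
        unfolding A_def M_def using I0 I1 h by simp
      finally show "0 \<le> (\<integral>y. exp (- g y) \<partial>lborel) + \<epsilon> * A + \<epsilon>\<^sup>2 * M" .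
    qed
    then show ?thesis by simp
  qed
  have "A = 0"
  proof (rule ccontr)
    assume A: "A \<noteq> 0"
    \<comment> \<open>The first two bounds make \<open>key\<close> applicable for both signs; the
      third makes the quadratic term smaller than the linear one.\<close>
    define \<epsilon> where "\<epsilon> = min (\<epsilon>0 / 2) (min (\<kappa> / (C + 1)) (\<bar>A\<bar> / (2 * (M + 1))))"
    have \<epsilon>p: "\<epsilon> > 0" unfolding \<epsilon>_def using \<epsilon>0 \<kappa> C0 M0 A by (simp add: add_nonneg_pos)
    have \<epsilon>1: "\<epsilon> < \<epsilon>0" unfolding \<epsilon>_def using \<epsilon>0 by auto
    have \<epsilon>2: "\<epsilon> * C \<le> \<kappa>"
    proof -
      have "\<epsilon> \<le> \<kappa> / (C + 1)" unfolding \<epsilon>_def by simp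
      then have "\<epsilon> * (C + 1) \<le> \<kappa>" using C0 by (simp add: pos_le_divide_eq)
      then show ?thesis using \<epsilon>p by (simp add: distrib_left)
    qed
    have \<epsilon>3: "\<epsilon> * M < \<bar>A\<bar>"
    proof -
      have "\<epsilon> \<le> \<bar>A\<bar> / (2 * (M + 1))" unfolding \<epsilon>_def by simp
      then have "\<epsilon> * (2 * (M + 1)) \<le> \<bar>A\<bar>" using M0 by (simp add: pos_le_divide_eq)
      then have "2 * (\<epsilon> * M) + 2 * \<epsilon> \<le> \<bar>A\<bar>" by (simp add: algebra_simps)
      moreover have "\<epsilon> * M \<ge> 0" using \<epsilon>p M0 by simp
      ultimately show ?thesis using \<epsilon>p by linarith
    qed
    have "0 \<le> \<epsilon> * A + \<epsilon>\<^sup>2 * M" by (rule key) (use \<epsilon>p \<epsilon>1 \<epsilon>2 in auto)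
    then have "0 \<le> \<epsilon> * (A + \<epsilon> * M)" by (simp add: power2_eq_square algebra_simps)
    then have 1: "0 \<le> A + \<epsilon> * M" using \<epsilon>p by (simp add: zero_le_mult_iff)
    have "0 \<le> (- \<epsilon>) * A + (- \<epsilon>)\<^sup>2 * M" by (rule key) (use \<epsilon>p \<epsilon>1 \<epsilon>2 in auto)
    then have "0 \<le> \<epsilon> * (- A + \<epsilon> * M)" by (simp add: power2_eq_square algebra_simps)
    then have 2: "0 \<le> - A + \<epsilon> * M" using \<epsilon>p by (simp add: zero_le_mult_iff)
    show False using 1 2 \<epsilon>3 by linarith
  qed
  then show "(\<integral>y. l y * exp (- g y) \<partial>lborel) = 0" unfolding A_def .
qed

subsection \<open>Polar bodies and Santalo points\<close>

definition shifted_support :: "'a::euclidean_space set \<Rightarrow> 'a \<Rightarrow> 'a \<Rightarrow> real" where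
  "shifted_support K z y = (SUP x\<in>K. y \<bullet> (x - z))"

text \<open>For \<open>A = UNIV\<close> and an interior point \<open>z\<close>, this is \<open>d!\<close> times the volume of the polar body.\<close>

definition polar_integral :: "'a::euclidean_space set \<Rightarrow> 'a set \<Rightarrow> 'a \<Rightarrow> ennreal" where
  "polar_integral A K z = (\<integral>\<^sup>+y. ennreal (exp (- shifted_support K z y)) * indicator A y \<partial>lborel)"

locale convex_body =
  fixes K :: "'a::euclidean_space set"
  assumes compact: "compact K" and conv: "convex K" and interior: "interior K \<noteq> {}"
begin

section \<open>Support functions of a convex body\<close>

abbreviation g where "g \<equiv> shifted_support K"

lemma nonempty: "K \<noteq> {}" using interior interior_subset by blast

lemma bdd: "bdd_above ((\<lambda>x. y \<bullet> (x - z)) ` K)"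
proof -
  have "compact ((\<lambda>x. y \<bullet> (x - z)) ` K)"
    by (intro compact_continuous_image compact continuous_intros)
  then show ?thesis by (rule bounded_imp_bdd_above[OF compact_imp_bounded])
qed

lemma support_upper: "x \<in> K \<Longrightarrow> y \<bullet> (x - z) \<le> g z y"
  unfolding shifted_support_def by (rule cSUP_upper[OF _ bdd])

lemma support_least: "(\<And>x. x \<in> K \<Longrightarrow> y \<bullet> (x - z) \<le> c) \<Longrightarrow> g z y \<le> c"
  unfolding shifted_support_def by (rule cSUP_least[OF nonempty])

lemma support_attained: obtains x where "x \<in> K" "g z y = y \<bullet> (x - z)"
proof -
  have "continuous_on K (\<lambda>x. y \<bullet> (x - z))" by (intro continuous_intros)
  then obtain x where x: "x \<in> K" "\<And>x'. x' \<in> K \<Longrightarrow> y \<bullet> (x' - z) \<le> y \<bullet> (x - z)"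
    using continuous_attains_sup[OF compact nonempty] by blast
  show thesis
    by (rule that[OF x(1)]) (intro antisym support_least support_upper x)
qed

lemma support_shift: "g (z + v) y = g z y - y \<bullet> v"
proof (rule antisym)
  show "g (z + v) y \<le> g z y - y \<bullet> v"
    by (rule support_least) (use support_upper[of _ y z] in \<open>simp add: inner_diff_right inner_add_right\<close>)
  have "g z y \<le> g (z + v) y + y \<bullet> v"
    by (rule support_least) (use support_upper[of _ y "z + v"] in \<open>simp add: inner_diff_right inner_add_right algebra_simps\<close>)
  then show "g z y - y \<bullet> v \<le> g (z + v) y" by simp
qed

lemma support_eq: "g z y = g 0 y - y \<bullet> z"
  using support_shift[of 0 z y] by simp

lemma support_add: "g z (y + y') \<le> g z y + g z y'"
  by (rule support_least) (simp add: inner_add_left add_mono support_upper)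

lemma support_scale: assumes "t \<ge> 0" shows "g z (t *\<^sub>R y) = t * g z y"
proof -
  obtain x where x: "x \<in> K" "g z y = y \<bullet> (x - z)" by (rule support_attained)
  show ?thesis
  proof (rule antisym)
    show "g z (t *\<^sub>R y) \<le> t * g z y"
      using assms by (intro support_least) (simp add: mult_left_mono support_upper)
    show "t * g z y \<le> g z (t *\<^sub>R y)"
      using support_upper[OF x(1), of "t *\<^sub>R y" z] x(2) by simp
  qed
qed

lemma support_homogeneous: "homogeneous (g z)"
  unfolding homogeneous_def by (simp add: support_scale)

lemma support_convex: "convex_on UNIV (g z)"
proof (rule convex_onI)
  fix t :: real and x y :: 'a assume "0 < t" "t < 1"
  then show "g z ((1 - t) *\<^sub>R x + t *\<^sub>R y) \<le> (1 - t) * g z x + t * g z y"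
    using support_add[of z "(1 - t) *\<^sub>R x" "t *\<^sub>R y"] by (simp add: support_scale)
qed auto

lemma support_continuous: "continuous_on UNIV (g z)"
  by (rule convex_on_continuous[OF open_UNIV support_convex])

lemma support_measurable[measurable]: "g z \<in> borel_measurable borel"
  using support_continuous by (rule borel_measurable_continuous_onI)

lemma support_upper_norm: obtains R where "R > 0" "\<And>y. g z y \<le> R * norm y"
proof -
  obtain R where R: "\<And>x. x \<in> K \<Longrightarrow> norm x \<le> R"
    using compact_imp_bounded[OF compact] by (auto simp: bounded_iff)
  define R' where "R' = \<bar>R\<bar> + norm z + 1"
  have "g z y \<le> R' * norm y" for y
  proof (rule support_least)
    fix x assume "x \<in> K"
    then have "norm (x - z) \<le> R'" unfolding R'_def using R[of x] norm_triangle_ineq4[of x z] by linarith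
    then have "norm y * norm (x - z) \<le> norm y * R'" by (rule mult_left_mono) simp
    then show "y \<bullet> (x - z) \<le> R' * norm y"
      using norm_cauchy_schwarz[of y "x - z"] by (simp add: mult.commute)
  qed
  moreover have "R' > 0" unfolding R'_def by (simp add: add_nonneg_pos)
  ultimately show thesis by (rule that[rotated])
qed

lemma support_lower_norm:
  assumes "z \<in> interior K"
  obtains \<rho> where "\<rho> > 0" "\<And>y. \<rho> * norm y \<le> g z y"
proof -
  obtain \<rho> where \<rho>: "\<rho> > 0" "cball z \<rho> \<subseteq> K"
    using assms by (auto simp: mem_interior_cball)
  have "\<rho> * norm y \<le> g z y" for y
  proof (cases "y = 0")
    case True
    then show ?thesis using support_scale[of 0 z 0] by simp
  next
    case False
    define x where "x = z + (\<rho> / norm y) *\<^sub>R y"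
    have "x \<in> K" using \<rho> False unfolding x_def by (intro subsetD[OF \<rho>(2)]) (simp add: dist_norm)
    from support_upper[OF this, of y z] show ?thesis
      using False unfolding x_def by (simp add: power2_norm_eq_inner[symmetric] power2_eq_square)
  qed
  then show thesis using \<rho>(1) by (rule that[rotated])
qed

lemma polar_body_eq: "polar_body K z = {y. g z y \<le> 1}"
  unfolding polar_body_def by (auto intro: support_least order_trans[OF support_upper])

section \<open>The polar integral as a function of the base point\<close>

lemma polar_integral_finite:
  assumes "z \<in> interior K"
  shows "polar_integral A K z < \<infinity>"
proof -
  obtain \<rho> where \<rho>: "\<rho> > 0" "\<And>y. \<rho> * norm y \<le> g z y" using support_lower_norm[OF assms] by blast
  have "polar_integral A K z \<le> (\<integral>\<^sup>+y. ennreal (exp (- (\<rho> * norm y))) \<partial>(lborel :: 'a measure))"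
    unfolding polar_integral_def using \<rho>(2)
    by (intro nn_integral_mono) (auto simp: indicator_def intro!: ennreal_leI)
  also have "\<dots> < \<infinity>" by (rule nn_integral_exp_norm_finite[OF \<rho>(1)])
  finally show ?thesis .
qed

lemma polar_volume:
  assumes "z \<in> interior K"
  shows "ennreal (measure lebesgue (polar_body K z)) * ennreal (fact (DIM('a))) = polar_integral UNIV K z"
    and "measure lebesgue (polar_body K z) > 0"
proof -
  obtain \<rho> where \<rho>: "\<rho> > 0" "\<And>y. \<rho> * norm y \<le> g z y" using support_lower_norm[OF assms] by blast
  have nn: "g z y \<ge> 0" for y using \<rho>(2)[of y] \<rho>(1) by (meson less_imp_le mult_nonneg_nonneg norm_ge_zero order_trans)
  have eq: "polar_integral UNIV K z = ennreal (fact (DIM('a))) * emeasure lborel {y. g z y \<le> 1}"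
    unfolding polar_integral_def
    using exp_integral_eq_sublevel[OF support_measurable support_homogeneous nn] by simp
  have fin: "emeasure lborel {y. g z y \<le> 1} < \<infinity>"
    using polar_integral_finite[OF assms, of UNIV] unfolding eq by (auto simp: ennreal_mult_less_top)
  have leb: "measure lebesgue {y. g z y \<le> 1} = measure lborel {y. g z y \<le> 1}"
    by (rule measure_completion) simp
  show "ennreal (measure lebesgue (polar_body K z)) * ennreal (fact (DIM('a))) = polar_integral UNIV K z"
    unfolding polar_body_eq leb eq using fin
    by (subst emeasure_eq_ennreal_measure) (auto simp: mult.commute)
  obtain R where R: "R > 0" "\<And>y. g z y \<le> R * norm y" using support_upper_norm by blast
  have "ball 0 (1 / R) \<subseteq> {y. g z y \<le> 1}"
  proof
    fix y :: 'a assume "y \<in> ball 0 (1 / R)"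
    then have "R * norm y \<le> 1" using R(1) by (simp add: field_simps)
    then show "y \<in> {y. g z y \<le> 1}" using R(2)[of y] by simp
  qed
  then have "emeasure lborel (ball (0::'a) (1 / R)) \<le> emeasure lborel {y. g z y \<le> 1}"
    by (rule emeasure_mono) simp
  moreover have "emeasure lborel (ball (0::'a) (1 / R)) > 0"
    using R(1) by (simp add: emeasure_ball)
  ultimately have "emeasure lborel {y. g z y \<le> 1} \<noteq> 0" by auto
  then show "measure lebesgue (polar_body K z) > 0"
    unfolding polar_body_eq leb using fin
    by (simp add: measure_def enn2real_positive_iff zero_less_iff_neq_zero)
qed

text \<open>Lower semicontinuity in the base point, with boundary points of \<open>K\<close>
  included. It carries minimising sequences to their limit, and infinite values at the boundary back
  to nearby interior points.\<close>

lemma polar_integral_Fatou: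
  assumes [measurable]: "A \<in> sets borel" and Z: "Z \<longlonglongrightarrow> z"
  shows "polar_integral A K z \<le> liminf (\<lambda>n. polar_integral A K (Z n))"
proof -
  have "polar_integral A K z = (\<integral>\<^sup>+y. liminf (\<lambda>n. ennreal (exp (- g (Z n) y)) * indicator A y) \<partial>lborel)"
    unfolding polar_integral_def
  proof (intro nn_integral_cong lim_imp_Liminf[symmetric])
    fix y
    have "(\<lambda>n. exp (- (g 0 y - y \<bullet> Z n))) \<longlonglongrightarrow> exp (- (g 0 y - y \<bullet> z))"
      by (intro tendsto_intros Z)
    then have "(\<lambda>n. ennreal (exp (- g (Z n) y))) \<longlonglongrightarrow> ennreal (exp (- g z y))"
      unfolding support_eq[of z] support_eq[of "Z _"] by (rule tendsto_ennrealI)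
    then show "(\<lambda>n. ennreal (exp (- g (Z n) y)) * indicator A y) \<longlonglongrightarrow> ennreal (exp (- g z y)) * indicator A y"
      by (cases "y \<in> A") auto
  qed simp
  also have "\<dots> \<le> liminf (\<lambda>n. \<integral>\<^sup>+y. ennreal (exp (- g (Z n) y)) * indicator A y \<partial>lborel)"
    by (rule nn_integral_liminf) measurable
  finally show ?thesis unfolding polar_integral_def .
qed

text \<open>A hyperplane separates \<open>z\<close> from the interior, and its normal
  \<open>u\<close> has \<open>g z u \<le> 0\<close>. Hence \<open>g z\<close> stays below a fixed
  bound on the unit balls centred at the multiples of \<open>u\<close>, and infinitely many disjoint
  balls of equal volume contribute.\<close>

lemma polar_integral_infinite:
  assumes z: "z \<notin> interior K"
  shows "polar_integral UNIV K z = \<infinity>"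
proof (rule ccontr)
  assume fin: "polar_integral UNIV K z \<noteq> \<infinity>"
  obtain a b where a: "a \<noteq> 0" "\<And>x. x \<in> interior K \<Longrightarrow> a \<bullet> x \<le> b" "a \<bullet> z \<ge> b"
    using separating_hyperplane_sets[of "interior K" "{z}"] z interior convex_interior[OF conv] by auto
  have "closure (interior K) \<subseteq> {x. a \<bullet> x \<le> b}"
    by (rule closure_minimal) (use a(2) in \<open>auto simp: closed_halfspace_le\<close>)
  then have K: "a \<bullet> x \<le> b" if "x \<in> K" for x
    using that closure_subset[of K] unfolding convex_closure_interior[OF conv interior] by blast
  \<comment> \<open>Length \<open>3\<close> keeps the unit balls around distinct multiples of
    \<open>u\<close> disjoint.\<close>
  define u where "u = (3 / norm a) *\<^sub>R a"
  have u: "norm u = 3" unfolding u_def using a(1) by simp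
  have gu: "g z u \<le> 0"
  proof (rule support_least)
    fix x assume "x \<in> K"
    then have "a \<bullet> (x - z) \<le> 0" using K[of x] a(3) by (simp add: inner_diff_right)
    then show "u \<bullet> (x - z) \<le> 0" unfolding u_def using a(1) by (simp add: divide_le_0_iff mult_le_0_iff)
  qed
  obtain R where R: "R > 0" "\<And>y. g z y \<le> R * norm y" using support_upper_norm by blast
  define D where "D = (\<lambda>j::nat. ball (real j *\<^sub>R u) 1)"
  have disj: "disjoint_family D"
    unfolding disjoint_family_on_def
  proof (intro ballI impI)
    fix m n :: nat assume "m \<noteq> n"
    have "norm ((real m - real n) *\<^sub>R u) \<ge> 3"
      using u \<open>m \<noteq> n\<close> by auto
    then have "dist (real m *\<^sub>R u) (real n *\<^sub>R u) \<ge> 1 + 1"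
      by (simp add: dist_norm scaleR_left_diff_distrib[symmetric] del: norm_scaleR)
    then show "D m \<inter> D n = {}" unfolding D_def by (rule disjoint_ballI)
  qed
  have lower: "ennreal (exp (- R)) * indicator (\<Union>j. D j) y \<le> ennreal (exp (- g z y)) * indicator UNIV y" for y
  proof (cases "y \<in> (\<Union>j. D j)")
    case True
    then obtain j :: nat where j: "norm (y - real j *\<^sub>R u) < 1" unfolding D_def by (auto simp: dist_norm norm_minus_commute)
    have "g z y \<le> g z (real j *\<^sub>R u) + g z (y - real j *\<^sub>R u)" using support_add[of z "real j *\<^sub>R u" "y - real j *\<^sub>R u"] by simp
    also have "g z (real j *\<^sub>R u) = real j * g z u" by (rule support_scale) simp
    finally have "g z y \<le> real j * g z u + g z (y - real j *\<^sub>R u)" .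
    moreover have "real j * g z u \<le> 0" using gu by (simp add: mult_nonneg_nonpos)
    moreover have "R * norm (y - real j *\<^sub>R u) \<le> R * 1" using R(1) j by (intro mult_left_mono) auto
    ultimately have "g z y \<le> R" using R(2)[of "y - real j *\<^sub>R u"] by linarith
    then show ?thesis using True by (auto intro!: ennreal_leI)
  next
    case False then show ?thesis by simp
  qed
  define c where "c = unit_ball_vol (real (DIM('a)))"
  have c: "c > 0" unfolding c_def by simp
  have "(\<Sum>j. ennreal c) = (\<Sum>j. emeasure lborel (D j))"
    unfolding D_def by (simp add: emeasure_ball c_def)
  also have "\<dots> = emeasure lborel (\<Union>j. D j)"
    by (rule suminf_emeasure[OF _ disj]) (auto simp: D_def)
  finally have S: "(\<Sum>j. ennreal c) = emeasure lborel (\<Union>j. D j)" .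
  have "ennreal (exp (- R)) * emeasure lborel (\<Union>j. D j) = (\<integral>\<^sup>+y. ennreal (exp (- R)) * indicator (\<Union>j. D j) y \<partial>lborel)"
    by (rule nn_integral_cmult_indicator[symmetric]) (auto simp: D_def)
  also have "\<dots> \<le> polar_integral UNIV K z"
    unfolding polar_integral_def by (rule nn_integral_mono[OF lower])
  also have "\<dots> < \<infinity>" using fin by (simp add: less_top)
  finally have "(\<Sum>j. ennreal c) \<noteq> top" unfolding S by (auto simp: ennreal_mult_less_top ennreal_mult_eq_top_iff)
  then have "summable (\<lambda>j::nat. c)" using c by (intro summable_suminf_not_top) auto
  then show False using c by (simp add: summable_const_iff)
qed

text \<open>A minimising sequence accumulates in the compact \<open>K\<close>, where Fatou bounds
  the limit value by the infimum. The limit point cannot lie on the boundary, since the value there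
  would be infinite.\<close>

lemma polar_integral_minimizer_exists:
  obtains s where "s \<in> interior K" "\<And>w. w \<in> interior K \<Longrightarrow> polar_integral UNIV K s \<le> polar_integral UNIV K w"
proof -
  let ?E = "polar_integral UNIV K"
  define m where "m = (INF w\<in>interior K. ?E w)"
  obtain f where f: "\<And>n. f n \<in> ?E ` interior K" "f \<longlonglongrightarrow> m"
    using Inf_as_limit[of "?E ` interior K"] interior unfolding m_def by auto
  then have "\<forall>n. \<exists>w. w \<in> interior K \<and> f n = ?E w" by auto
  then obtain W where W: "\<And>n. W n \<in> interior K" "\<And>n. f n = ?E (W n)" by metis
  have WK: "W n \<in> K" for n using W(1)[of n] interior_subset by blast
  obtain s r where s: "s \<in> K" "strict_mono r" "(W \<circ> r) \<longlonglongrightarrow> s"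
    using compact[unfolded compact_def, rule_format, of W] WK by auto
  have "?E s \<le> liminf (\<lambda>n. ?E ((W \<circ> r) n))" by (rule polar_integral_Fatou[OF _ s(3)]) simp
  also have "(\<lambda>n. ?E ((W \<circ> r) n)) = f \<circ> r" using W(2) by auto
  also have "liminf (f \<circ> r) = m"
    using LIMSEQ_subseq_LIMSEQ[OF f(2) s(2)] by (intro lim_imp_Liminf) auto
  finally have le: "?E s \<le> m" .
  have mw: "m \<le> ?E w" if "w \<in> interior K" for w unfolding m_def using that by (rule INF_lower)
  obtain w0 where "w0 \<in> interior K" using interior by auto
  then have "?E s < \<infinity>" using le mw polar_integral_finite by (meson le_less_trans)
  then have "s \<in> interior K" using polar_integral_infinite by fastforce
  then show thesis using that le mw order_trans by blast
qed

text \<open>Strict convexity of the exponential: at the midpoint \<open>w\<close> the integrand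
  falls short of the average by half the square of
  \<open>exp (- g z y / 2) - exp (- g z' y / 2)\<close>. Two minimisers therefore have equal support
  functions.\<close>

lemma polar_integral_minimizer_unique:
  assumes z: "z \<in> interior K" "z' \<in> interior K"
    and min: "\<And>w. w \<in> interior K \<Longrightarrow> polar_integral UNIV K z \<le> polar_integral UNIV K w"
    and eq: "polar_integral UNIV K z' = polar_integral UNIV K z"
  shows "z' = z"
proof (rule ccontr)
  assume neq: "z' \<noteq> z"
  define w where "w = (1/2) *\<^sub>R z + (1/2) *\<^sub>R z'"
  have w: "w \<in> interior K"
    unfolding w_def using convexD[OF convex_interior[OF conv] z(1,2), of "1/2" "1/2"] by simp
  define A B C where "A = (\<lambda>y. exp (- g z y))" and "B = (\<lambda>y. exp (- g z' y))" and "C = (\<lambda>y. exp (- g w y))"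
  have gw: "- g w y = (- g z y + - g z' y) / 2" for y
    using support_eq[of w y] support_eq[of z y] support_eq[of z' y] unfolding w_def by (simp add: inner_add_right)
  have sq: "(A y + B y) / 2 - C y = (exp (- g z y / 2) - exp (- g z' y / 2))\<^sup>2 / 2" for y
  proof -
    have "A y = (exp (- g z y / 2))\<^sup>2" "B y = (exp (- g z' y / 2))\<^sup>2"
      unfolding A_def B_def by (simp_all add: exp_double[symmetric])
    moreover have "C y = exp (- g z y / 2) * exp (- g z' y / 2)"
      unfolding C_def gw by (simp add: exp_add[symmetric] add_divide_distrib diff_divide_distrib)
    ultimately show ?thesis by (simp add: power2_diff field_simps)
  qed
  have sq0: "(A y + B y) / 2 - C y \<ge> 0" for y unfolding sq by simp
  have [measurable]: "A \<in> borel_measurable borel" "B \<in> borel_measurable borel" "C \<in> borel_measurable borel"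
    unfolding A_def B_def C_def by measurable
  have E: "polar_integral UNIV K v = (\<integral>\<^sup>+y. ennreal (exp (- g v y)) \<partial>lborel)" for v
    unfolding polar_integral_def by simp
  obtain m where m: "polar_integral UNIV K z = ennreal m" "m \<ge> 0"
    using polar_integral_finite[OF z(1), of UNIV] by (cases "polar_integral UNIV K z") auto
  have "ennreal m + ennreal m = (\<integral>\<^sup>+y. ennreal (A y) + ennreal (B y) \<partial>lborel)"
    using m eq unfolding E A_def B_def by (subst nn_integral_add) auto
  also have "\<dots> = (\<integral>\<^sup>+y. (ennreal (C y) + ennreal (C y)) + ennreal (2 * ((A y + B y) / 2 - C y)) \<partial>lborel)"
  proof (rule nn_integral_cong)
    fix y
    have p: "A y \<ge> 0" "B y \<ge> 0" "C y \<ge> 0" unfolding A_def B_def C_def by simp_all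
    have "ennreal (A y) + ennreal (B y) = ennreal (A y + B y)" using p by simp
    also have "A y + B y = (C y + C y) + 2 * ((A y + B y) / 2 - C y)" by simp
    also have "ennreal \<dots> = ennreal (C y + C y) + ennreal (2 * ((A y + B y) / 2 - C y))"
      using p sq0[of y] by (intro ennreal_plus) auto
    also have "ennreal (C y + C y) = ennreal (C y) + ennreal (C y)"
      using p by (intro ennreal_plus) auto
    finally show "ennreal (A y) + ennreal (B y) = (ennreal (C y) + ennreal (C y)) + ennreal (2 * ((A y + B y) / 2 - C y))" .
  qed
  also have "\<dots> = (polar_integral UNIV K w + polar_integral UNIV K w) + (\<integral>\<^sup>+y. ennreal (2 * ((A y + B y) / 2 - C y)) \<partial>lborel)"
    unfolding E C_def[symmetric, THEN fun_cong] by (subst nn_integral_add, simp, simp)+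
  finally have sum: "ennreal m + ennreal m = (polar_integral UNIV K w + polar_integral UNIV K w) + (\<integral>\<^sup>+y. ennreal (2 * ((A y + B y) / 2 - C y)) \<partial>lborel)" .
  have "ennreal m \<le> polar_integral UNIV K w" using min[OF w] m by simp
  then have "(ennreal m + ennreal m) + (\<integral>\<^sup>+y. ennreal (2 * ((A y + B y) / 2 - C y)) \<partial>lborel)
      \<le> (polar_integral UNIV K w + polar_integral UNIV K w) + (\<integral>\<^sup>+y. ennreal (2 * ((A y + B y) / 2 - C y)) \<partial>lborel)"
    by (intro add_mono order_refl)
  also have "\<dots> = (ennreal m + ennreal m) + 0" using sum[symmetric] by (simp only: add_0_right)
  finally have "(\<integral>\<^sup>+y. ennreal (2 * ((A y + B y) / 2 - C y)) \<partial>lborel) = 0"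
    using m(2) by (subst (asm) ennreal_add_left_cancel_le) auto
  moreover have "continuous_on UNIV (\<lambda>y. 2 * ((A y + B y) / 2 - C y))"
    unfolding A_def B_def C_def by (intro continuous_intros support_continuous) auto
  \<comment> \<open>The gap vanishes at every point; \<open>y = z' - z\<close> is the one at which
    \<open>g z y - g z' y\<close> equals the squared distance.\<close>
  ultimately have "2 * ((A (z' - z) + B (z' - z)) / 2 - C (z' - z)) \<le> 0"
    by (intro continuous_nn_integral_zero)
  then have "(exp (- g z (z' - z) / 2) - exp (- g z' (z' - z) / 2))\<^sup>2 / 2 \<le> 0" unfolding sq by simp
  then have "g z (z' - z) = g z' (z' - z)" by simp
  then have "(z' - z) \<bullet> (z' - z) = 0" unfolding support_eq[of z] support_eq[of z'] by (simp add: inner_diff_right)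
  then show False using neq by simp
qed

lemma volume_le_iff:
  assumes "z \<in> interior K" "w \<in> interior K"
  shows "measure lebesgue (polar_body K z) \<le> measure lebesgue (polar_body K w)
    \<longleftrightarrow> polar_integral UNIV K z \<le> polar_integral UNIV K w"
proof -
  have "(fact (DIM('a)) :: real) > 0" by simp
  then show ?thesis
    unfolding polar_volume(1)[OF assms(1), symmetric] polar_volume(1)[OF assms(2), symmetric]
    by (simp add: ennreal_mult[symmetric] ennreal_le_iff)
qed

text \<open>Existence and uniqueness of the minimiser make the definite description denote. From
  here on the Santalo point is used as the minimiser of the polar integral.\<close>

lemma santalo_point:
  shows "santalo_point K \<in> interior K"
    and "\<And>w. w \<in> interior K \<Longrightarrow> polar_integral UNIV K (santalo_point K) \<le> polar_integral UNIV K w"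
proof -
  obtain s where s: "s \<in> interior K" "\<And>w. w \<in> interior K \<Longrightarrow> polar_integral UNIV K s \<le> polar_integral UNIV K w"
    using polar_integral_minimizer_exists by blast
  have "santalo_point K = s"
    unfolding santalo_point_def
  proof (rule the_equality)
    show "s \<in> interior K \<and> (\<forall>w\<in>interior K. measure lebesgue (polar_body K s) \<le> measure lebesgue (polar_body K w))"
      using s volume_le_iff by blast
    fix z assume z: "z \<in> interior K \<and> (\<forall>w\<in>interior K. measure lebesgue (polar_body K z) \<le> measure lebesgue (polar_body K w))"
    then have "polar_integral UNIV K z \<le> polar_integral UNIV K s" using s(1) volume_le_iff by blast
    then show "z = s" using z s by (intro polar_integral_minimizer_unique) (auto intro: antisym)
  qed
  then show "santalo_point K \<in> interior K"
    "\<And>w. w \<in> interior K \<Longrightarrow> polar_integral UNIV K (santalo_point K) \<le> polar_integral UNIV K w"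
    using s by auto
qed

end

subsection \<open>The two halves of a polar body\<close>

text \<open>Charts on the hyperplane orthogonal to \<open>e\<close> are composed with this
  projection, so that they are functions on the whole space, as \<open>itint\<close> and
  \<open>coercive_convex\<close> expect.\<close>

definition proj_perp :: "'a::euclidean_space \<Rightarrow> 'a \<Rightarrow> 'a" where
  "proj_perp e y = y - (y \<bullet> e) *\<^sub>R e"

text \<open>With the direction as an argument, the lower half is \<open>halfpolar (- e)\<close>, and
  one statement can cover both halves.\<close>

abbreviation halfpolar :: "'a::euclidean_space \<Rightarrow> 'a set \<Rightarrow> 'a \<Rightarrow> ennreal" where
  "halfpolar e \<equiv> polar_integral {y. y \<bullet> e > 0}"

lemma span_perp:
  assumes "e \<in> Basis" "v \<in> span (Basis - {e})" shows "v \<bullet> e = 0"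
proof -
  have "Basis - {e} \<subseteq> {x. x \<bullet> e = 0}" using assms(1) by (auto simp: inner_Basis)
  then have "span (Basis - {e}) \<subseteq> {x. x \<bullet> e = 0}" by (rule span_minimal) (simp add: subspace_hyperplane2)
  then show ?thesis using assms(2) by auto
qed

lemma proj_perp_in_span:
  assumes "e \<in> Basis" shows "proj_perp e y \<in> span (Basis - {e})"
proof -
  have "(\<Sum>b\<in>Basis. (y \<bullet> b) *\<^sub>R b) = (y \<bullet> e) *\<^sub>R e + (\<Sum>b\<in>Basis - {e}. (y \<bullet> b) *\<^sub>R b)"
    using assms by (intro sum.remove) auto
  then have "proj_perp e y = (\<Sum>b\<in>Basis - {e}. (y \<bullet> b) *\<^sub>R b)"
    unfolding proj_perp_def euclidean_representation by (simp add: algebra_simps)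
  then show ?thesis by (simp only:) (rule span_sum, rule span_scale, rule span_base)
qed

lemma proj_perp_span: "e \<in> Basis \<Longrightarrow> v \<in> span (Basis - {e}) \<Longrightarrow> proj_perp e v = v"
  unfolding proj_perp_def by (simp add: span_perp)

lemma proj_perp_linear: "linear (proj_perp e)"
  unfolding proj_perp_def by (rule linearI) (simp_all add: inner_add_left algebra_simps)

section \<open>Halves of the polar integral and their charts\<close>

context convex_body begin

lemma chart_coercive_convex:
  assumes e: "e \<in> Basis" and s: "\<bar>s\<bar> = 1" and z: "z \<in> interior K"
  shows "coercive_convex (Basis - {e}) (\<lambda>W. g z (proj_perp e W + s *\<^sub>R e))"
  unfolding coercive_convex_def
proof
  show "convex_on UNIV (\<lambda>W. g z (proj_perp e W + s *\<^sub>R e))"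
  proof (rule convex_onI)
    fix t :: real and x y :: 'a assume t: "0 < t" "t < 1"
    have "proj_perp e ((1 - t) *\<^sub>R x + t *\<^sub>R y) + s *\<^sub>R e
      = (1 - t) *\<^sub>R (proj_perp e x + s *\<^sub>R e) + t *\<^sub>R (proj_perp e y + s *\<^sub>R e)"
      by (simp only: linear_add[OF proj_perp_linear] linear_scale[OF proj_perp_linear]) (simp add: algebra_simps)
    then show "g z (proj_perp e ((1 - t) *\<^sub>R x + t *\<^sub>R y) + s *\<^sub>R e)
      \<le> (1 - t) * g z (proj_perp e x + s *\<^sub>R e) + t * g z (proj_perp e y + s *\<^sub>R e)"
      using convex_onD[OF support_convex, of t "proj_perp e x + s *\<^sub>R e" "proj_perp e y + s *\<^sub>R e" z] t by simp
  qed auto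
  obtain \<rho> where \<rho>: "\<rho> > 0" "\<And>y. \<rho> * norm y \<le> g z y" using support_lower_norm[OF z] by blast
  show "\<exists>\<delta>>0. \<forall>y. \<delta> * (1 + (\<Sum>b\<in>Basis - {e}. \<bar>y \<bullet> b\<bar>)) \<le> g z (proj_perp e y + s *\<^sub>R e)"
  proof (intro exI conjI allI)
    \<comment> \<open>The norm dominates the sum of absolute coordinates divided by the dimension;
      the coordinate along \<open>e\<close> equals \<open>s\<close> and supplies the summand
      \<open>1\<close>.\<close>
    show "\<rho> / DIM('a) > 0" using \<rho>(1) by simp
    fix y :: 'a
    let ?v = "proj_perp e y + s *\<^sub>R e"
    have ve: "?v \<bullet> e = s" using e unfolding proj_perp_def by (simp add: inner_diff_left inner_add_left)
    have vb: "?v \<bullet> b = y \<bullet> b" if "b \<in> Basis - {e}" for b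
      using that e unfolding proj_perp_def by (auto simp: inner_diff_left inner_add_left inner_Basis)
    have "(\<Sum>b\<in>Basis. \<bar>?v \<bullet> b\<bar>) = \<bar>?v \<bullet> e\<bar> + (\<Sum>b\<in>Basis - {e}. \<bar>?v \<bullet> b\<bar>)"
      using e by (intro sum.remove) auto
    also have "\<dots> = 1 + (\<Sum>b\<in>Basis - {e}. \<bar>y \<bullet> b\<bar>)"
      unfolding ve s by (intro arg_cong[where f="(+) 1"] sum.cong refl) (simp add: vb)
    finally have eq: "1 + (\<Sum>b\<in>Basis - {e}. \<bar>y \<bullet> b\<bar>) = (\<Sum>b\<in>Basis. \<bar>?v \<bullet> b\<bar>)" ..
    have "(\<Sum>b\<in>Basis. \<bar>?v \<bullet> b\<bar>) \<le> (\<Sum>b\<in>(Basis :: 'a set). norm ?v)"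
      by (intro sum_mono Basis_le_norm)
    then have "\<rho> / DIM('a) * (\<Sum>b\<in>Basis. \<bar>?v \<bullet> b\<bar>) \<le> \<rho> / DIM('a) * (DIM('a) * norm ?v)"
      using \<rho>(1) by (intro mult_left_mono) auto
    also have "\<dots> = \<rho> * norm ?v" by simp
    also have "\<dots> \<le> g z ?v" by (rule \<rho>(2))
    finally show "\<rho> / DIM('a) * (1 + (\<Sum>b\<in>Basis - {e}. \<bar>y \<bullet> b\<bar>)) \<le> g z ?v" unfolding eq .
  qed
qed

lemma support_pos:
  assumes "z \<in> interior K" "y \<noteq> 0" shows "g z y > 0"
proof -
  obtain \<rho> where \<rho>: "\<rho> > 0" "\<And>y. \<rho> * norm y \<le> g z y" using support_lower_norm[OF assms(1)] by blast
  have "0 < \<rho> * norm y" using \<rho>(1) assms(2) by simp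
  with \<rho>(2)[of y] show ?thesis by simp
qed

lemma halfpolar_eq:
  assumes e: "e \<in> Basis" and s: "\<bar>s\<bar> = 1" and z: "z \<in> interior K"
  shows "halfpolar (s *\<^sub>R e) K z
    = ennreal (fact (DIM('a) - 1)) * itint (Basis - {e}) (\<lambda>y. ennreal (1 / g z y ^ DIM('a))) (s *\<^sub>R e)"
proof -
  have "s *\<^sub>R e + v \<noteq> 0" if "v \<in> span (Basis - {e})" for v
  proof
    assume "s *\<^sub>R e + v = 0"
    then have "(s *\<^sub>R e + v) \<bullet> e = 0" by simp
    then show False using span_perp[OF e that] e s by (simp add: inner_add_left)
  qed
  then show ?thesis
    unfolding polar_integral_def
    using exp_integral_halfspace[OF support_measurable support_homogeneous e s, of z] support_pos[OF z] by simp
qed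

lemma card_perp: "e \<in> Basis \<Longrightarrow> Suc (card (Basis - {e} :: 'a set)) = DIM('a)"
  using DIM_positive[where 'a='a] by (simp add: card_Diff_singleton)

lemma halfpolar_chart:
  assumes e: "e \<in> Basis" and s: "\<bar>s\<bar> = 1" and z: "z \<in> interior K"
  shows "halfpolar (s *\<^sub>R e) K z = ennreal (fact (DIM('a) - 1)) *
    itint (Basis - {e}) (\<lambda>W. ennreal (1 / g z (proj_perp e W + s *\<^sub>R e) ^ Suc (card (Basis - {e})))) 0"
proof -
  have "itint (Basis - {e}) (\<lambda>y. ennreal (1 / g z y ^ DIM('a))) (s *\<^sub>R e)
      = itint (Basis - {e}) (\<lambda>W. ennreal (1 / g z (s *\<^sub>R e + W) ^ DIM('a))) 0"
    unfolding itint_def by simp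
  also have "\<dots> = itint (Basis - {e}) (\<lambda>W. ennreal (1 / g z (proj_perp e W + s *\<^sub>R e) ^ DIM('a))) 0"
    by (rule itint_cong) (simp_all add: proj_perp_span[OF e] add.commute)
  finally show ?thesis unfolding halfpolar_eq[OF assms] card_perp[OF e] by simp
qed

lemma halfpolar_add:
  assumes e: "e \<in> Basis"
  shows "polar_integral UNIV K z = halfpolar e K z + halfpolar (- e) K z"
proof -
  have "polar_integral UNIV K z = (\<integral>\<^sup>+y. ennreal (exp (- g z y)) * indicator {y. y \<bullet> e > 0} y
      + ennreal (exp (- g z y)) * indicator {y. y \<bullet> (- e) > 0} y \<partial>lborel)"
    unfolding polar_integral_def
    by (rule nn_integral_cong_AE, rule AE_mp[OF AE_lborel_inner_neq[OF e, of 0]], rule AE_I2)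
      (auto simp: indicator_def)
  also have "\<dots> = halfpolar e K z + halfpolar (- e) K z"
    unfolding polar_integral_def by (rule nn_integral_add) auto
  finally show ?thesis .
qed

text \<open>Moving the base point by \<open>t *\<^sub>R e\<close> multiplies the integrand by
  \<open>exp (t * (y \<bullet> e))\<close>, which is at least \<open>1\<close> on this half. The
  opposite half shrinks, so the ratio of the halves is monotone in \<open>t\<close>.\<close>

lemma halfpolar_mono:
  assumes "t \<ge> 0"
  shows "halfpolar e K z \<le> halfpolar e K (z + t *\<^sub>R e)"
  unfolding polar_integral_def
proof (rule nn_integral_mono)
  fix y
  show "ennreal (exp (- g z y)) * indicator {y. 0 < y \<bullet> e} y \<le> ennreal (exp (- g (z + t *\<^sub>R e) y)) * indicator {y. 0 < y \<bullet> e} y"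
    using assms unfolding support_shift by (auto simp: indicator_def intro!: ennreal_leI)
qed

lemma halfpolar_pos:
  assumes e: "e \<noteq> 0"
  shows "halfpolar e K z > 0"
proof -
  have "halfpolar e K z \<noteq> 0"
  proof
    assume "halfpolar e K z = 0"
    then have "AE y in lborel. ennreal (exp (- g z y)) * indicator {y. y \<bullet> e > 0} y = 0"
      unfolding polar_integral_def by (subst (asm) nn_integral_0_iff_AE) auto
    then have "AE y in lborel. y \<in> {y. y \<bullet> e \<le> 0}"
      by (rule AE_mp) (intro AE_I2, auto simp: indicator_def split: if_splits)
    then have "AE y in lebesgue. y \<in> {y. y \<bullet> e \<le> 0}"
      by (subst AE_completion_iff) auto
    moreover have "closed {y. y \<bullet> e \<le> 0}" by (intro closed_Collect_le continuous_intros)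
    ultimately have "e \<in> {y. y \<bullet> e \<le> 0}" by (rule mem_closed_if_AE_lebesgue[rotated])
    then have "e \<bullet> e \<le> 0" by simp
    then show False using inner_gt_zero_iff[of e] e by linarith
  qed
  then show ?thesis by (simp add: zero_less_iff_neq_zero)
qed

text \<open>Convexity of the exponential, as in the uniqueness proof. It serves to make the halves
  continuous in the base point, for the intermediate value argument.\<close>

lemma polar_integral_convex:
  assumes [measurable]: "A \<in> sets borel" and I: "I \<subseteq> {t. z + t *\<^sub>R v \<in> interior K}" "convex I"
  shows "convex_on I (\<lambda>t. enn2real (polar_integral A K (z + t *\<^sub>R v)))"
proof (rule convex_onI)
  fix u t t' :: real assume u: "0 < u" "u < 1" and t: "t \<in> I" "t' \<in> I"
  let ?w = "z + ((1 - u) *\<^sub>R t + u *\<^sub>R t') *\<^sub>R v"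
  have wI: "(1 - u) *\<^sub>R t + u *\<^sub>R t' \<in> I" using convexD[OF I(2) t, of "1 - u" u] u by simp
  have fin: "polar_integral A K (z + r *\<^sub>R v) < \<infinity>" if "r \<in> I" for r using I(1) that by (intro polar_integral_finite) auto
  have "polar_integral A K ?w \<le> (\<integral>\<^sup>+y. ennreal (1 - u) * (ennreal (exp (- g (z + t *\<^sub>R v) y)) * indicator A y)
      + ennreal u * (ennreal (exp (- g (z + t' *\<^sub>R v) y)) * indicator A y) \<partial>lborel)"
    unfolding polar_integral_def
  proof (rule nn_integral_mono)
    fix y
    have eq: "- g ?w y = (1 - u) *\<^sub>R (- g (z + t *\<^sub>R v) y) + u *\<^sub>R (- g (z + t' *\<^sub>R v) y)"
      unfolding support_shift by (simp add: algebra_simps)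
    have "exp (- g ?w y) \<le> (1 - u) * exp (- g (z + t *\<^sub>R v) y) + u * exp (- g (z + t' *\<^sub>R v) y)"
      unfolding eq by (rule convex_onD[OF exp_convex]) (use u in auto)
    then have "ennreal (exp (- g ?w y)) \<le> ennreal ((1 - u) * exp (- g (z + t *\<^sub>R v) y) + u * exp (- g (z + t' *\<^sub>R v) y))"
      by (rule ennreal_leI)
    also have "\<dots> = ennreal (1 - u) * ennreal (exp (- g (z + t *\<^sub>R v) y)) + ennreal u * ennreal (exp (- g (z + t' *\<^sub>R v) y))"
      using u by (simp add: ennreal_mult)
    finally show "ennreal (exp (- g ?w y)) * indicator A y \<le> ennreal (1 - u) * (ennreal (exp (- g (z + t *\<^sub>R v) y)) * indicator A y)
      + ennreal u * (ennreal (exp (- g (z + t' *\<^sub>R v) y)) * indicator A y)"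
      by (cases "y \<in> A") auto
  qed
  also have "\<dots> = ennreal (1 - u) * polar_integral A K (z + t *\<^sub>R v) + ennreal u * polar_integral A K (z + t' *\<^sub>R v)"
    unfolding polar_integral_def by (subst nn_integral_add) (auto simp: nn_integral_cmult)
  finally have le: "polar_integral A K ?w \<le> \<dots>" .
  have "ennreal (enn2real (polar_integral A K ?w)) \<le> ennreal ((1 - u) * enn2real (polar_integral A K (z + t *\<^sub>R v)) + u * enn2real (polar_integral A K (z + t' *\<^sub>R v)))"
    using le fin[OF t(1)] fin[OF t(2)] fin[OF wI] u by (simp add: ennreal_mult ennreal_plus)
  then show "enn2real (polar_integral A K ?w) \<le> (1 - u) * enn2real (polar_integral A K (z + t *\<^sub>R v)) + u * enn2real (polar_integral A K (z + t' *\<^sub>R v))"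
    using u by (subst (asm) ennreal_le_iff) auto
qed (rule I(2))

lemma polar_integral_continuous:
  assumes "A \<in> sets borel" "I \<subseteq> {t. z + t *\<^sub>R v \<in> interior K}" "convex I" "open I"
  shows "continuous_on I (\<lambda>t. enn2real (polar_integral A K (z + t *\<^sub>R v)))"
  by (rule convex_on_continuous[OF assms(4) polar_integral_convex[OF assms(1-3)]])

end

text \<open>At the exit point the total is infinite, but the opposite half is no larger than it was
  at \<open>p\<close>. So the half in direction \<open>e\<close> is infinite there, and lower
  semicontinuity makes it large along the approach.\<close>

lemma (in convex_body) halfpolar_blowup:
  assumes e: "e \<in> Basis \<or> - e \<in> Basis" and p: "p \<in> interior K"
    and \<beta>: "\<beta> \<ge> 0" "p + \<beta> *\<^sub>R e \<notin> interior K" and T: "T \<longlonglongrightarrow> \<beta>" "\<And>n. p + T n *\<^sub>R e \<in> interior K"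
  shows "\<exists>n. enn2real (halfpolar e K (p + T n *\<^sub>R e)) > M"
proof (rule ccontr)
  assume "\<not> ?thesis"
  then have le: "enn2real (halfpolar e K (p + T n *\<^sub>R e)) \<le> M" for n by (auto simp: not_less)
  have split: "polar_integral UNIV K z = halfpolar e K z + halfpolar (- e) K z" for z
    using e halfpolar_add[of e z] halfpolar_add[of "- e" z] by (auto simp: add.commute)
  have "halfpolar (- e) K (p + \<beta> *\<^sub>R e) \<le> halfpolar (- e) K (p + \<beta> *\<^sub>R e + \<beta> *\<^sub>R (- e))"
    by (rule halfpolar_mono[OF \<beta>(1)])
  also have "\<dots> = halfpolar (- e) K p" by simp
  also have "\<dots> < \<infinity>" by (rule polar_integral_finite[OF p])
  finally have "halfpolar (- e) K (p + \<beta> *\<^sub>R e) < top" by simp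
  moreover have "halfpolar e K (p + \<beta> *\<^sub>R e) + halfpolar (- e) K (p + \<beta> *\<^sub>R e) = top"
    using polar_integral_infinite[OF \<beta>(2)] unfolding split by simp
  ultimately have "halfpolar e K (p + \<beta> *\<^sub>R e) = top" by (auto simp: ennreal_add_eq_top)
  moreover have "(\<lambda>n. p + T n *\<^sub>R e) \<longlonglongrightarrow> p + \<beta> *\<^sub>R e" by (intro tendsto_intros T)
  then have "halfpolar e K (p + \<beta> *\<^sub>R e) \<le> liminf (\<lambda>n. halfpolar e K (p + T n *\<^sub>R e))"
    by (rule polar_integral_Fatou[rotated]) simp
  moreover have "liminf (\<lambda>n. halfpolar e K (p + T n *\<^sub>R e)) \<le> liminf (\<lambda>n::nat. ennreal M)"
  proof (intro Liminf_mono always_eventually allI)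
    fix n
    have "halfpolar e K (p + T n *\<^sub>R e) = ennreal (enn2real (halfpolar e K (p + T n *\<^sub>R e)))"
      using polar_integral_finite[OF T(2)] by simp
    also have "\<dots> \<le> ennreal M" by (rule ennreal_leI[OF le])
    finally show "halfpolar e K (p + T n *\<^sub>R e) \<le> ennreal M" .
  qed
  ultimately show False by (simp add: Liminf_const top_unique)
qed

section \<open>Base points with equal ratios of the halves\<close>

lemma halfpolar_real_mono:
  assumes "convex_body K" "z \<in> interior K" "z + t *\<^sub>R e \<in> interior K" "t \<ge> 0"
  shows "enn2real (halfpolar e K z) \<le> enn2real (halfpolar e K (z + t *\<^sub>R e))"
proof -
  interpret convex_body K by fact
  show ?thesis
    using halfpolar_mono[OF assms(4)] polar_integral_finite[OF assms(3)] by (intro enn2real_mono) auto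
qed

lemma halfpolar_real_pos:
  assumes "convex_body K" "z \<in> interior K" "e \<noteq> 0"
  shows "enn2real (halfpolar e K z) > 0"
proof -
  interpret convex_body K by fact
  show ?thesis
    using halfpolar_pos[OF assms(3)] polar_integral_finite[OF assms(2)] by (auto simp: enn2real_positive_iff)
qed

text \<open>When the base point of \<open>K0\<close> approaches the boundary in direction
  \<open>e\<close>, one of the four halves blows up. The other three are controlled by their initial
  values through monotonicity, each in the favourable direction.\<close>

lemma halfpolar_ratio_blowup:
  assumes cb: "convex_body K0" "convex_body K1" and e: "e \<in> Basis \<or> - e \<in> Basis"
    and p: "p0 \<in> interior K0" "p1 \<in> interior K1"
    and T: "T \<longlonglongrightarrow> \<beta>" "\<And>n. T n \<ge> (0::real)" "\<And>n. p0 + T n *\<^sub>R e \<in> interior K0" "\<And>n. p1 - T n *\<^sub>R e \<in> interior K1"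
    and \<beta>: "p0 + \<beta> *\<^sub>R e \<notin> interior K0"
  shows "\<exists>n. enn2real (halfpolar (- e) K0 (p0 + T n *\<^sub>R e)) * enn2real (halfpolar e K1 (p1 - T n *\<^sub>R e))
    \<le> enn2real (halfpolar e K0 (p0 + T n *\<^sub>R e)) * enn2real (halfpolar (- e) K1 (p1 - T n *\<^sub>R e))"
proof -
  have e0: "e \<noteq> 0" using e nonzero_Basis by fastforce
  \<comment> \<open>Chosen so that \<open>M\<close> times the initial lower half of
    \<open>K1\<close> equals the initial value of the left product.\<close>
  define M where "M = enn2real (halfpolar (- e) K0 p0) * enn2real (halfpolar e K1 p1) / enn2real (halfpolar (- e) K1 p1)"
  have q: "enn2real (halfpolar (- e) K1 p1) > 0" 
    using e0 by (intro halfpolar_real_pos[OF cb(2) p(2)]) simp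
  have \<beta>0: "\<beta> \<ge> 0" using LIMSEQ_le_const[OF T(1), of 0] T(2) by auto
  obtain n where n: "M < enn2real (halfpolar e K0 (p0 + T n *\<^sub>R e))"
    using convex_body.halfpolar_blowup[OF cb(1) e p(1) \<beta>0 \<beta> T(1) T(3)] by blast
  have "enn2real (halfpolar (- e) K0 (p0 + T n *\<^sub>R e)) \<le> enn2real (halfpolar (- e) K0 (p0 + T n *\<^sub>R e + T n *\<^sub>R (- e)))"
    using p T by (intro halfpolar_real_mono[OF cb(1)]) auto
  then have 1: "enn2real (halfpolar (- e) K0 (p0 + T n *\<^sub>R e)) \<le> enn2real (halfpolar (- e) K0 p0)" by simp
  have "enn2real (halfpolar e K1 (p1 - T n *\<^sub>R e)) \<le> enn2real (halfpolar e K1 (p1 - T n *\<^sub>R e + T n *\<^sub>R e))"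
    using p T by (intro halfpolar_real_mono[OF cb(2)]) auto
  then have 2: "enn2real (halfpolar e K1 (p1 - T n *\<^sub>R e)) \<le> enn2real (halfpolar e K1 p1)" by simp
  have "enn2real (halfpolar (- e) K1 p1) \<le> enn2real (halfpolar (- e) K1 (p1 + T n *\<^sub>R (- e)))"
    using p T by (intro halfpolar_real_mono[OF cb(2)]) auto
  then have 3: "enn2real (halfpolar (- e) K1 p1) \<le> enn2real (halfpolar (- e) K1 (p1 - T n *\<^sub>R e))" by simp
  have "enn2real (halfpolar (- e) K0 (p0 + T n *\<^sub>R e)) * enn2real (halfpolar e K1 (p1 - T n *\<^sub>R e))
      \<le> enn2real (halfpolar (- e) K0 p0) * enn2real (halfpolar e K1 p1)"
    using 1 2 by (intro mult_mono) auto
  also have "\<dots> = M * enn2real (halfpolar (- e) K1 p1)" unfolding M_def using q by simp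
  also have "\<dots> \<le> enn2real (halfpolar e K0 (p0 + T n *\<^sub>R e)) * enn2real (halfpolar (- e) K1 (p1 - T n *\<^sub>R e))"
    using n 3 by (intro mult_mono) auto
  finally show ?thesis by blast
qed

text \<open>The base points travel in opposite directions, so their midpoint stays fixed; later it
  is the Santalo point of the middle body. The journey ends when one of them leaves its body, and
  whichever does, the inequality holds at some moment before.\<close>

lemma halfpolar_ratio_nonneg:
  assumes cb: "convex_body K0" "convex_body K1" and e: "e \<in> Basis \<or> - e \<in> Basis"
    and p: "p0 \<in> interior K0" "p1 \<in> interior K1"
  shows "\<exists>t\<ge>0. p0 + t *\<^sub>R e \<in> interior K0 \<and> p1 - t *\<^sub>R e \<in> interior K1 \<and>
    enn2real (halfpolar (- e) K0 (p0 + t *\<^sub>R e)) * enn2real (halfpolar e K1 (p1 - t *\<^sub>R e))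
    \<le> enn2real (halfpolar e K0 (p0 + t *\<^sub>R e)) * enn2real (halfpolar (- e) K1 (p1 - t *\<^sub>R e))"
proof -
  define S where "S = {t. p0 + t *\<^sub>R e \<in> interior K0 \<and> p1 - t *\<^sub>R e \<in> interior K1}"
  have ne: "norm e = 1" using e norm_Basis[of e] norm_Basis[of "- e"] norm_minus_cancel[of e] by metis
  have S: "S = (\<lambda>t. p0 + t *\<^sub>R e) -` interior K0 \<inter> (\<lambda>t. p1 - t *\<^sub>R e) -` interior K1"
    unfolding S_def by auto
  have opS: "open S"
    unfolding S by (intro open_Int open_vimage open_interior continuous_intros)
  have cv: "t \<in> S" if "0 \<le> t" "t \<le> t'" "t' \<in> S" for t t'
  proof (cases "t' = 0")
    case True then show ?thesis using that by auto
  next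
    case False
    have u: "0 \<le> t / t'" "t / t' \<le> 1" using that False by auto
    have "(1 - t / t') *\<^sub>R p0 + (t / t') *\<^sub>R (p0 + t' *\<^sub>R e) \<in> interior K0"
      using that p u cb(1)[unfolded convex_body_def] unfolding S_def
      by (intro convexD[OF convex_interior]) auto
    moreover have "(1 - t / t') *\<^sub>R p0 + (t / t') *\<^sub>R (p0 + t' *\<^sub>R e) = p0 + t *\<^sub>R e"
      using False by (simp add: algebra_simps)
    moreover have "(1 - t / t') *\<^sub>R p1 + (t / t') *\<^sub>R (p1 - t' *\<^sub>R e) \<in> interior K1"
      using that p u cb(2)[unfolded convex_body_def] unfolding S_def
      by (intro convexD[OF convex_interior]) auto
    moreover have "(1 - t / t') *\<^sub>R p1 + (t / t') *\<^sub>R (p1 - t' *\<^sub>R e) = p1 - t *\<^sub>R e"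
      using False by (simp add: algebra_simps)
    ultimately show ?thesis unfolding S_def by simp
  qed
  have S0: "0 \<in> S" unfolding S_def using p by simp
  obtain R where R: "\<And>x. x \<in> K0 \<Longrightarrow> norm x \<le> R"
    using compact_imp_bounded[of K0] cb(1) unfolding convex_body_def bounded_iff by auto
  have bS: "t \<le> R + norm p0" if "t \<in> S" for t
  proof -
    have "p0 + t *\<^sub>R e \<in> K0" using that interior_subset unfolding S_def by blast
    then have "norm (p0 + t *\<^sub>R e) \<le> R" by (rule R)
    moreover have "norm (t *\<^sub>R e) \<le> norm (p0 + t *\<^sub>R e) + norm p0"
      using norm_triangle_ineq4[of "p0 + t *\<^sub>R e" p0] by simp
    ultimately show ?thesis using ne by simp
  qed
  have bdd: "bdd_above S" using bS by (rule bdd_aboveI)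
  define \<beta> where "\<beta> = Sup S"
  have Sle: "t \<le> \<beta>" if "t \<in> S" for t unfolding \<beta>_def by (rule cSup_upper[OF that bdd])
  have nS: "\<beta> \<notin> S"
  proof
    assume "\<beta> \<in> S"
    then obtain \<epsilon> where "\<epsilon> > 0" "ball \<beta> \<epsilon> \<subseteq> S" using opS open_contains_ball by blast
    then have "\<beta> + \<epsilon> / 2 \<in> S" by (intro subsetD[of "ball \<beta> \<epsilon>" S]) (auto simp: dist_real_def)
    from Sle[OF this] show False using \<open>\<epsilon> > 0\<close> by simp
  qed
  have \<beta>0: "\<beta> > 0" using Sle[OF S0] nS S0 by (cases "\<beta> = 0") auto
  \<comment> \<open>Parameters in \<open>S\<close> that approach the exit time
    \<open>\<beta>\<close> from below.\<close>
  define T where "T = (\<lambda>n::nat. \<beta> * (1 - 1 / real (Suc n)))"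
  have T: "T \<longlonglongrightarrow> \<beta>"
  proof -
    have "(\<lambda>n. \<beta> * (1 - 1 / real (Suc n))) \<longlonglongrightarrow> \<beta> * (1 - 0)"
      by (intro tendsto_intros LIMSEQ_Suc[OF lim_1_over_n])
    then show ?thesis unfolding T_def by simp
  qed
  have T0: "T n \<ge> 0" for n unfolding T_def using \<beta>0 by simp
  have TS: "T n \<in> S" for n
  proof -
    have "T n < \<beta>" unfolding T_def using \<beta>0 by (simp add: field_simps)
    then obtain t where "t \<in> S" "T n < t" unfolding \<beta>_def using less_cSup_iff[of S "T n"] S0 bdd by blast
    then show ?thesis using cv[of "T n" t] T0 by simp
  qed
  have TK: "p0 + T n *\<^sub>R e \<in> interior K0" "p1 - T n *\<^sub>R e \<in> interior K1" for n
    using TS[of n] unfolding S_def by auto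
  consider "p0 + \<beta> *\<^sub>R e \<notin> interior K0" | "p1 + \<beta> *\<^sub>R (- e) \<notin> interior K1"
    using nS unfolding S_def by auto
  then show ?thesis
  proof cases
    case 1
    obtain n where "enn2real (halfpolar (- e) K0 (p0 + T n *\<^sub>R e)) * enn2real (halfpolar e K1 (p1 - T n *\<^sub>R e))
        \<le> enn2real (halfpolar e K0 (p0 + T n *\<^sub>R e)) * enn2real (halfpolar (- e) K1 (p1 - T n *\<^sub>R e))"
      using halfpolar_ratio_blowup[OF cb e p T T0 TK 1] by blast
    then show ?thesis using T0[of n] TK[of n] by blast
  next
    case 2
    \<comment> \<open>The same argument with the bodies exchanged and \<open>e\<close> reversed: the
      base point of \<open>K1\<close> travels along \<open>- e\<close>.\<close>
    have e': "- e \<in> Basis \<or> - (- e) \<in> Basis" using e by auto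
    have TK': "p1 + T n *\<^sub>R (- e) \<in> interior K1" "p0 - T n *\<^sub>R (- e) \<in> interior K0" for n using TK[of n] by auto
    obtain n where "enn2real (halfpolar (- (- e)) K1 (p1 + T n *\<^sub>R (- e))) * enn2real (halfpolar (- e) K0 (p0 - T n *\<^sub>R (- e)))
        \<le> enn2real (halfpolar (- e) K1 (p1 + T n *\<^sub>R (- e))) * enn2real (halfpolar (- (- e)) K0 (p0 - T n *\<^sub>R (- e)))"
      using halfpolar_ratio_blowup[OF cb(2) cb(1) e' p(2) p(1) T T0 TK' 2] by blast
    then have "enn2real (halfpolar (- e) K0 (p0 + T n *\<^sub>R e)) * enn2real (halfpolar e K1 (p1 - T n *\<^sub>R e))
        \<le> enn2real (halfpolar e K0 (p0 + T n *\<^sub>R e)) * enn2real (halfpolar (- e) K1 (p1 - T n *\<^sub>R e))"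
      by (simp add: mult.commute)
    then show ?thesis using T0[of n] TK[of n] by blast
  qed
qed

text \<open>
  Harmonic means of the upper and of the lower halves add up to the harmonic mean of the totals
  only if both pairs of halves have the same ratio.
\<close>

lemma halfpolar_ratio_balanced:
  assumes cb: "convex_body K0" "convex_body K1" and e: "e \<in> Basis"
    and p: "p0 \<in> interior K0" "p1 \<in> interior K1"
  obtains t where "p0 + t *\<^sub>R e \<in> interior K0" "p1 - t *\<^sub>R e \<in> interior K1"
    "enn2real (halfpolar e K0 (p0 + t *\<^sub>R e)) * enn2real (halfpolar (- e) K1 (p1 - t *\<^sub>R e))
    = enn2real (halfpolar (- e) K0 (p0 + t *\<^sub>R e)) * enn2real (halfpolar e K1 (p1 - t *\<^sub>R e))"
proof -
  define S where "S = {t. p0 + t *\<^sub>R e \<in> interior K0 \<and> p1 - t *\<^sub>R e \<in> interior K1}"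
  \<comment> \<open>Equality of the two ratios in cross-multiplied form. Its sign at a negative
    parameter comes from \<open>halfpolar_ratio_nonneg\<close> for \<open>- e\<close>, which
    exchanges the halves.\<close>
  define Q where "Q = (\<lambda>t. enn2real (halfpolar e K0 (p0 + t *\<^sub>R e)) * enn2real (halfpolar (- e) K1 (p1 + t *\<^sub>R (- e)))
    - enn2real (halfpolar (- e) K0 (p0 + t *\<^sub>R e)) * enn2real (halfpolar e K1 (p1 + t *\<^sub>R (- e))))"
  obtain t where t: "t \<ge> 0" "t \<in> S" "Q t \<ge> 0"
    using halfpolar_ratio_nonneg[OF cb, of e p0 p1] e p unfolding S_def Q_def by auto
  obtain t' where t': "t' \<ge> 0" "- t' \<in> S" "Q (- t') \<le> 0"
    using halfpolar_ratio_nonneg[OF cb, of "- e" p0 p1] e p unfolding S_def Q_def by auto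
  have S: "S = (\<lambda>t. p0 + t *\<^sub>R e) -` interior K0 \<inter> (\<lambda>t. p1 - t *\<^sub>R e) -` interior K1"
    unfolding S_def by auto
  have opS: "open S"
    unfolding S by (intro open_Int open_vimage open_interior continuous_intros)
  have cS: "convex S"
  proof (rule convexI)
    fix x y u v :: real assume x: "x \<in> S" "y \<in> S" and u: "0 \<le> u" "0 \<le> v" "u + v = 1"
    have "u *\<^sub>R (p0 + x *\<^sub>R e) + v *\<^sub>R (p0 + y *\<^sub>R e) \<in> interior K0"
      using x u cb(1)[unfolded convex_body_def] unfolding S_def by (intro convexD[OF convex_interior]) auto
    moreover have "u *\<^sub>R (p0 + x *\<^sub>R e) + v *\<^sub>R (p0 + y *\<^sub>R e) = (u + v) *\<^sub>R p0 + (u * x + v * y) *\<^sub>R e"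
      by (simp add: algebra_simps)
    moreover have "u *\<^sub>R (p1 - x *\<^sub>R e) + v *\<^sub>R (p1 - y *\<^sub>R e) \<in> interior K1"
      using x u cb(2)[unfolded convex_body_def] unfolding S_def by (intro convexD[OF convex_interior]) auto
    moreover have "u *\<^sub>R (p1 - x *\<^sub>R e) + v *\<^sub>R (p1 - y *\<^sub>R e) = (u + v) *\<^sub>R p1 - (u * x + v * y) *\<^sub>R e"
      by (simp add: algebra_simps)
    ultimately show "u *\<^sub>R x + v *\<^sub>R y \<in> S" unfolding S_def u(3) by simp
  qed
  have S0: "S \<subseteq> {t. p0 + t *\<^sub>R e \<in> interior K0}" and S1: "S \<subseteq> {t. p1 + t *\<^sub>R (- e) \<in> interior K1}"
    unfolding S_def by auto
  have contQ: "continuous_on S Q"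
    unfolding Q_def
    by (intro continuous_on_diff continuous_on_mult convex_body.polar_integral_continuous[OF cb(1) _ S0 cS opS]
      convex_body.polar_integral_continuous[OF cb(2) _ S1 cS opS]) auto
  have "{- t'..t} \<subseteq> S" using t(2) t'(2) cS by (metis closed_segment_eq_real_ivl closed_segment_subset t(1) t'(1) neg_le_0_iff_le order_trans)
  then have "continuous_on {- t'..t} Q" using contQ continuous_on_subset by blast
  then obtain x where x: "- t' \<le> x" "x \<le> t" "Q x = 0"
    using IVT'[of Q "- t'" 0 t] t t' by auto
  then have "x \<in> S" using \<open>{- t'..t} \<subseteq> S\<close> by auto
  then show thesis using that[of x] x(3) unfolding S_def Q_def by auto
qed

text \<open>This is what remains of a shadow system at the two ends and the midpoint of an interval.\<close>

definition coupled :: "'a::euclidean_space \<Rightarrow> 'a set \<Rightarrow> 'a set \<Rightarrow> 'a set \<Rightarrow> bool" where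
  "coupled e K0 K1 Km \<longleftrightarrow> (\<forall>q\<in>Km. \<exists>q0\<in>K0. \<exists>\<tau>. q0 + \<tau> *\<^sub>R e \<in> K1 \<and> q = q0 + (\<tau> / 2) *\<^sub>R e)"

text \<open>Since both vectors have the fixed component \<open>s\<close> along \<open>e\<close>, a
  displacement along \<open>e\<close> contributes \<open>s\<close> times its length, whatever
  \<open>U\<close> and \<open>V\<close> are. So the pairing with the midpoint is exactly the average
  of the two end pairings.\<close>

lemma coupled_support_le:
  assumes cb: "convex_body K0" "convex_body K1" "convex_body Km" and e: "e \<in> Basis"
    and coupled: "coupled e K0 K1 Km"
  shows "shifted_support Km (z + (\<tau> / 2) *\<^sub>R e) (proj_perp e ((1/2) *\<^sub>R (U + V)) + s *\<^sub>R e)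
    \<le> (shifted_support K0 z (proj_perp e U + s *\<^sub>R e) + shifted_support K1 (z + \<tau> *\<^sub>R e) (proj_perp e V + s *\<^sub>R e)) / 2"
proof (rule convex_body.support_least[OF cb(3)])
  fix q assume "q \<in> Km"
  then obtain q0 \<kappa> where q: "q0 \<in> K0" "q0 + \<kappa> *\<^sub>R e \<in> K1" "q = q0 + (\<kappa> / 2) *\<^sub>R e"
    using coupled unfolding coupled_def by blast
  have ee: "e \<bullet> e = 1" using e by simp
  have pe: "proj_perp e x \<bullet> e = 0" for x unfolding proj_perp_def using ee by (simp add: inner_diff_left)
  have 0: "proj_perp e ((1/2) *\<^sub>R (U + V)) = (1/2) *\<^sub>R (proj_perp e U + proj_perp e V)"
    unfolding proj_perp_def by (simp add: inner_add_left algebra_simps)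
  have d: "q - (z + (\<tau> / 2) *\<^sub>R e) = (q0 - z) + ((\<kappa> - \<tau>) / 2) *\<^sub>R e"
    unfolding q(3) by (simp add: algebra_simps diff_divide_distrib)
  have d1: "q0 + \<kappa> *\<^sub>R e - (z + \<tau> *\<^sub>R e) = (q0 - z) + (\<kappa> - \<tau>) *\<^sub>R e"
    by (simp add: algebra_simps)
  have "(proj_perp e ((1/2) *\<^sub>R (U + V)) + s *\<^sub>R e) \<bullet> (q - (z + (\<tau> / 2) *\<^sub>R e))
    = ((proj_perp e U + s *\<^sub>R e) \<bullet> (q0 - z) + (proj_perp e V + s *\<^sub>R e) \<bullet> (q0 + \<kappa> *\<^sub>R e - (z + \<tau> *\<^sub>R e))) / 2"
    unfolding 0 d d1 using pe ee by (simp add: inner_add_left inner_add_right add_divide_distrib distrib_left)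
  also have "\<dots> \<le> (shifted_support K0 z (proj_perp e U + s *\<^sub>R e) + shifted_support K1 (z + \<tau> *\<^sub>R e) (proj_perp e V + s *\<^sub>R e)) / 2"
    using convex_body.support_upper[OF cb(1) q(1)] convex_body.support_upper[OF cb(2) q(2)]
    by (intro divide_right_mono add_mono) auto
  finally show "(proj_perp e ((1/2) *\<^sub>R (U + V)) + s *\<^sub>R e) \<bullet> (q - (z + (\<tau> / 2) *\<^sub>R e))
    \<le> (shifted_support K0 z (proj_perp e U + s *\<^sub>R e) + shifted_support K1 (z + \<tau> *\<^sub>R e) (proj_perp e V + s *\<^sub>R e)) / 2" .
qed

text \<open>Each half equals \<open>F / j\<close> with \<open>F\<close> the factorial of
  \<open>d - 1\<close>, so its reciprocal is proportional to the number \<open>j\<close> for which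
  the inequality is additive. The dilation \<open>j1 / j0\<close> is the ratio
  \<open>h0 / h1\<close> of the halves.\<close>

lemma halfpolar_coupled:
  assumes cb: "convex_body K0" "convex_body K1" "convex_body Km" and e: "e \<in> Basis"
    and coupled: "coupled e K0 K1 Km" and s: "\<bar>s\<bar> = 1"
    and z: "z \<in> interior K0" "z + \<tau> *\<^sub>R e \<in> interior K1" "z + (\<tau> / 2) *\<^sub>R e \<in> interior Km"
  defines "h0 \<equiv> enn2real (halfpolar (s *\<^sub>R e) K0 z)" and "h1 \<equiv> enn2real (halfpolar (s *\<^sub>R e) K1 (z + \<tau> *\<^sub>R e))"
    and "hm \<equiv> enn2real (halfpolar (s *\<^sub>R e) Km (z + (\<tau> / 2) *\<^sub>R e))"
  shows "1 / hm \<le> (1 / h0 + 1 / h1) / 2"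
    and "1 / hm = (1 / h0 + 1 / h1) / 2 \<Longrightarrow> \<exists>w\<in>span (Basis - {e}). \<forall>W\<in>span (Basis - {e}).
      shifted_support K1 (z + \<tau> *\<^sub>R e) ((h0 / h1) *\<^sub>R W + w + s *\<^sub>R e) = h0 / h1 * shifted_support K0 z (W + s *\<^sub>R e)"
proof -
  let ?B = "Basis - {e}"
  let ?c0 = "\<lambda>W. shifted_support K0 z (proj_perp e W + s *\<^sub>R e)"
  let ?c1 = "\<lambda>W. shifted_support K1 (z + \<tau> *\<^sub>R e) (proj_perp e W + s *\<^sub>R e)"
  let ?cm = "\<lambda>W. shifted_support Km (z + (\<tau> / 2) *\<^sub>R e) (proj_perp e W + s *\<^sub>R e)"
  define F where "F = (fact (DIM('a) - 1) :: real)"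
  have F: "F > 0" unfolding F_def by simp
  note cc0 = convex_body.chart_coercive_convex[OF cb(1) e s z(1)]
  note cc1 = convex_body.chart_coercive_convex[OF cb(2) e s z(2)]
  note ccm = convex_body.chart_coercive_convex[OF cb(3) e s z(3)]
  have B: "?B \<subseteq> Basis" by auto
  obtain j0 where j0: "j0 > 0" "itint ?B (\<lambda>W. ennreal (1 / ?c0 W ^ Suc (card ?B))) 0 = ennreal (1 / j0)"
    using itint_inverse_power_finite[OF B cc0] by blast
  obtain j1 where j1: "j1 > 0" "itint ?B (\<lambda>W. ennreal (1 / ?c1 W ^ Suc (card ?B))) 0 = ennreal (1 / j1)"
    using itint_inverse_power_finite[OF B cc1] by blast
  obtain jm where jm: "jm > 0" "itint ?B (\<lambda>W. ennreal (1 / ?cm W ^ Suc (card ?B))) 0 = ennreal (1 / jm)"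
    using itint_inverse_power_finite[OF B ccm] by blast
  have h: "h0 = F / j0" "h1 = F / j1" "hm = F / jm"
    unfolding h0_def h1_def hm_def convex_body.halfpolar_chart[OF cb(1) e s z(1)] convex_body.halfpolar_chart[OF cb(2) e s z(2)]
      convex_body.halfpolar_chart[OF cb(3) e s z(3)] j0 j1 jm F_def[symmetric]
    using F j0(1) j1(1) jm(1) by (simp_all add: ennreal_mult[symmetric])
  note bbl = borell_brascamp_lieb_itint[OF B cc0 cc1 ccm coupled_support_le[OF cb e coupled] j0(2) j1(2) jm(2) j0(1) j1(1) jm(1)]
  have inv: "1 / h0 = j0 / F" "1 / h1 = j1 / F" "1 / hm = jm / F" unfolding h by simp_all
  have "jm / F \<le> (j0 + j1) / 2 / F" using bbl[THEN conjunct1] F by (intro divide_right_mono) auto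
  then show "1 / hm \<le> (1 / h0 + 1 / h1) / 2" unfolding inv by (simp add: add_divide_distrib mult.commute)
  assume "1 / hm = (1 / h0 + 1 / h1) / 2"
  then have "jm / F = (j0 / F + j1 / F) / 2" unfolding inv .
  also have "\<dots> = ((j0 + j1) / 2) / F" by (simp add: add_divide_distrib mult.commute)
  finally have "jm = (j0 + j1) / 2" using F by (simp only: divide_cancel_right) simp
  moreover have c: "h0 / h1 = j1 / j0" unfolding h using F by simp
  ultimately obtain w where w: "w \<in> span ?B" "\<And>W. W \<in> span ?B \<Longrightarrow> ?c1 ((h0 / h1) *\<^sub>R W + w) = h0 / h1 * ?c0 W"
    using bbl[THEN conjunct2] unfolding c by blast
  show "\<exists>w\<in>span ?B. \<forall>W\<in>span ?B.
      shifted_support K1 (z + \<tau> *\<^sub>R e) ((h0 / h1) *\<^sub>R W + w + s *\<^sub>R e) = h0 / h1 * shifted_support K0 z (W + s *\<^sub>R e)"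
  proof (intro bexI[OF _ w(1)] ballI)
    fix W assume W: "W \<in> span ?B"
    have "(h0 / h1) *\<^sub>R W + w \<in> span ?B" by (intro span_add span_scale W w(1))
    then show "shifted_support K1 (z + \<tau> *\<^sub>R e) ((h0 / h1) *\<^sub>R W + w + s *\<^sub>R e) = h0 / h1 * shifted_support K0 z (W + s *\<^sub>R e)"
      using w(2)[OF W] by (simp add: proj_perp_span[OF e] W)
  qed
qed

subsection \<open>Equality at Santalo points\<close>

text \<open>Here \<open>a\<close>, \<open>a'\<close> and \<open>b\<close>, \<open>b'\<close> are the
  halves for the end bodies, \<open>m\<close>, \<open>m'\<close> those for the middle one, and
  \<open>E0\<close>, \<open>E1\<close> the minimal totals. Balance makes the harmonic means of the
  halves add up to that of the totals, and \<open>eq\<close> leaves no room between this and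
  minimality.\<close>

lemma harmonic_equality:
  fixes a a' b b' m m' E0 E1 :: real
  assumes pos: "a > 0" "a' > 0" "b > 0" "b' > 0" "m > 0" "m' > 0" "E0 > 0" "E1 > 0"
    and bal: "a * b' = a' * b" and le: "1 / m \<le> (1 / a + 1 / b) / 2" "1 / m' \<le> (1 / a' + 1 / b') / 2"
    and E: "E0 \<le> a + a'" "E1 \<le> b + b'" and eq: "1 / (m + m') = (1 / E0 + 1 / E1) / 2"
  shows "E0 = a + a'" "E1 = b + b'" "1 / m = (1 / a + 1 / b) / 2" "1 / m' = (1 / a' + 1 / b') / 2"
    "a / b = E0 / E1" "a' / b' = E0 / E1"
proof -
  define c where "c = a / b"
  have c: "c > 0" unfolding c_def using pos by simp
  have a: "a = c * b" "a' = c * b'" unfolding c_def using pos bal by (simp_all add: field_simps)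
  \<comment> \<open>\<open>k * x\<close> is the harmonic mean of \<open>c * x\<close> and
    \<open>x\<close>.\<close>
  define k where "k = 2 * c / (1 + c)"
  have k: "k > 0" unfolding k_def using c by simp
  have mean: "(1 / (c * x) + 1 / x) / 2 = 1 / (k * x)" if "x > 0" for x
  proof -
    have "1 / (c * x) + 1 / x = (1 + c) / (c * x)" using c that by (simp add: add_divide_distrib)
    then show ?thesis unfolding k_def by simp
  qed
  have m: "k * b \<le> m" "k * b' \<le> m'"
    using le pos k unfolding a mean[OF pos(3)] mean[OF pos(4)] by (simp_all add: divide_le_eq le_divide_eq)
  have bb: "b + b' > 0" using pos by simp
  have kk: "k * (b + b') \<le> m + m'" using m by (simp add: distrib_left)
  have "1 / (m + m') \<le> 1 / (k * (b + b'))"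
    using kk k bb by (intro divide_left_mono mult_pos_pos) (auto intro: add_pos_pos pos)
  also have "\<dots> = (1 / (c * (b + b')) + 1 / (b + b')) / 2" by (rule mean[OF bb, symmetric])
  finally have le': "1 / E0 + 1 / E1 \<le> 1 / (c * (b + b')) + 1 / (b + b')" unfolding eq by simp
  have E': "E0 \<le> c * (b + b')" "E1 \<le> b + b'" using E unfolding a by (simp_all add: distrib_left)
  have 0: "1 / (c * (b + b')) \<le> 1 / E0" "1 / (b + b') \<le> 1 / E1"
    using E' pos c bb by (auto intro!: divide_left_mono)
  have e0: "1 / (c * (b + b')) = 1 / E0" and e1: "1 / (b + b') = 1 / E1" using le' 0 by linarith+
  have E0: "E0 = c * (b + b')" using e0 by (simp only: divide_cancel_left) simp
  have E1: "E1 = b + b'" using e1 by (simp only: divide_cancel_left) simp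
  show "E0 = a + a'" "E1 = b + b'" using E0 E1 unfolding a by (simp_all add: distrib_left)
  have "1 / (m + m') = 1 / (k * (b + b'))" unfolding eq E0 E1 by (rule mean[OF bb])
  then have "m + m' = k * (b + b')" by (simp only: divide_cancel_left) simp
  then have "m = k * b" "m' = k * b'" using m by (simp_all add: distrib_left)
  then show "1 / m = (1 / a + 1 / b) / 2" "1 / m' = (1 / a' + 1 / b') / 2"
    unfolding a mean[OF pos(3)] mean[OF pos(4)] by simp_all
  show "a / b = E0 / E1" "a' / b' = E0 / E1" unfolding E0 E1 a using pos bb by simp_all
qed

text \<open>\<open>coupled\<close> yields points of the closed bodies only. So \<open>z\<close> is
  first pushed slightly further away from the midpoint \<open>pm\<close> of an interior pair, and
  the pair found there is contracted back towards that interior pair.\<close>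

lemma coupled_interior:
  assumes cb: "convex_body K0" "convex_body K1" and coupled: "coupled e K0 K1 Km"
    and p: "p \<in> interior K0" "p + \<sigma> *\<^sub>R e \<in> interior K1" and z: "z \<in> interior Km"
  obtains q \<kappa> where "q \<in> interior K0" "q + \<kappa> *\<^sub>R e \<in> interior K1" "z = q + (\<kappa> / 2) *\<^sub>R e"
proof -
  define pm where "pm = p + (\<sigma> / 2) *\<^sub>R e"
  obtain r where r: "r > 0" "cball z r \<subseteq> Km" using z by (auto simp: mem_interior_cball)
  define \<epsilon> where "\<epsilon> = r / (norm (z - pm) + 1)"
  have \<epsilon>: "\<epsilon> > 0" unfolding \<epsilon>_def using r(1) by (simp add: add_nonneg_pos)
  have "\<epsilon> * norm (z - pm) \<le> r" 
  proof -
    have "\<epsilon> * norm (z - pm) \<le> \<epsilon> * (norm (z - pm) + 1)" using \<epsilon> by (intro mult_left_mono) auto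
    also have "\<dots> = r" unfolding \<epsilon>_def by (simp add: add_nonneg_eq_0_iff)
    finally show ?thesis .
  qed
  then have "z + \<epsilon> *\<^sub>R (z - pm) \<in> Km" using \<epsilon> by (intro subsetD[OF r(2)]) (simp add: dist_norm)
  then obtain q0 \<kappa>0 where q0: "q0 \<in> K0" "q0 + \<kappa>0 *\<^sub>R e \<in> K1" "z + \<epsilon> *\<^sub>R (z - pm) = q0 + (\<kappa>0 / 2) *\<^sub>R e"
    using coupled unfolding coupled_def by blast
  \<comment> \<open>The contraction ratio that undoes the push by the factor
    \<open>1 + \<epsilon>\<close>.\<close>
  define t where "t = \<epsilon> / (1 + \<epsilon>)"
  have t: "0 < t" "t \<le> 1" unfolding t_def using \<epsilon> by auto
  have t1: "(1 - t) * (1 + \<epsilon>) = 1" "t * (1 + \<epsilon>) = \<epsilon>" unfolding t_def using \<epsilon> by (simp_all add: field_simps)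
  define q where "q = q0 - t *\<^sub>R (q0 - p)"
  define \<kappa> where "\<kappa> = (1 - t) * \<kappa>0 + t * \<sigma>"
  show thesis
  proof (rule that[of q \<kappa>])
    show "q \<in> interior K0" unfolding q_def
      using cb(1)[unfolded convex_body_def] by (intro mem_interior_convex_shrink p q0 t) auto
    have "(q0 + \<kappa>0 *\<^sub>R e) - t *\<^sub>R ((q0 + \<kappa>0 *\<^sub>R e) - (p + \<sigma> *\<^sub>R e)) \<in> interior K1"
      using cb(2)[unfolded convex_body_def] by (intro mem_interior_convex_shrink p q0 t) auto
    then show "q + \<kappa> *\<^sub>R e \<in> interior K1" unfolding q_def \<kappa>_def by (simp add: algebra_simps)
    have "q + (\<kappa> / 2) *\<^sub>R e = (1 - t) *\<^sub>R (q0 + (\<kappa>0 / 2) *\<^sub>R e) + t *\<^sub>R pm"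
      unfolding q_def \<kappa>_def pm_def by (simp add: algebra_simps add_divide_distrib diff_divide_distrib)
    also have "\<dots> = ((1 - t) * (1 + \<epsilon>)) *\<^sub>R z + (t - (1 - t) * \<epsilon>) *\<^sub>R pm"
      unfolding q0(3)[symmetric] by (simp add: algebra_simps)
    also have "t - (1 - t) * \<epsilon> = t * (1 + \<epsilon>) - \<epsilon>" by (simp add: algebra_simps)
    finally show "z = q + (\<kappa> / 2) *\<^sub>R e" unfolding t1 by simp
  qed
qed

text \<open>The base points are balanced and have their midpoint at the Santalo point of
  \<open>Km\<close>. Equality makes them minimisers, so by uniqueness they are the Santalo points of
  \<open>K0\<close> and \<open>K1\<close>, which therefore differ along \<open>e\<close> only. Equal
  ratios give both halves the same dilation \<open>c\<close>.\<close>

lemma santalo_coupled_equality: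
  assumes cb: "convex_body K0" "convex_body K1" "convex_body Km" and e: "e \<in> Basis"
    and coupled: "coupled e K0 K1 Km"
    and p: "p \<in> interior K0" "p + \<sigma> *\<^sub>R e \<in> interior K1"
  defines "E \<equiv> \<lambda>K. enn2real (polar_integral UNIV K (santalo_point K))"
  assumes eq: "1 / E Km = (1 / E K0 + 1 / E K1) / 2"
  obtains \<tau> c w1 w2 where "santalo_point K1 = santalo_point K0 + \<tau> *\<^sub>R e" "c > 0"
    "w1 \<in> span (Basis - {e})" "w2 \<in> span (Basis - {e})"
    "\<And>W. W \<in> span (Basis - {e}) \<Longrightarrow> shifted_support K1 (santalo_point K1) (c *\<^sub>R W + w1 + e)
      = c * shifted_support K0 (santalo_point K0) (W + e)"
    "\<And>W. W \<in> span (Basis - {e}) \<Longrightarrow> shifted_support K1 (santalo_point K1) (c *\<^sub>R W + w2 - e)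
      = c * shifted_support K0 (santalo_point K0) (W - e)"
proof -
  note cbs = cb(1)[THEN convex_body.santalo_point(1)] cb(2)[THEN convex_body.santalo_point(1)] cb(3)[THEN convex_body.santalo_point(1)]
  obtain q \<kappa> where q: "q \<in> interior K0" "q + \<kappa> *\<^sub>R e \<in> interior K1" "santalo_point Km = q + (\<kappa> / 2) *\<^sub>R e"
    using coupled_interior[OF cb(1,2) coupled p cbs(3)] by blast
  obtain t where t: "q + t *\<^sub>R e \<in> interior K0" "q + \<kappa> *\<^sub>R e - t *\<^sub>R e \<in> interior K1"
    "enn2real (halfpolar e K0 (q + t *\<^sub>R e)) * enn2real (halfpolar (- e) K1 (q + \<kappa> *\<^sub>R e - t *\<^sub>R e))
    = enn2real (halfpolar (- e) K0 (q + t *\<^sub>R e)) * enn2real (halfpolar e K1 (q + \<kappa> *\<^sub>R e - t *\<^sub>R e))"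
    using halfpolar_ratio_balanced[OF cb(1,2) e q(1,2)] by blast
  define z where "z = q + t *\<^sub>R e"
  \<comment> \<open>The base points move by \<open>t\<close> and \<open>- t\<close>, so their offset
    changes by \<open>- 2 * t\<close> while the midpoint stays.\<close>
  define \<tau> where "\<tau> = \<kappa> - 2 * t"
  have z1: "q + \<kappa> *\<^sub>R e - t *\<^sub>R e = z + \<tau> *\<^sub>R e" 
  proof -
    have "t + \<tau> = \<kappa> - t" unfolding \<tau>_def by simp
    then have "q + (t + \<tau>) *\<^sub>R e = q + (\<kappa> - t) *\<^sub>R e" by simp
    then show ?thesis unfolding z_def by (simp add: algebra_simps)
  qed
  have zm: "z + (\<tau> / 2) *\<^sub>R e = santalo_point Km"
  proof -
    have "\<tau> / 2 = \<kappa> / 2 - t" unfolding \<tau>_def by simp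
    then have "z + (\<tau> / 2) *\<^sub>R e = q + t *\<^sub>R e + (\<kappa> / 2 - t) *\<^sub>R e" unfolding z_def by simp
    then show ?thesis unfolding q(3) scaleR_left_diff_distrib by simp
  qed
  note z = t(1)[folded z_def] t(2)[unfolded z1] cbs(3)[folded zm]
  note bal = t(3)[unfolded z1, folded z_def]
  have s: "\<bar>1::real\<bar> = 1" "\<bar>- 1::real\<bar> = 1" by simp_all
  have e0: "e \<noteq> 0" "- e \<noteq> 0" using e nonzero_Basis by auto
  note hc = halfpolar_coupled[OF cb e coupled s(1) z, unfolded scaleR_one]
  note hc' = halfpolar_coupled[OF cb e coupled s(2) z, unfolded scaleR_minus_left scaleR_one]
  have tot: "enn2real (polar_integral UNIV K x) = enn2real (halfpolar e K x) + enn2real (halfpolar (- e) K x)"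
    if "convex_body K" "x \<in> interior K" for K x
    unfolding convex_body.halfpolar_add[OF that(1) e]
    by (rule enn2real_plus) (use convex_body.polar_integral_finite[OF that] in auto)
  have min: "E K \<le> enn2real (polar_integral UNIV K x)" if "convex_body K" "x \<in> interior K" for K x
    unfolding E_def using convex_body.santalo_point(2)[OF that] convex_body.polar_integral_finite[OF that]
    by (intro enn2real_mono) auto
  have Epos: "E K > 0" if "convex_body K" for K
    unfolding E_def tot[OF that convex_body.santalo_point(1)[OF that]]
    by (intro add_pos_pos halfpolar_real_pos[OF that] convex_body.santalo_point(1)[OF that] e0)
  have Em: "E Km = enn2real (halfpolar e Km (z + (\<tau> / 2) *\<^sub>R e)) + enn2real (halfpolar (- e) Km (z + (\<tau> / 2) *\<^sub>R e))"
    unfolding E_def zm[symmetric] by (rule tot[OF cb(3) z(3)])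
  note harm = harmonic_equality[OF halfpolar_real_pos[OF cb(1) z(1) e0(1)] halfpolar_real_pos[OF cb(1) z(1) e0(2)]
    halfpolar_real_pos[OF cb(2) z(2) e0(1)] halfpolar_real_pos[OF cb(2) z(2) e0(2)]
    halfpolar_real_pos[OF cb(3) z(3) e0(1)] halfpolar_real_pos[OF cb(3) z(3) e0(2)]
    Epos[OF cb(1)] Epos[OF cb(2)] bal hc(1) hc'(1) min[OF cb(1) z(1), unfolded tot[OF cb(1) z(1)]]
    min[OF cb(2) z(2), unfolded tot[OF cb(2) z(2)]] eq[unfolded Em]]
  have san: "x = santalo_point K" if K: "convex_body K" "x \<in> interior K" "E K = enn2real (polar_integral UNIV K x)" for K x
  proof (rule convex_body.polar_integral_minimizer_unique[OF K(1) convex_body.santalo_point(1)[OF K(1)] K(2) convex_body.santalo_point(2)[OF K(1)]])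
    have "polar_integral UNIV K x = ennreal (enn2real (polar_integral UNIV K x))"
      using convex_body.polar_integral_finite[OF K(1,2)] by simp
    also have "\<dots> = ennreal (enn2real (polar_integral UNIV K (santalo_point K)))"
      using K(3) unfolding E_def by simp
    also have "\<dots> = polar_integral UNIV K (santalo_point K)"
      using convex_body.polar_integral_finite[OF K(1) convex_body.santalo_point(1)[OF K(1)]] by simp
    finally show "polar_integral UNIV K x = polar_integral UNIV K (santalo_point K)" .
  qed
  have z0: "santalo_point K0 = z" using san[OF cb(1) z(1)] harm(1) unfolding tot[OF cb(1) z(1)] by simp
  have z1: "santalo_point K1 = z + \<tau> *\<^sub>R e" using san[OF cb(2) z(2)] harm(2) unfolding tot[OF cb(2) z(2)] by simp
  define c where "c = E K0 / E K1"
  have c: "c > 0" unfolding c_def using Epos cb by simp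
  obtain w1 where w1: "w1 \<in> span (Basis - {e})" "\<And>W. W \<in> span (Basis - {e}) \<Longrightarrow>
      shifted_support K1 (z + \<tau> *\<^sub>R e) (c *\<^sub>R W + w1 + e) = c * shifted_support K0 z (W + e)"
    using hc(2)[OF harm(3)] unfolding harm(5) c_def by blast
  obtain w2 where w2: "w2 \<in> span (Basis - {e})" "\<And>W. W \<in> span (Basis - {e}) \<Longrightarrow>
      shifted_support K1 (z + \<tau> *\<^sub>R e) (c *\<^sub>R W + w2 + - e) = c * shifted_support K0 z (W + - e)"
    using hc'(2)[OF harm(4)] unfolding harm(6) c_def by blast
  show thesis
    by (rule that[of \<tau>, OF _ c w1(1) w2(1)]) (use w1(2) w2(2) in \<open>simp_all add: z0 z1\<close>)
qed

text \<open>The positively homogeneous map that sends \<open>W + e\<close> to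
  \<open>c *\<^sub>R W + w1 + e\<close> and \<open>W - e\<close> to
  \<open>c *\<^sub>R W + w2 - e\<close> for \<open>W\<close> orthogonal to \<open>e\<close>. It is
  linear exactly when \<open>w2 = - w1\<close>.\<close>

definition piecewise_shear :: "'a::euclidean_space \<Rightarrow> real \<Rightarrow> 'a \<Rightarrow> 'a \<Rightarrow> 'a \<Rightarrow> 'a" where
  "piecewise_shear e c w1 w2 y = c *\<^sub>R proj_perp e y + \<bar>y \<bullet> e\<bar> *\<^sub>R (if y \<bullet> e > 0 then w1 else w2) + (y \<bullet> e) *\<^sub>R e"

text \<open>A change of variables by the piecewise shear, done on each half in its chart: the
  hyperplane contributes \<open>c ^ (d - 1)\<close>, and the factor \<open>c\<close> of the support
  function contributes \<open>1 / c ^ d\<close>. The base point moves by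
  \<open>c * \<epsilon>\<close>, so that the perturbation pulls back with the coefficient
  \<open>\<epsilon>\<close>.\<close>

lemma polar_integral_piecewise_shear:
  assumes cb: "convex_body K0" "convex_body K1" and e: "e \<in> Basis" and c: "c > 0"
    and w: "w1 \<in> span (Basis - {e})" "w2 \<in> span (Basis - {e})"
    and eq1: "\<And>W. W \<in> span (Basis - {e}) \<Longrightarrow> shifted_support K1 z1 (c *\<^sub>R W + w1 + e) = c * shifted_support K0 z0 (W + e)"
    and eq2: "\<And>W. W \<in> span (Basis - {e}) \<Longrightarrow> shifted_support K1 z1 (c *\<^sub>R W + w2 - e) = c * shifted_support K0 z0 (W - e)"
    and z1: "z1 + (c * \<epsilon>) *\<^sub>R d \<in> interior K1"
  shows "polar_integral UNIV K1 (z1 + (c * \<epsilon>) *\<^sub>R d)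
    = ennreal (1 / c) * (\<integral>\<^sup>+y. ennreal (exp (- shifted_support K0 z0 y + \<epsilon> * (piecewise_shear e c w1 w2 y \<bullet> d))) \<partial>lborel)"
proof -
  let ?B = "Basis - {e}"
  define G where "G = (\<lambda>y. shifted_support K0 z0 y - \<epsilon> * (piecewise_shear e c w1 w2 y \<bullet> d))"
  have ee: "e \<bullet> e = 1" using e by simp
  have [measurable]: "G \<in> borel_measurable borel"
    using convex_body.support_measurable[OF cb(1), of z0]
    unfolding G_def piecewise_shear_def proj_perp_def by measurable
  have homG: "homogeneous G"
    unfolding homogeneous_def
  proof (intro allI impI)
    fix t :: real and y assume t: "t > 0"
    have "piecewise_shear e c w1 w2 (t *\<^sub>R y) = t *\<^sub>R piecewise_shear e c w1 w2 y"
      using t unfolding piecewise_shear_def proj_perp_def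
      by (auto simp: algebra_simps abs_mult zero_less_mult_iff)
    then show "G (t *\<^sub>R y) = t * G y"
      unfolding G_def using t by (simp add: convex_body.support_scale[OF cb(1)] right_diff_distrib)
  qed
  have half: "halfpolar (s *\<^sub>R e) K1 (z1 + (c * \<epsilon>) *\<^sub>R d)
      = ennreal (1 / c) * (\<integral>\<^sup>+y. ennreal (exp (- G y)) * indicator {y. s * (y \<bullet> e) > 0} y \<partial>lborel)"
    if s: "\<bar>s\<bar> = 1" for s
  proof -
    define w where "w = (if s > 0 then w1 else w2)"
    have wB: "w \<in> span ?B" unfolding w_def using w by simp
    define f where "f = (\<lambda>y. ennreal (1 / shifted_support K1 (z1 + (c * \<epsilon>) *\<^sub>R d) y ^ DIM('a)))"
    have fm[measurable]: "f \<in> borel_measurable borel"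
      using convex_body.support_measurable[OF cb(2), of "z1 + (c * \<epsilon>) *\<^sub>R d"] unfolding f_def by measurable
    have key: "shifted_support K1 (z1 + (c * \<epsilon>) *\<^sub>R d) (c *\<^sub>R W + (s *\<^sub>R e + w)) = c * G (s *\<^sub>R e + W)" if W: "W \<in> span ?B" for W
    proof -
      have We: "W \<bullet> e = 0" by (rule span_perp[OF e W])
      have "s = 1 \<or> s = - 1" using s by linarith
      then have 1: "shifted_support K1 z1 (c *\<^sub>R W + (s *\<^sub>R e + w)) = c * shifted_support K0 z0 (s *\<^sub>R e + W)"
        using eq1[OF W] eq2[OF W] unfolding w_def by (auto simp: algebra_simps)
      have "piecewise_shear e c w1 w2 (s *\<^sub>R e + W) = c *\<^sub>R W + (s *\<^sub>R e + w)"
        using s We ee unfolding piecewise_shear_def proj_perp_def w_def by (simp add: inner_add_left)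
      then show ?thesis
        unfolding convex_body.support_shift[OF cb(2)] 1 G_def by (simp add: right_diff_distrib)
    qed
    have nz: "c *\<^sub>R W + (s *\<^sub>R e + w) \<noteq> 0" if "W \<in> span ?B" for W
    proof
      assume "c *\<^sub>R W + (s *\<^sub>R e + w) = 0"
      then have "(c *\<^sub>R W + (s *\<^sub>R e + w)) \<bullet> e = 0" by simp
      then show False using span_perp[OF e that] span_perp[OF e wB] ee s by (simp add: inner_add_left)
    qed
    have Gpos: "G (s *\<^sub>R e + W) > 0" if "W \<in> span ?B" for W
      using convex_body.support_pos[OF cb(2) z1 nz[OF that]] c unfolding key[OF that] by (simp add: zero_less_mult_iff)
    have "itint ?B f (s *\<^sub>R e) = itint ?B f (s *\<^sub>R e + w)"
      by (rule itint_translate[symmetric]) (simp_all add: wB)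
    also have "\<dots> = itint ?B (\<lambda>v. f (v + (s *\<^sub>R e + w))) 0" unfolding itint_def by (simp add: add.commute)
    also have "\<dots> = ennreal (c ^ card ?B) * (ennreal (1 / c ^ card ?B) * itint ?B (\<lambda>v. f (v + (s *\<^sub>R e + w))) (c *\<^sub>R 0))"
      using c by (simp add: mult.assoc[symmetric] ennreal_mult[symmetric])
    also have "ennreal (1 / c ^ card ?B) * itint ?B (\<lambda>v. f (v + (s *\<^sub>R e + w))) (c *\<^sub>R 0)
        = itint ?B (\<lambda>v. f (c *\<^sub>R v + (s *\<^sub>R e + w))) 0"
      by (rule itint_scale[symmetric]) (simp_all add: c)
    also have "\<dots> = itint ?B (\<lambda>v. ennreal (1 / c ^ DIM('a)) * ennreal (1 / G (s *\<^sub>R e + v) ^ DIM('a))) 0"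
    proof (rule itint_cong)
      fix v assume v: "v \<in> span ?B"
      show "f (c *\<^sub>R (0 + v) + (s *\<^sub>R e + w)) = ennreal (1 / c ^ DIM('a)) * ennreal (1 / G (s *\<^sub>R e + (0 + v)) ^ DIM('a))"
        unfolding f_def using key[OF v] Gpos[OF v] c by (simp add: ennreal_mult[symmetric] power_mult_distrib)
    qed simp
    also have "\<dots> = ennreal (1 / c ^ DIM('a)) * itint ?B (\<lambda>v. ennreal (1 / G (s *\<^sub>R e + v) ^ DIM('a))) 0"
      by (rule itint_cmult) measurable
    also have "itint ?B (\<lambda>v. ennreal (1 / G (s *\<^sub>R e + v) ^ DIM('a))) 0 = itint ?B (\<lambda>v. ennreal (1 / G v ^ DIM('a))) (s *\<^sub>R e)"
      unfolding itint_def by simp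
    also have "ennreal (c ^ card ?B) * (ennreal (1 / c ^ DIM('a)) * itint ?B (\<lambda>v. ennreal (1 / G v ^ DIM('a))) (s *\<^sub>R e))
        = ennreal (1 / c) * itint ?B (\<lambda>v. ennreal (1 / G v ^ DIM('a))) (s *\<^sub>R e)"
    proof -
      have "c ^ card ?B * (1 / c ^ DIM('a)) = 1 / c"
        unfolding convex_body.card_perp[OF cb(1) e, symmetric] using c by simp
      then show ?thesis using c by (simp add: mult.assoc[symmetric] ennreal_mult[symmetric])
    qed
    finally have J: "itint ?B f (s *\<^sub>R e) = ennreal (1 / c) * itint ?B (\<lambda>v. ennreal (1 / G v ^ DIM('a))) (s *\<^sub>R e)" .
    have H: "(\<integral>\<^sup>+y. ennreal (exp (- G y)) * indicator {y. s * (y \<bullet> e) > 0} y \<partial>lborel)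
        = ennreal (fact (DIM('a) - 1)) * itint ?B (\<lambda>v. ennreal (1 / G v ^ DIM('a))) (s *\<^sub>R e)"
      by (rule exp_integral_halfspace[OF _ homG e s Gpos]) measurable
    show ?thesis
      unfolding convex_body.halfpolar_eq[OF cb(2) e s z1] J[unfolded f_def] H by (rule mult.left_commute)
  qed
  have "polar_integral UNIV K1 (z1 + (c * \<epsilon>) *\<^sub>R d) = ennreal (1 / c) *
      ((\<integral>\<^sup>+y. ennreal (exp (- G y)) * indicator {y. 1 * (y \<bullet> e) > 0} y \<partial>lborel)
      + (\<integral>\<^sup>+y. ennreal (exp (- G y)) * indicator {y. - 1 * (y \<bullet> e) > 0} y \<partial>lborel))"
    using half[of 1] half[of "- 1"] unfolding convex_body.halfpolar_add[OF cb(2) e] by (simp add: distrib_left)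
  also have "(\<integral>\<^sup>+y. ennreal (exp (- G y)) * indicator {y. 1 * (y \<bullet> e) > 0} y \<partial>lborel)
      + (\<integral>\<^sup>+y. ennreal (exp (- G y)) * indicator {y. - 1 * (y \<bullet> e) > 0} y \<partial>lborel)
      = (\<integral>\<^sup>+y. ennreal (exp (- G y)) * indicator {y. 1 * (y \<bullet> e) > 0} y
        + ennreal (exp (- G y)) * indicator {y. - 1 * (y \<bullet> e) > 0} y \<partial>lborel)"
    by (rule nn_integral_add[symmetric]) auto
  also have "\<dots> = (\<integral>\<^sup>+y. ennreal (exp (- G y)) \<partial>lborel)"
    by (rule nn_integral_cong_AE, rule AE_mp[OF AE_lborel_inner_neq[OF e, of 0]], rule AE_I2)
      (auto simp: indicator_def)
  finally show ?thesis unfolding G_def by simp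
qed

lemma piecewise_shear_norm_le:
  assumes "e \<in> Basis"
  shows "\<bar>piecewise_shear e c w1 w2 y \<bullet> d\<bar> \<le> ((2 * \<bar>c\<bar> + (norm w1 + norm w2) + 1) * norm d) * norm y"
proof -
  have ye: "\<bar>y \<bullet> e\<bar> \<le> norm y" using assms by (rule Basis_le_norm)
  have ne: "norm e = 1" using assms by simp
  have "norm (proj_perp e y) \<le> norm y + \<bar>y \<bullet> e\<bar>"
    unfolding proj_perp_def using norm_triangle_ineq4[of y "(y \<bullet> e) *\<^sub>R e"] ne by simp
  then have p: "norm (c *\<^sub>R proj_perp e y) \<le> \<bar>c\<bar> * (2 * norm y)"
    unfolding norm_scaleR using ye by (intro mult_left_mono) auto
  have "norm (\<bar>y \<bullet> e\<bar> *\<^sub>R (if y \<bullet> e > 0 then w1 else w2)) \<le> norm y * (norm w1 + norm w2)"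
    unfolding norm_scaleR using ye by (intro mult_mono) auto
  moreover have "norm ((y \<bullet> e) *\<^sub>R e) \<le> norm y" using ye ne by simp
  ultimately have "norm (piecewise_shear e c w1 w2 y) \<le> \<bar>c\<bar> * (2 * norm y) + norm y * (norm w1 + norm w2) + norm y"
    unfolding piecewise_shear_def using p by (intro norm_triangle_le add_mono) auto
  also have "\<dots> = (2 * \<bar>c\<bar> + (norm w1 + norm w2) + 1) * norm y" by (simp add: algebra_simps)
  finally have "norm (piecewise_shear e c w1 w2 y) * norm d \<le> (2 * \<bar>c\<bar> + (norm w1 + norm w2) + 1) * norm y * norm d"
    by (rule mult_right_mono) simp
  then show ?thesis using Cauchy_Schwarz_ineq2[of "piecewise_shear e c w1 w2 y" d] by (simp add: mult_ac)
qed

text \<open>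
  Both Santalo points satisfy a first order condition: the barycentre with respect to \<open>exp (- g)\<close> is the
  origin. Pulled back to \<open>K0\<close>, the two conditions differ by a positive multiple of \<open>w1 + w2\<close>.
\<close>

lemma opposite_shifts:
  assumes cb: "convex_body K0" "convex_body K1" and e: "e \<in> Basis" and c: "c > 0"
    and w: "w1 \<in> span (Basis - {e})" "w2 \<in> span (Basis - {e})"
    and eq1: "\<And>W. W \<in> span (Basis - {e}) \<Longrightarrow> shifted_support K1 (santalo_point K1) (c *\<^sub>R W + w1 + e)
      = c * shifted_support K0 (santalo_point K0) (W + e)"
    and eq2: "\<And>W. W \<in> span (Basis - {e}) \<Longrightarrow> shifted_support K1 (santalo_point K1) (c *\<^sub>R W + w2 - e)
      = c * shifted_support K0 (santalo_point K0) (W - e)"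
  shows "w1 + w2 = 0"
proof -
  let ?g = "shifted_support K0 (santalo_point K0)"
  let ?l = "\<lambda>d y. piecewise_shear e c w1 w2 y \<bullet> d"
  note s0 = convex_body.santalo_point[OF cb(1)] and s1 = convex_body.santalo_point[OF cb(2)]
  have gm[measurable]: "?g \<in> borel_measurable borel" by (rule convex_body.support_measurable[OF cb(1)])
  obtain \<rho> where \<rho>: "\<rho> > 0" "\<And>y. \<rho> * norm y \<le> ?g y"
    using convex_body.support_lower_norm[OF cb(1) s0(1)] by blast
  have lm[measurable]: "?l d \<in> borel_measurable borel" for d
    unfolding piecewise_shear_def proj_perp_def by measurable
  have near: "\<exists>\<epsilon>0>0. \<forall>\<epsilon>. \<bar>\<epsilon>\<bar> < \<epsilon>0 \<longrightarrow> x + (k * \<epsilon>) *\<^sub>R d \<in> interior K" if xK: "x \<in> interior K" for x d :: 'a and k K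
  proof -
    obtain r where r: "r > 0" "ball x r \<subseteq> interior K"
      by (rule openE[OF open_interior xK])
    define M where "M = \<bar>k\<bar> * norm d + 1"
    have M: "M > 0" unfolding M_def by (simp add: add_nonneg_pos)
    have "x + (k * \<epsilon>) *\<^sub>R d \<in> interior K" if \<epsilon>: "\<bar>\<epsilon>\<bar> < r / M" for \<epsilon>
    proof (rule subsetD[OF r(2)])
      have "\<bar>\<epsilon>\<bar> * (\<bar>k\<bar> * norm d) \<le> \<bar>\<epsilon>\<bar> * M" unfolding M_def by (intro mult_left_mono) auto
      also have "\<dots> < r" using \<epsilon> M by (simp add: pos_less_divide_eq)
      finally show "x + (k * \<epsilon>) *\<^sub>R d \<in> ball x r" by (simp add: dist_norm abs_mult mult_ac)
    qed
    then show ?thesis using r(1) M by (intro exI[of _ "r / M"]) auto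
  qed
  \<comment> \<open>The barycentre condition at the Santalo point of \<open>K0\<close>, tested in
    direction \<open>d\<close>; \<open>F1\<close> is that of \<open>K1\<close> pulled back.\<close>
  have F0: "integrable lborel (\<lambda>y. (y \<bullet> d) * exp (- ?g y))" "(\<integral>y. (y \<bullet> d) * exp (- ?g y) \<partial>lborel) = 0" for d
  proof -
    obtain \<epsilon>0 where \<epsilon>0: "\<epsilon>0 > 0" "\<And>\<epsilon>. \<bar>\<epsilon>\<bar> < \<epsilon>0 \<Longrightarrow> santalo_point K0 + (1 * \<epsilon>) *\<^sub>R d \<in> interior K0"
      using near[OF s0(1), of 1 d] by blast
    have min: "(\<integral>\<^sup>+y. ennreal (exp (- ?g y)) \<partial>lborel) \<le> (\<integral>\<^sup>+y. ennreal (exp (- ?g y + \<epsilon> * (y \<bullet> d))) \<partial>lborel)"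
      if "\<bar>\<epsilon>\<bar> < \<epsilon>0" for \<epsilon>
      using s0(2)[OF \<epsilon>0(2)[OF that]] unfolding polar_integral_def convex_body.support_shift[OF cb(1)] by simp
    have bound: "\<bar>y \<bullet> d\<bar> \<le> norm d * norm y" for y using Cauchy_Schwarz_ineq2[of y d] by (simp add: mult.commute)
    show "integrable lborel (\<lambda>y. (y \<bullet> d) * exp (- ?g y))" "(\<integral>y. (y \<bullet> d) * exp (- ?g y) \<partial>lborel) = 0"
      using first_order_condition[OF gm _ \<rho> bound \<epsilon>0(1) min] by simp_all
  qed
  have F1: "integrable lborel (\<lambda>y. ?l d y * exp (- ?g y))" "(\<integral>y. ?l d y * exp (- ?g y) \<partial>lborel) = 0" for d
  proof -
    obtain \<epsilon>0 where \<epsilon>0: "\<epsilon>0 > 0" "\<And>\<epsilon>. \<bar>\<epsilon>\<bar> < \<epsilon>0 \<Longrightarrow> santalo_point K1 + (c * \<epsilon>) *\<^sub>R d \<in> interior K1"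
      using near[OF s1(1), of c d] by blast
    have P: "polar_integral UNIV K1 (santalo_point K1 + (c * \<epsilon>) *\<^sub>R d)
        = ennreal (1 / c) * (\<integral>\<^sup>+y. ennreal (exp (- ?g y + \<epsilon> * ?l d y)) \<partial>lborel)"
      if "santalo_point K1 + (c * \<epsilon>) *\<^sub>R d \<in> interior K1" for \<epsilon>
      by (rule polar_integral_piecewise_shear[OF cb e c w _ _ that]) (use eq1 eq2 in auto)
    have min: "(\<integral>\<^sup>+y. ennreal (exp (- ?g y)) \<partial>lborel) \<le> (\<integral>\<^sup>+y. ennreal (exp (- ?g y + \<epsilon> * ?l d y)) \<partial>lborel)"
      if \<epsilon>: "\<bar>\<epsilon>\<bar> < \<epsilon>0" for \<epsilon>
    proof -
      have i0: "santalo_point K1 + (c * 0) *\<^sub>R d \<in> interior K1" using s1(1) by simp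
      have "polar_integral UNIV K1 (santalo_point K1 + (c * 0) *\<^sub>R d) \<le> polar_integral UNIV K1 (santalo_point K1 + (c * \<epsilon>) *\<^sub>R d)"
        using s1(2)[OF \<epsilon>0(2)[OF \<epsilon>]] by simp
      then have "ennreal c * (ennreal (1 / c) * (\<integral>\<^sup>+y. ennreal (exp (- ?g y + 0 * ?l d y)) \<partial>lborel))
          \<le> ennreal c * (ennreal (1 / c) * (\<integral>\<^sup>+y. ennreal (exp (- ?g y + \<epsilon> * ?l d y)) \<partial>lborel))"
        unfolding P[OF i0] P[OF \<epsilon>0(2)[OF \<epsilon>]] by (rule mult_left_mono) simp
      then show ?thesis using c by (simp add: mult.assoc[symmetric] ennreal_mult[symmetric])
    qed
    show "integrable lborel (\<lambda>y. ?l d y * exp (- ?g y))" "(\<integral>y. ?l d y * exp (- ?g y) \<partial>lborel) = 0"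
      using first_order_condition[OF gm lm \<rho> piecewise_shear_norm_le[OF e] \<epsilon>0(1) min] by simp_all
  qed
  \<comment> \<open>The test direction that isolates the sum. It is orthogonal to \<open>e\<close>,
    so the part of the piecewise shear along \<open>e\<close> drops out.\<close>
  define d where "d = w1 + w2"
  have dB: "d \<in> span (Basis - {e})" unfolding d_def by (rule span_add[OF w])
  have de: "e \<bullet> d = 0" using span_perp[OF e dB] by (simp add: inner_commute)
  \<comment> \<open>Coefficients of the even and odd parts in \<open>y \<bullet> e\<close> of the
    shift term. By \<open>F0\<close> and \<open>F1\<close> everything else integrates to zero, hence
    so does the even part, whose weight \<open>\<bar>y \<bullet> e\<bar>\<close> is positive almost
    everywhere.\<close>
  define \<alpha> \<beta> where "\<alpha> = (d \<bullet> d) / 2" and "\<beta> = ((w1 - w2) \<bullet> d) / 2"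
  have split: "\<alpha> * \<bar>y \<bullet> e\<bar> * exp (- ?g y) = ?l d y * exp (- ?g y) - c * ((y \<bullet> d) * exp (- ?g y)) - \<beta> * ((y \<bullet> e) * exp (- ?g y))" for y
  proof -
    have "?l d y = c * (y \<bullet> d) + \<bar>y \<bullet> e\<bar> * ((if y \<bullet> e > 0 then w1 else w2) \<bullet> d)"
      unfolding piecewise_shear_def proj_perp_def using de by (simp add: inner_add_left inner_diff_left)
    also have "\<bar>y \<bullet> e\<bar> * ((if y \<bullet> e > 0 then w1 else w2) \<bullet> d) = \<alpha> * \<bar>y \<bullet> e\<bar> + \<beta> * (y \<bullet> e)"
    proof -
      have "\<alpha> + \<beta> = w1 \<bullet> d" "\<alpha> - \<beta> = w2 \<bullet> d" unfolding \<alpha>_def \<beta>_def d_def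
        by (simp_all add: inner_add_left inner_diff_left add_divide_distrib[symmetric] diff_divide_distrib[symmetric])
      then have w: "w1 \<bullet> d = \<alpha> + \<beta>" "w2 \<bullet> d = \<alpha> - \<beta>" by simp_all
      show ?thesis
      proof (cases "y \<bullet> e > 0")
        case True
        then have "\<bar>y \<bullet> e\<bar> = y \<bullet> e" by simp
        with True show ?thesis unfolding w(1)[symmetric] by (simp add: w distrib_left distrib_right mult.commute)
      next
        case False
        then have "\<bar>y \<bullet> e\<bar> = - (y \<bullet> e)" by simp
        with False show ?thesis by (simp add: w left_diff_distrib right_diff_distrib mult.commute)
      qed
    qed
    finally have l: "?l d y = c * (y \<bullet> d) + (\<alpha> * \<bar>y \<bullet> e\<bar> + \<beta> * (y \<bullet> e))" .
    show ?thesis unfolding l by (simp add: algebra_simps)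
  qed
  have I: "integrable lborel (\<lambda>y. \<alpha> * \<bar>y \<bullet> e\<bar> * exp (- ?g y))"
    unfolding split using F1(1)[of d] F0(1)[of d] F0(1)[of e] by simp
  have Z: "(\<integral>y. \<alpha> * \<bar>y \<bullet> e\<bar> * exp (- ?g y) \<partial>lborel) = 0"
    unfolding split using F1[of d] F0[of d] F0[of e] by simp
  have "\<alpha> = 0"
  proof (rule ccontr)
    assume \<alpha>: "\<alpha> \<noteq> 0"
    have \<alpha>0: "\<alpha> \<ge> 0" unfolding \<alpha>_def by simp
    have "AE y in lborel. \<alpha> * \<bar>y \<bullet> e\<bar> * exp (- ?g y) = 0"
      using Z \<alpha>0 by (subst (asm) integral_nonneg_eq_0_iff_AE[OF I]) auto
    then have "AE y in (lborel :: 'a measure). False"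
      using AE_lborel_inner_neq[OF e, of 0] by (rule AE_mp[OF _ AE_mp]) (use \<alpha> in auto)
    then show False by (subst (asm) AE_iff_null) auto
  qed
  then show ?thesis unfolding \<alpha>_def d_def by simp
qed

subsection \<open>Shears\<close>

text \<open>\<open>shear_map\<close> with the time absorbed into the parameters. If
  \<open>V \<bullet> e = 0\<close>, then \<open>k\<close> is the determinant of the linear
  part.\<close>

definition shear :: "'a::euclidean_space \<Rightarrow> real \<Rightarrow> 'a \<Rightarrow> real \<Rightarrow> 'a \<Rightarrow> 'a" where
  "shear e k V u x = x + ((k - 1) * (x \<bullet> e) + V \<bullet> x + u) *\<^sub>R e"

lemma shear_map_eq:
  assumes "e \<in> Basis" "V \<bullet> e = 0"
  shows "shear_map e v u V s = shear e (1 + s * v) (s *\<^sub>R V) (s * u)"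
  unfolding shear_map_def shear_def Let_def using assms
  by (intro ext) (simp add: inner_diff_right algebra_simps)

lemma shear_inner:
  assumes "e \<in> Basis" shows "shear e k V u x \<bullet> e = k * (x \<bullet> e) + V \<bullet> x + u"
  using assms unfolding shear_def by (simp add: inner_add_left algebra_simps)

lemma shear_diff:
  "shear e k V u x - shear e k V u z = shear e k V 0 (x - z)"
  unfolding shear_def by (simp add: inner_diff_left inner_diff_right algebra_simps)

lemma shear_linear: "linear (shear e k V 0)"
  unfolding shear_def by (rule linearI) (simp_all add: inner_add_left inner_add_right algebra_simps)

lemma shear_translate: "shear e k V u x = shear e k V 0 x + u *\<^sub>R e"
  unfolding shear_def by (simp add: algebra_simps)

lemma inj_shear:
  assumes e: "e \<in> Basis" and V: "V \<bullet> e = 0" and k: "k \<noteq> 0"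
  shows "inj (shear e k V u)"
proof (rule injI)
  fix x y assume "shear e k V u x = shear e k V u y"
  then have 0: "shear e k V 0 (x - y) = 0" using shear_diff[of e k V u x y] by simp
  define d where "d = x - y"
  have d: "d = - ((k - 1) * (d \<bullet> e) + V \<bullet> d) *\<^sub>R e" 
    using 0 unfolding shear_def d_def[symmetric] scaleR_minus_left by (simp add: eq_neg_iff_add_eq_0)
  have "V \<bullet> d = - ((k - 1) * (d \<bullet> e) + V \<bullet> d) * (V \<bullet> e)" using arg_cong[OF d, of "\<lambda>x. V \<bullet> x"] by simp
  then have Vd: "V \<bullet> d = 0" using V by simp
  have "k * (d \<bullet> e) = 0" using shear_inner[OF e, of k V 0 d] 0 Vd unfolding d_def by simp
  then have "d \<bullet> e = 0" using k by simp
  then show "x = y" using d Vd unfolding d_def by simp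
qed

lemma convex_body_shear:
  assumes cb: "convex_body K" and e: "e \<in> Basis" and V: "V \<bullet> e = 0" and k: "k \<noteq> 0"
  shows "convex_body (shear e k V u ` K)" and "interior (shear e k V u ` K) = shear e k V u ` interior K"
proof -
  interpret convex_body K by fact
  have bij: "bij (shear e k V 0)"
    using linear_inj_imp_surj[OF shear_linear inj_shear[OF e V k]] inj_shear[OF e V k] by (rule bijI[rotated])
  have im: "shear e k V u ` S = (\<lambda>x. u *\<^sub>R e + x) ` (shear e k V 0 ` S)" for S
    unfolding image_image by (intro image_cong refl) (simp add: shear_translate[of e k V u] add.commute)
  show int: "interior (shear e k V u ` K) = shear e k V u ` interior K"
    unfolding im interior_translation interior_bijective_linear_image[OF shear_linear bij] ..
  show "convex_body (shear e k V u ` K)"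
  proof
    show "compact (shear e k V u ` K)"
      unfolding im by (intro compact_translation compact_continuous_image compact linear_continuous_on_compose[OF _ shear_linear] continuous_on_id)
    show "convex (shear e k V u ` K)"
      unfolding im by (intro convex_translation convex_linear_image shear_linear conv)
    show "interior (shear e k V u ` K) \<noteq> {}" unfolding int using interior by simp
  qed
qed

text \<open>Every line parallel to \<open>e\<close> is mapped to itself with slope \<open>k\<close>,
  so Fubini with the inner integral along \<open>e\<close> suffices.\<close>

lemma volume_shear:
  assumes cb: "convex_body K" and e: "e \<in> Basis" and V: "V \<bullet> e = 0" and k: "k > 0"
  shows "measure lebesgue (shear e k V u ` K) = k * measure lebesgue K"
proof -
  let ?A = "shear e k V u" and ?B = "Basis - {e}"
  have kz: "k \<noteq> 0" using k by simp
  have ee: "e \<bullet> e = 1" using e by simp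
  have bor: "K \<in> sets borel" "?A ` K \<in> sets borel"
    using cb convex_body_shear(1)[OF cb e V kz] unfolding convex_body_def
    by (auto intro!: borel_closed compact_imp_closed)
  note [measurable] = bor
  have "emeasure lborel (?A ` K) = (\<integral>\<^sup>+y. indicator (?A ` K) y \<partial>lborel)" by simp
  also have "\<dots> = itint ?B (\<lambda>y. \<integral>\<^sup>+r. indicator (?A ` K) (y + r *\<^sub>R e) \<partial>lborel) 0"
    by (rule nn_integral_lborel_slices(2)[OF _ e]) measurable
  also have "\<dots> = itint ?B (\<lambda>y. ennreal k * (\<integral>\<^sup>+r. indicator K (y + r *\<^sub>R e) \<partial>lborel)) 0"
  proof (rule itint_cong)
    fix v assume v: "v \<in> span ?B"
    have ve: "v \<bullet> e = 0" by (rule span_perp[OF e v])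
    have "(\<integral>\<^sup>+r. indicator (?A ` K) (v + r *\<^sub>R e) \<partial>lborel)
        = ennreal \<bar>k\<bar> * (\<integral>\<^sup>+r. indicator (?A ` K) (v + ((V \<bullet> v + u) + k * r) *\<^sub>R e) \<partial>lborel)"
      by (rule nn_integral_real_affine[OF _ kz]) measurable
    also have "(\<lambda>r. indicator (?A ` K) (v + ((V \<bullet> v + u) + k * r) *\<^sub>R e)) = (\<lambda>r. indicator K (v + r *\<^sub>R e) :: ennreal)"
    proof
      fix r
      have "?A (v + r *\<^sub>R e) = v + ((V \<bullet> v + u) + k * r) *\<^sub>R e"
        unfolding shear_def using ve ee V by (simp add: inner_add_left inner_add_right algebra_simps)
      then have "v + ((V \<bullet> v + u) + k * r) *\<^sub>R e \<in> ?A ` K \<longleftrightarrow> v + r *\<^sub>R e \<in> K"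
        using inj_image_mem_iff[OF inj_shear[OF e V kz, of u], of "v + r *\<^sub>R e" K] by simp
      then show "indicator (?A ` K) (v + ((V \<bullet> v + u) + k * r) *\<^sub>R e) = (indicator K (v + r *\<^sub>R e) :: ennreal)"
        by (simp add: indicator_def)
    qed
    finally show "(\<integral>\<^sup>+r. indicator (?A ` K) (0 + v + r *\<^sub>R e) \<partial>lborel)
        = ennreal k * (\<integral>\<^sup>+r. indicator K (0 + v + r *\<^sub>R e) \<partial>lborel)" using k by simp
  qed simp
  also have "\<dots> = ennreal k * itint ?B (\<lambda>y. \<integral>\<^sup>+r. indicator K (y + r *\<^sub>R e) \<partial>lborel) 0"
    by (rule itint_cmult) measurable
  also have "itint ?B (\<lambda>y. \<integral>\<^sup>+r. indicator K (y + r *\<^sub>R e) \<partial>lborel) 0 = (\<integral>\<^sup>+y. indicator K y \<partial>lborel)"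
    by (rule nn_integral_lborel_slices(2)[OF _ e, symmetric]) measurable
  also have "\<dots> = emeasure lborel K" by simp
  finally have "emeasure lborel (?A ` K) = ennreal k * emeasure lborel K" .
  then have "measure lborel (?A ` K) = k * measure lborel K"
    using k by (simp add: measure_def enn2real_mult)
  then show ?thesis using bor by simp
qed

text \<open>The support function of the image is that of \<open>K\<close> composed with the
  transpose \<open>T\<close>. On the slice at height \<open>r\<close>, \<open>T\<close> is a
  translation onto the slice at height \<open>k * r\<close>, so only the outer integral is
  rescaled.\<close>

lemma polar_integral_shear:
  assumes cb: "convex_body K" and e: "e \<in> Basis" and V: "V \<bullet> e = 0" and k: "k > 0"
  shows "polar_integral UNIV (shear e k V u ` K) (shear e k V u z) = ennreal (1 / k) * polar_integral UNIV K z"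
proof -
  let ?A = "shear e k V u" and ?B = "Basis - {e}"
  define T where "T = (\<lambda>y. y + (y \<bullet> e) *\<^sub>R ((k - 1) *\<^sub>R e + V))"
  have adj: "y \<bullet> shear e k V 0 x = T y \<bullet> x" for x y
    unfolding T_def shear_def by (simp add: inner_add_left inner_add_right inner_commute algebra_simps)
  have supp: "shifted_support (?A ` K) (?A z) y = shifted_support K z (T y)" for y
    unfolding shifted_support_def image_image shear_diff adj ..
  define f where "f = (\<lambda>y. ennreal (exp (- shifted_support K z y)))"
  have [measurable]: "f \<in> borel_measurable borel"
    unfolding f_def using convex_body.support_measurable[OF cb, of z] by measurable
  have [measurable]: "T \<in> borel_measurable borel" unfolding T_def by measurable
  have ee: "e \<bullet> e = 1" using e by simp
  have VB: "V \<in> span ?B"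
    using proj_perp_in_span[OF e, of V] V unfolding proj_perp_def by simp
  have slice: "itint ?B (\<lambda>y. f (T y)) (r *\<^sub>R e) = itint ?B f ((0 + k * r) *\<^sub>R e)" for r
  proof -
    have "itint ?B (\<lambda>y. f (T y)) (r *\<^sub>R e) = itint ?B (\<lambda>y. f (y + ((k - 1) * r) *\<^sub>R e + r *\<^sub>R V)) (r *\<^sub>R e)"
    proof (rule itint_cong)
      fix v assume v: "v \<in> span ?B"
      have "(r *\<^sub>R e + v) \<bullet> e = r" using span_perp[OF e v] ee by (simp add: inner_add_left)
      then show "f (T (r *\<^sub>R e + v)) = f (r *\<^sub>R e + v + ((k - 1) * r) *\<^sub>R e + r *\<^sub>R V)"
        unfolding T_def by (simp add: algebra_simps)
    qed simp
    also have "\<dots> = itint ?B f ((0 + k * r) *\<^sub>R e + r *\<^sub>R V)"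
      unfolding itint_def by (simp add: algebra_simps)
    also have "\<dots> = itint ?B f ((0 + k * r) *\<^sub>R e)"
      by (rule itint_translate) (simp_all add: VB span_scale)
    finally show ?thesis .
  qed
  have "polar_integral UNIV (?A ` K) (?A z) = (\<integral>\<^sup>+y. f (T y) \<partial>lborel)"
    unfolding polar_integral_def supp f_def by simp
  also have "\<dots> = (\<integral>\<^sup>+r. itint ?B (\<lambda>y. f (T y)) (r *\<^sub>R e) \<partial>lborel)"
    by (rule nn_integral_lborel_slices(1)[OF _ e]) measurable
  also have "\<dots> = ennreal (1 / k) * (ennreal \<bar>k\<bar> * (\<integral>\<^sup>+r. itint ?B f ((0 + k * r) *\<^sub>R e) \<partial>lborel))"
    unfolding slice using k by (simp add: mult.assoc[symmetric] ennreal_mult[symmetric])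
  also have "ennreal \<bar>k\<bar> * (\<integral>\<^sup>+r. itint ?B f ((0 + k * r) *\<^sub>R e) \<partial>lborel) = (\<integral>\<^sup>+r. itint ?B f (r *\<^sub>R e) \<partial>lborel)"
    by (rule nn_integral_real_affine[OF measurable_compose[OF _ measurable_itint], symmetric]) (use k in auto)
  also have "\<dots> = (\<integral>\<^sup>+y. f y \<partial>lborel)"
    by (rule nn_integral_lborel_slices(1)[OF _ e, symmetric]) measurable
  also have "\<dots> = polar_integral UNIV K z" unfolding polar_integral_def f_def by simp
  finally show ?thesis .
qed

section \<open>Santalo polars under shears\<close>

lemma santalo_polar_volume:
  fixes K :: "'a::euclidean_space set"
  assumes "convex_body K"
  shows "enn2real (polar_integral UNIV K (santalo_point K)) = measure lebesgue (santalo_polar K) * fact (DIM('a))"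
    and "measure lebesgue (santalo_polar K) > 0"
proof -
  interpret convex_body K by fact
  show "enn2real (polar_integral UNIV K (santalo_point K)) = measure lebesgue (santalo_polar K) * fact (DIM('a))"
    unfolding santalo_polar_def polar_volume(1)[OF santalo_point(1), symmetric] by (simp add: enn2real_mult)
  show "measure lebesgue (santalo_polar K) > 0"
    unfolding santalo_polar_def by (rule polar_volume(2)[OF santalo_point(1)])
qed

text \<open>A shear multiplies the polar integrals at corresponding base points by the same
  \<open>1 / k\<close> and maps interior to interior, so minimisers correspond.\<close>

lemma santalo_polar_volume_shear:
  fixes K :: "'a::euclidean_space set"
  assumes cb: "convex_body K" and e: "e \<in> Basis" and V: "V \<bullet> e = 0" and k: "k > 0"
  shows "measure lebesgue (santalo_polar (shear e k V u ` K)) = measure lebesgue (santalo_polar K) / k"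
proof -
  let ?A = "shear e k V u"
  have kz: "k \<noteq> 0" using k by simp
  note cbA = convex_body_shear[OF cb e V kz, of u]
  note s = convex_body.santalo_point[OF cb] and sA = convex_body.santalo_point[OF cbA(1)]
  have "polar_integral UNIV (?A ` K) (santalo_point (?A ` K)) = ennreal (1 / k) * polar_integral UNIV K (santalo_point K)"
  proof (rule antisym)
    show "polar_integral UNIV (?A ` K) (santalo_point (?A ` K)) \<le> ennreal (1 / k) * polar_integral UNIV K (santalo_point K)"
      unfolding polar_integral_shear[OF cb e V k, of u, symmetric] by (rule sA(2)) (use s(1) cbA(2) in auto)
    obtain z where z: "z \<in> interior K" "santalo_point (?A ` K) = ?A z" using sA(1) cbA(2) by auto
    show "ennreal (1 / k) * polar_integral UNIV K (santalo_point K) \<le> polar_integral UNIV (?A ` K) (santalo_point (?A ` K))"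
      unfolding z(2) polar_integral_shear[OF cb e V k, of u] by (intro mult_left_mono s(2) z(1)) simp
  qed
  then have "enn2real (polar_integral UNIV (?A ` K) (santalo_point (?A ` K))) = enn2real (polar_integral UNIV K (santalo_point K)) / k"
    using k by (simp add: enn2real_mult)
  then have "measure lebesgue (santalo_polar (?A ` K)) * fact (DIM('a)) = measure lebesgue (santalo_polar K) / k * fact (DIM('a))"
    unfolding santalo_polar_volume(1)[OF cb] santalo_polar_volume(1)[OF cbA(1)] by simp
  then show ?thesis by (metis fact_nonzero mult_right_cancel)
qed

subsection \<open>Shadow systems\<close>

lemma support_le_imp_subset:
  assumes cb: "convex_body K" "convex_body L" and le: "\<And>y. shifted_support K z y \<le> shifted_support L z y"
  shows "K \<subseteq> L"
proof
  fix x assume x: "x \<in> K"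
  show "x \<in> L"
  proof (rule ccontr)
    assume "x \<notin> L"
    moreover have "closed L" "convex L" using cb(2) unfolding convex_body_def by (auto intro: compact_imp_closed)
    ultimately obtain a b where ab: "a \<bullet> x < b" "\<And>y. y \<in> L \<Longrightarrow> a \<bullet> y > b"
      using separating_hyperplane_closed_point[of L x] by auto
    have "(- a) \<bullet> (x - z) \<le> shifted_support K z (- a)" by (rule convex_body.support_upper[OF cb(1) x])
    also have "\<dots> \<le> shifted_support L z (- a)" by (rule le)
    also have "\<dots> \<le> a \<bullet> z - b"
      by (rule convex_body.support_least[OF cb(2)]) (use ab(2) in \<open>force simp: inner_diff_right\<close>)
    finally show False using ab(1) by (simp add: inner_diff_right)
  qed
qed

text \<open>With opposite shifts the piecewise shear is the linear map \<open>L\<close>, and it is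
  \<open>c\<close> times the inverse transpose of the linear part of the shear in the conclusion. So
  the hypotheses say that \<open>K1\<close> and the sheared \<open>K0\<close> have the same support
  function.\<close>

lemma shear_of_support_equality:
  assumes cb: "convex_body K0" "convex_body K1" and e: "e \<in> Basis" and c: "c > 0"
    and w: "w \<in> span (Basis - {e})"
    and eq1: "\<And>W. W \<in> span (Basis - {e}) \<Longrightarrow> shifted_support K1 (z + \<tau> *\<^sub>R e) (c *\<^sub>R W + w + e) = c * shifted_support K0 z (W + e)"
    and eq2: "\<And>W. W \<in> span (Basis - {e}) \<Longrightarrow> shifted_support K1 (z + \<tau> *\<^sub>R e) (c *\<^sub>R W - w - e) = c * shifted_support K0 z (W - e)"
  shows "K1 = shear e c (- w) (\<tau> - (c - 1) * (z \<bullet> e) + w \<bullet> z) ` K0"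
proof -
  let ?A = "shear e c (- w) (\<tau> - (c - 1) * (z \<bullet> e) + w \<bullet> z)"
  let ?z1 = "z + \<tau> *\<^sub>R e"
  let ?g0 = "shifted_support K0 z" and ?g1 = "shifted_support K1 ?z1"
  have ee: "e \<bullet> e = 1" using e by simp
  have we: "w \<bullet> e = 0" by (rule span_perp[OF e w])
  have cz: "c \<noteq> 0" using c by simp
  \<comment> \<open>The translation part of \<open>?A\<close> is chosen to give this.\<close>
  have Az: "?A z = ?z1" unfolding shear_def by (simp add: algebra_simps)
  define L where "L = (\<lambda>y. c *\<^sub>R proj_perp e y + (y \<bullet> e) *\<^sub>R (w + e))"
  have adj: "L y \<bullet> shear e c (- w) 0 x = c * (y \<bullet> x)" for x y
    unfolding L_def shear_def proj_perp_def using ee we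
    by (simp add: inner_add_left inner_add_right inner_diff_left inner_commute algebra_simps)
  have hom: "?g1 (L y) = c * ?g0 y" if r: "y \<bullet> e \<noteq> 0" for y
  proof -
    define r where "r = \<bar>y \<bullet> e\<bar>"
    have r0: "r > 0" unfolding r_def using r by simp
    define W where "W = (1 / r) *\<^sub>R proj_perp e y"
    have WB: "W \<in> span (Basis - {e})" unfolding W_def by (intro span_scale proj_perp_in_span[OF e])
    have rW: "r *\<^sub>R W = proj_perp e y" unfolding W_def using r0 by simp
    have y: "y = proj_perp e y + (y \<bullet> e) *\<^sub>R e" unfolding proj_perp_def by simp
    show ?thesis
    proof (cases "y \<bullet> e > 0")
      case True
      then have re: "y \<bullet> e = r" unfolding r_def by simp
      have "L y = r *\<^sub>R (c *\<^sub>R W + w + e)" unfolding L_def re rW[symmetric] by (simp add: algebra_simps)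
      moreover have "y = r *\<^sub>R (W + e)" by (subst y) (simp add: re rW[symmetric] scaleR_add_right)
      ultimately show ?thesis
        using eq1[OF WB] convex_body.support_scale[OF cb(2), of r] convex_body.support_scale[OF cb(1), of r] r0 by simp
    next
      case False
      then have re: "y \<bullet> e = - r" unfolding r_def by simp
      have "L y = r *\<^sub>R (c *\<^sub>R W - w - e)" unfolding L_def re rW[symmetric] by (simp add: algebra_simps)
      moreover have "y = r *\<^sub>R (W - e)" by (subst y) (simp add: re rW[symmetric] scaleR_diff_right)
      ultimately show ?thesis
        using eq2[OF WB] convex_body.support_scale[OF cb(2), of r] convex_body.support_scale[OF cb(1), of r] r0 by simp
    qed
  qed
  have key: "?g1 (L y) = c * ?g0 y" for y
  proof (cases "y \<bullet> e = 0")
    case False then show ?thesis by (rule hom)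
  next
    case True
    \<comment> \<open>Vectors orthogonal to \<open>e\<close> lie in neither half; they are reached
      as limits from the upper one.\<close>
    define Y where "Y = (\<lambda>n::nat. y + (1 / real (Suc n)) *\<^sub>R e)"
    have "Y \<longlonglongrightarrow> y + 0 *\<^sub>R e"
      unfolding Y_def by (intro tendsto_intros LIMSEQ_Suc[OF lim_1_over_n])
    then have Y: "Y \<longlonglongrightarrow> y" by simp
    have c0: "isCont ?g0 x" and c1: "isCont ?g1 x" for x
      using convex_body.support_continuous[OF cb(1)] convex_body.support_continuous[OF cb(2)]
      by (auto simp: continuous_on_eq_continuous_at)
    have cL: "isCont L x" for x unfolding L_def proj_perp_def by (intro continuous_intros)
    have "(\<lambda>n. ?g1 (L (Y n))) \<longlonglongrightarrow> ?g1 (L y)"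
      by (intro isCont_tendsto_compose[OF c1] isCont_tendsto_compose[OF cL] Y)
    moreover have "(\<lambda>n. c * ?g0 (Y n)) \<longlonglongrightarrow> c * ?g0 y"
      by (intro tendsto_mult_left isCont_tendsto_compose[OF c0] Y)
    moreover have "?g1 (L (Y n)) = c * ?g0 (Y n)" for n
      by (rule hom) (use True ee in \<open>simp add: Y_def inner_add_left\<close>)
    ultimately show ?thesis using LIMSEQ_unique by fastforce
  qed
  have we': "- w \<bullet> e = 0" using we by simp
  note cbA = convex_body_shear(1)[OF cb(1) e we' cz, of "\<tau> - (c - 1) * (z \<bullet> e) + w \<bullet> z"]
  have surj: "\<exists>y. y' = L y" for y'
  proof
    define y where "y = (1 / c) *\<^sub>R (proj_perp e y' - (y' \<bullet> e) *\<^sub>R w) + (y' \<bullet> e) *\<^sub>R e"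
    have pe: "proj_perp e x \<bullet> e = 0" for x unfolding proj_perp_def using ee by (simp add: inner_diff_left)
    have ye: "y \<bullet> e = y' \<bullet> e" unfolding y_def using ee we pe by (simp add: inner_add_left inner_diff_left)
    have "c *\<^sub>R proj_perp e y = proj_perp e y' - (y' \<bullet> e) *\<^sub>R w"
      unfolding proj_perp_def[of e y] ye unfolding y_def using cz by simp
    then have "L y = proj_perp e y' + (y' \<bullet> e) *\<^sub>R e" unfolding L_def ye by (simp add: scaleR_add_right)
    then show "y' = L y" unfolding proj_perp_def by simp
  qed
  have suppA: "shifted_support (?A ` K0) ?z1 y' = ?g1 y'" for y'
  proof -
    obtain y where y: "y' = L y" using surj by blast
    have "shifted_support (?A ` K0) ?z1 y' = (SUP x\<in>K0. c * (y \<bullet> (x - z)))"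
      unfolding shifted_support_def image_image Az[symmetric] shear_diff y adj ..
    also have "\<dots> = (SUP x\<in>K0. (c *\<^sub>R y) \<bullet> (x - z))" by simp
    also have "\<dots> = c * ?g0 y"
      using convex_body.support_scale[OF cb(1), of c z y] c unfolding shifted_support_def by simp
    finally show ?thesis unfolding y key .
  qed
  show ?thesis
    by (rule antisym; rule support_le_imp_subset[where z="?z1"]) (simp_all add: cb cbA suppA)
qed

text \<open>A point of \<open>L\<close> outside the closed \<open>K\<close> is a limit of interior
  points of \<open>L\<close>, so \<open>L - K\<close> would contain a nonempty open set and have
  positive volume.\<close>

lemma equal_of_subset_volume:
  assumes cb: "convex_body K" "convex_body L" and sub: "K \<subseteq> L" and vol: "measure lebesgue K = measure lebesgue L"
  shows "K = L"
proof (rule ccontr)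
  assume "K \<noteq> L"
  then obtain x where x: "x \<in> L" "x \<notin> K" using sub by blast
  have clK: "closed K" and clL: "closed L" and cL: "convex L" and iL: "interior L \<noteq> {}"
    using cb unfolding convex_body_def by (auto intro: compact_imp_closed)
  define U where "U = interior L - K"
  have opU: "open U" unfolding U_def using clK by (intro open_Diff) auto
  have "x \<in> closure (interior L)" using x(1) closure_subset convex_closure_interior[OF cL iL] by blast
  then have "- K \<inter> interior L \<noteq> {}"
    using x(2) clK open_Int_closure_eq_empty[of "- K" "interior L"] by auto
  then have neU: "U \<noteq> {}" unfolding U_def by auto
  have bor: "K \<in> sets borel" "L \<in> sets borel" "U \<in> sets borel" using clK clL opU by auto
  have fin: "emeasure lborel L < \<infinity>" "emeasure lborel K < \<infinity>"
    using cb unfolding convex_body_def by (blast intro: emeasure_bounded_finite compact_imp_bounded)+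
  have "emeasure lborel K + emeasure lborel U = emeasure lborel (K \<union> U)"
    by (rule plus_emeasure) (use bor in \<open>auto simp: U_def\<close>)
  also have "\<dots> \<le> emeasure lborel L"
    by (rule emeasure_mono) (use bor sub interior_subset[of L] in \<open>auto simp: U_def\<close>)
  also have "\<dots> = emeasure lborel K"
    using vol bor fin by (simp add: emeasure_eq_ennreal_measure less_top)
  finally have "emeasure lborel K + emeasure lborel U \<le> emeasure lborel K + 0" by simp
  then have "emeasure lborel U = 0"
    using fin(2) by (subst (asm) ennreal_add_left_cancel_le) auto
  moreover have "emeasure lborel U > 0"
  proof -
    obtain y where "y \<in> U" using neU by blast
    then obtain r where r: "r > 0" "ball y r \<subseteq> U" using opU openE by blast
    have "0 < emeasure lborel (ball y r)" using r(1) by (simp add: emeasure_ball)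
    also have "\<dots> \<le> emeasure lborel U" using r(2) bor by (intro emeasure_mono) auto
    finally show ?thesis .
  qed
  ultimately show False by simp
qed

text \<open>The positions at the times \<open>a\<close> and \<open>b\<close> are recorded as pairs,
  and the closed convex hull \<open>G\<close> is taken in the product space. Being compact, it has a
  closed linear image that contains \<open>K t\<close>; so even limit points of \<open>K t\<close>
  come from a pair whose first entry moves along \<open>e\<close> to the second at constant
  speed.\<close>

lemma shadow_system_coupling:
  fixes K :: "real \<Rightarrow> 'a::euclidean_space set"
  assumes ab: "a < b" and nd: "nondegenerate_shadow_system {a..b} e K"
  shows "\<And>t. t \<in> {a..b} \<Longrightarrow> convex_body (K t)"
    and "\<And>t q. t \<in> {a..b} \<Longrightarrow> q \<in> K t \<Longrightarrow>
      \<exists>q0\<in>K a. \<exists>\<tau>. q0 + \<tau> *\<^sub>R e \<in> K b \<and> q = q0 + ((t - a) / (b - a) * \<tau>) *\<^sub>R e"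
    and "\<exists>p \<sigma>. p \<in> interior (K a) \<and> p + \<sigma> *\<^sub>R e \<in> interior (K b)"
proof -
  obtain M \<alpha> where M: "bounded M" "bounded (\<alpha> ` M)"
    and K: "\<And>t. t \<in> {a..b} \<Longrightarrow> K t = closure (convex hull ((\<lambda>x. x + (\<alpha> x * t) *\<^sub>R e) ` M))"
    and ne: "norm e = 1" and int: "\<And>t. t \<in> {a..b} \<Longrightarrow> interior (K t) \<noteq> {}"
    using nd unfolding nondegenerate_shadow_system_def shadow_system_def by blast
  have ee: "e \<bullet> e = 1" using ne by (simp add: norm_eq_1)
  obtain R where R: "\<And>x. x \<in> M \<Longrightarrow> norm x \<le> R" using M(1) by (auto simp: bounded_iff)
  obtain R' where R': "\<And>x. x \<in> M \<Longrightarrow> \<bar>\<alpha> x\<bar> \<le> R'" using M(2) by (auto simp: bounded_iff)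
  have nb: "norm (x + (\<alpha> x * t) *\<^sub>R e) \<le> R + R' * \<bar>t\<bar>" if "x \<in> M" for x t
  proof -
    have "norm (x + (\<alpha> x * t) *\<^sub>R e) \<le> norm x + \<bar>\<alpha> x\<bar> * \<bar>t\<bar>"
      using norm_triangle_ineq[of x "(\<alpha> x * t) *\<^sub>R e"] ne by (simp add: abs_mult)
    also have "\<dots> \<le> R + R' * \<bar>t\<bar>" using R[OF that] R'[OF that] by (intro add_mono mult_right_mono) auto
    finally show ?thesis .
  qed
  have bd: "bounded ((\<lambda>x. x + (\<alpha> x * t) *\<^sub>R e) ` M)" for t
    unfolding bounded_iff using nb by blast
  show cb: "convex_body (K t)" if t: "t \<in> {a..b}" for t
  proof
    show "compact (K t)" unfolding K[OF t] using bounded_convex_hull[OF bd] by (simp add: compact_closure)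
    show "convex (K t)" unfolding K[OF t] by (intro convex_closure convex_convex_hull)
    show "interior (K t) \<noteq> {}" by (rule int[OF t])
  qed
  define P where "P = (\<lambda>x. (x + (\<alpha> x * a) *\<^sub>R e, x + (\<alpha> x * b) *\<^sub>R e)) ` M"
  define G where "G = closure (convex hull P)"
  have "P \<subseteq> ((\<lambda>x. x + (\<alpha> x * a) *\<^sub>R e) ` M) \<times> ((\<lambda>x. x + (\<alpha> x * b) *\<^sub>R e) ` M)"
    unfolding P_def by auto
  then have "bounded P" using bounded_Times[OF bd bd] bounded_subset by blast
  then have cG: "compact G" unfolding G_def using bounded_convex_hull by (simp add: compact_closure)
  have a: "a \<in> {a..b}" and b: "b \<in> {a..b}" using ab by auto
  \<comment> \<open>Having a difference parallel to \<open>e\<close> is a closed and linear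
    condition on pairs, so it passes from \<open>P\<close> to \<open>G\<close>.\<close>
  have Gdiff: "snd p - fst p = ((snd p - fst p) \<bullet> e) *\<^sub>R e" if "p \<in> G" for p
  proof -
    let ?S = "{p. snd p - fst p = ((snd p - fst p) \<bullet> e) *\<^sub>R e}"
    have "P \<subseteq> ?S" unfolding P_def using ee by (auto simp: algebra_simps inner_add_left)
    moreover have "convex ?S"
    proof (rule convexI)
      fix p q :: "'a \<times> 'a" and u v :: real
      define x y where "x = snd p - fst p" and "y = snd q - fst q"
      assume "p \<in> ?S" "q \<in> ?S"
      then have x: "x = (x \<bullet> e) *\<^sub>R e" and y: "y = (y \<bullet> e) *\<^sub>R e" unfolding x_def y_def by auto
      have d: "snd (u *\<^sub>R p + v *\<^sub>R q) - fst (u *\<^sub>R p + v *\<^sub>R q) = u *\<^sub>R x + v *\<^sub>R y"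
        unfolding x_def y_def by (simp add: algebra_simps)
      have "((u *\<^sub>R x + v *\<^sub>R y) \<bullet> e) *\<^sub>R e = u *\<^sub>R ((x \<bullet> e) *\<^sub>R e) + v *\<^sub>R ((y \<bullet> e) *\<^sub>R e)"
        by (simp add: inner_add_left scaleR_add_left)
      also have "\<dots> = u *\<^sub>R x + v *\<^sub>R y" by (simp only: x[symmetric] y[symmetric])
      finally show "u *\<^sub>R p + v *\<^sub>R q \<in> ?S" unfolding mem_Collect_eq d ..
    qed
    ultimately have "convex hull P \<subseteq> ?S" by (rule hull_minimal)
    moreover have "closed ?S" by (intro closed_Collect_eq continuous_intros)
    ultimately have "G \<subseteq> ?S" unfolding G_def by (rule closure_minimal)
    then show ?thesis using that by auto
  qed
  have Gfst: "fst p \<in> K a" and Gsnd: "snd p \<in> K b" if "p \<in> G" for p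
  proof -
    have "fst ` G \<subseteq> closure (fst ` (convex hull P))"
      unfolding G_def by (rule closure_bounded_linear_image_subset[OF bounded_linear_fst])
    also have "fst ` (convex hull P) = convex hull (fst ` P)"
      by (rule convex_hull_linear_image) (rule linear_fst)
    also have "fst ` P = (\<lambda>x. x + (\<alpha> x * a) *\<^sub>R e) ` M" unfolding P_def by (simp add: image_image)
    finally show "fst p \<in> K a" unfolding K[OF a] using that by auto
    have "snd ` G \<subseteq> closure (snd ` (convex hull P))"
      unfolding G_def by (rule closure_bounded_linear_image_subset[OF bounded_linear_snd])
    also have "snd ` (convex hull P) = convex hull (snd ` P)"
      by (rule convex_hull_linear_image) (rule linear_snd)
    also have "snd ` P = (\<lambda>x. x + (\<alpha> x * b) *\<^sub>R e) ` M" unfolding P_def by (simp add: image_image)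
    finally show "snd p \<in> K b" unfolding K[OF b] using that by auto
  qed
  have cover: "\<exists>p\<in>G. q = fst p + ((t - a) / (b - a)) *\<^sub>R (snd p - fst p)" if t: "t \<in> {a..b}" and q: "q \<in> K t" for t q
  proof -
    define l where "l = (t - a) / (b - a)"
    define F where "F = (\<lambda>p::'a \<times> 'a. fst p + l *\<^sub>R (snd p - fst p))"
    have lin: "linear F" unfolding F_def by (rule linearI) (simp_all add: algebra_simps)
    have l: "a + l * (b - a) = t" unfolding l_def using ab by simp
    have "F ` P = (\<lambda>x. x + (\<alpha> x * t) *\<^sub>R e) ` M"
      unfolding P_def image_image
    proof (intro image_cong refl)
      fix x
      have "F (x + (\<alpha> x * a) *\<^sub>R e, x + (\<alpha> x * b) *\<^sub>R e) = x + (\<alpha> x * (a + l * (b - a))) *\<^sub>R e"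
        unfolding F_def by (simp add: algebra_simps)
      then show "F (x + (\<alpha> x * a) *\<^sub>R e, x + (\<alpha> x * b) *\<^sub>R e) = x + (\<alpha> x * t) *\<^sub>R e" unfolding l .
    qed
    then have "convex hull ((\<lambda>x. x + (\<alpha> x * t) *\<^sub>R e) ` M) = F ` (convex hull P)"
      using convex_hull_linear_image[OF lin, of P] by simp
    also have "\<dots> \<subseteq> F ` G" unfolding G_def by (intro image_mono closure_subset)
    finally have "K t \<subseteq> closure (F ` G)" unfolding K[OF t] by (rule closure_mono)
    moreover have "closed (F ` G)"
      by (intro compact_imp_closed compact_continuous_image[OF _ cG] linear_continuous_on linear_conv_bounded_linear[THEN iffD1, OF lin])
    ultimately have "q \<in> F ` G" using q by (metis closure_closed subsetD)
    then show ?thesis unfolding F_def l_def by blast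
  qed
  show "\<exists>q0\<in>K a. \<exists>\<tau>. q0 + \<tau> *\<^sub>R e \<in> K b \<and> q = q0 + ((t - a) / (b - a) * \<tau>) *\<^sub>R e"
    if t: "t \<in> {a..b}" and q: "q \<in> K t" for t q
  proof -
    obtain p where p: "p \<in> G" "q = fst p + ((t - a) / (b - a)) *\<^sub>R (snd p - fst p)" using cover[OF t q] by blast
    define \<tau> where "\<tau> = (snd p - fst p) \<bullet> e"
    have d: "snd p - fst p = \<tau> *\<^sub>R e" unfolding \<tau>_def by (rule Gdiff[OF p(1)])
    have "fst p + \<tau> *\<^sub>R e \<in> K b" using Gsnd[OF p(1)] unfolding d[symmetric] by simp
    moreover have "q = fst p + ((t - a) / (b - a) * \<tau>) *\<^sub>R e" using p(2) unfolding d by simp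
    ultimately show ?thesis using Gfst[OF p(1)] by blast
  qed
  obtain p0 where p0: "p0 \<in> interior (K a)" using int[OF a] by blast
  obtain x where x: "x \<in> G" "p0 = fst x" 
    using cover[OF a subsetD[OF interior_subset p0]] by auto
  obtain q1 where q1: "q1 \<in> interior (K b)" using int[OF b] by blast
  obtain y where "y \<in> G" "q1 = fst y + ((b - a) / (b - a)) *\<^sub>R (snd y - fst y)"
    using cover[OF b subsetD[OF interior_subset q1]] by blast
  then have y: "y \<in> G" "q1 = snd y" using ab by simp_all
  \<comment> \<open>Averaging a pair over an interior point of \<open>K a\<close> with a pair over
    an interior point of \<open>K b\<close> makes both entries interior.\<close>
  have half: "0 < (1/2::real)" "(1/2::real) \<le> 1" by simp_all
  have A: "fst y - (1/2) *\<^sub>R (fst y - fst x) \<in> interior (K a)"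
    using cb[OF a] p0 Gfst[OF y(1)] unfolding x(2) convex_body_def
    by (intro mem_interior_convex_shrink half) auto
  have B: "snd x - (1/2) *\<^sub>R (snd x - snd y) \<in> interior (K b)"
    using cb[OF b] q1 Gsnd[OF x(1)] unfolding y(2) convex_body_def
    by (intro mem_interior_convex_shrink half) auto
  define \<sigma> where "\<sigma> = ((snd x - fst x) \<bullet> e + (snd y - fst y) \<bullet> e) / 2"
  have "snd x - (1/2) *\<^sub>R (snd x - snd y) - (fst y - (1/2) *\<^sub>R (fst y - fst x)) = (1/2) *\<^sub>R ((snd x - fst x) + (snd y - fst y))"
  proof -
    have h: "v - (1/2) *\<^sub>R (v - w) = (1/2) *\<^sub>R (v + w)" for v w :: 'a
    proof -
      have "v - (1/2) *\<^sub>R v = (1 - 1/2) *\<^sub>R v" by (simp only: scaleR_left_diff_distrib scaleR_one)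
      then show ?thesis by (simp add: scaleR_diff_right scaleR_add_right)
    qed
    show ?thesis unfolding h scaleR_diff_right[symmetric] by (simp add: algebra_simps)
  qed
  also have "\<dots> = \<sigma> *\<^sub>R e"
    by (subst Gdiff[OF x(1)], subst Gdiff[OF y(1)]) (simp add: \<sigma>_def scaleR_add_left[symmetric] del: scaleR_add_left)
  finally have "fst y - (1/2) *\<^sub>R (fst y - fst x) + \<sigma> *\<^sub>R e = snd x - (1/2) *\<^sub>R (snd x - snd y)"
    by (simp add: algebra_simps)
  then show "\<exists>p \<sigma>. p \<in> interior (K a) \<and> p + \<sigma> *\<^sub>R e \<in> interior (K b)" using A B by metis
qed

text \<open>All happens on one line parallel to \<open>e\<close>, since shears preserve such lines:
  the preimage \<open>p\<close> of the end point lies on the line of \<open>q0\<close>, and a point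
  of the segment from \<open>q0\<close> to \<open>p\<close> is carried by the interpolated shear to
  the intermediate point.\<close>

lemma shear_interpolate_subset:
  assumes cb: "convex_body K0" and e: "e \<in> Basis" and V: "V \<bullet> e = 0" and c: "c > 0" and l: "0 \<le> l" "l \<le> 1"
    and q0: "q0 \<in> K0" and q1: "q0 + \<tau> *\<^sub>R e \<in> shear e c V u ` K0"
  shows "q0 + (l * \<tau>) *\<^sub>R e \<in> shear e (1 + l * (c - 1)) (l *\<^sub>R V) (l * u) ` K0"
proof -
  have ee: "e \<bullet> e = 1" using e by simp
  define m where "m = (c - 1) * (q0 \<bullet> e) + V \<bullet> q0 + u"
  have sh: "shear e c V u (q0 + s *\<^sub>R e) = q0 + (c * s + m) *\<^sub>R e" for s
    unfolding shear_def m_def using ee V by (simp add: inner_add_left inner_add_right algebra_simps)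
  have shl: "shear e (1 + l * (c - 1)) (l *\<^sub>R V) (l * u) (q0 + s *\<^sub>R e) = q0 + ((1 + l * (c - 1)) * s + l * m) *\<^sub>R e" for s
    unfolding shear_def m_def using ee V by (simp add: inner_add_left inner_add_right algebra_simps)
  obtain p where p: "p \<in> K0" "q0 + \<tau> *\<^sub>R e = shear e c V u p" using q1 by blast
  define \<kappa> where "\<kappa> = (c - 1) * (p \<bullet> e) + V \<bullet> p + u"
  have pe: "p = q0 + (\<tau> - \<kappa>) *\<^sub>R e" using p(2) unfolding shear_def \<kappa>_def by (simp add: algebra_simps)
  define s where "s = \<tau> - \<kappa>"
  have "q0 + \<tau> *\<^sub>R e = q0 + (c * s + m) *\<^sub>R e" using p(2) sh[of s] unfolding pe s_def by simp
  then have "(\<tau> - (c * s + m)) *\<^sub>R e = 0" by (simp add: scaleR_left_diff_distrib)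
  then have \<tau>: "\<tau> = c * s + m" using ee by auto
  define k where "k = 1 + l * (c - 1)"
  have k: "k = (1 - l) + l * c" unfolding k_def by (simp add: algebra_simps)
  have lc: "0 \<le> l * c" using l c by simp
  have k0: "k > 0"
  proof (cases "l = 1")
    case True then show ?thesis unfolding k using c by simp
  next
    case False then show ?thesis unfolding k using l lc by simp
  qed
  \<comment> \<open>The weight for which the stretched part \<open>k * (t * s)\<close> becomes
    \<open>l * c * s\<close>, the share of \<open>l * \<tau> = l * (c * s + m)\<close> that is due
    to \<open>s\<close>.\<close>
  define t where "t = l * c / k"
  have t: "0 \<le> t" "t \<le> 1" unfolding t_def using lc k0 l by (auto simp: k)
  have "(1 - t) *\<^sub>R q0 + t *\<^sub>R p \<in> K0"
    using cb[unfolded convex_body_def] q0 p(1) t by (intro convexD) auto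
  moreover have "(1 - t) *\<^sub>R q0 + t *\<^sub>R p = q0 + (t * s) *\<^sub>R e"
    unfolding pe s_def by (simp add: algebra_simps)
  ultimately have in0: "q0 + (t * s) *\<^sub>R e \<in> K0" by simp
  have "k * (t * s) = l * c * s" unfolding t_def using k0 by simp
  then have "shear e k (l *\<^sub>R V) (l * u) (q0 + (t * s) *\<^sub>R e) = q0 + (l * \<tau>) *\<^sub>R e"
    using shl[of "t * s"] unfolding k_def[symmetric] \<tau> by (simp add: distrib_left mult.assoc)
  then show ?thesis unfolding k_def[symmetric] using in0 by (metis imageI)
qed

section \<open>The two implications\<close>

lemma affine_functions_imp_shear:
  fixes K :: "real \<Rightarrow> 'a::euclidean_space set"
  assumes e: "e \<in> Basis" and ab: "a < b" and nd: "nondegenerate_shadow_system {a..b} e K"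
    and vol: "affine_function_on {a..b} (\<lambda>t. measure lebesgue (K t))"
    and pvol: "affine_function_on {a..b} (\<lambda>t. inverse (measure lebesgue (santalo_polar (K t))))"
  shows "\<exists>v u :: real. \<exists>V :: 'a. V \<bullet> e = 0 \<and>
            (\<forall>t\<in>{a..b}. K t = shear_map e v u V (t - (a + b) / 2) ` K ((a + b) / 2))"
proof -
  define m where "m = (a + b) / 2"
  have mem: "a \<in> {a..b}" "b \<in> {a..b}" "m \<in> {a..b}" unfolding m_def using ab by auto
  note sys = shadow_system_coupling[OF ab nd]
  note cb = sys(1)
  have mh: "(m - a) / (b - a) = 1 / 2"
  proof -
    have "m - a = (b - a) / 2" unfolding m_def by (simp add: field_simps)
    then show ?thesis using ab by simp
  qed
  have coupled: "coupled e (K a) (K b) (K m)"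
    unfolding coupled_def
  proof
    fix q assume "q \<in> K m"
    from sys(2)[OF mem(3) this] show "\<exists>q0\<in>K a. \<exists>\<tau>. q0 + \<tau> *\<^sub>R e \<in> K b \<and> q = q0 + (\<tau> / 2) *\<^sub>R e"
      unfolding mh by simp
  qed
  obtain p \<sigma> where p: "p \<in> interior (K a)" "p + \<sigma> *\<^sub>R e \<in> interior (K b)" using sys(3) by blast
  let ?E = "\<lambda>K. enn2real (polar_integral UNIV K (santalo_point K))"
  have inv: "1 / ?E (K t) = inverse (measure lebesgue (santalo_polar (K t))) / fact (DIM('a))" if "t \<in> {a..b}" for t
    unfolding santalo_polar_volume(1)[OF cb[OF that]] by (simp add: divide_inverse)
  obtain p' q' where aff: "\<And>t. t \<in> {a..b} \<Longrightarrow> inverse (measure lebesgue (santalo_polar (K t))) = p' * t + q'"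
    using pvol unfolding affine_function_on_def by blast
  \<comment> \<open>Affinity at the midpoint is equality in the convexity bound for the reciprocal
    polar volume, up to the factor \<open>fact (DIM('a))\<close>.\<close>
  have "p' * m + q' = ((p' * a + q') + (p' * b + q')) / 2" unfolding m_def by (simp add: field_simps)
  then have "1 / ?E (K m) = (1 / ?E (K a) + 1 / ?E (K b)) / 2"
    unfolding inv[OF mem(1)] inv[OF mem(2)] inv[OF mem(3)] aff[OF mem(1)] aff[OF mem(2)] aff[OF mem(3)]
    by (simp add: add_divide_distrib)
  then obtain \<tau> c w1 w2 where w: "santalo_point (K b) = santalo_point (K a) + \<tau> *\<^sub>R e" "c > 0"
    "w1 \<in> span (Basis - {e})" "w2 \<in> span (Basis - {e})"
    "\<And>W. W \<in> span (Basis - {e}) \<Longrightarrow> shifted_support (K b) (santalo_point (K b)) (c *\<^sub>R W + w1 + e)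
      = c * shifted_support (K a) (santalo_point (K a)) (W + e)"
    "\<And>W. W \<in> span (Basis - {e}) \<Longrightarrow> shifted_support (K b) (santalo_point (K b)) (c *\<^sub>R W + w2 - e)
      = c * shifted_support (K a) (santalo_point (K a)) (W - e)"
    using santalo_coupled_equality[OF cb[OF mem(1)] cb[OF mem(2)] cb[OF mem(3)] e coupled p] by metis
  have "w1 + w2 = 0" by (rule opposite_shifts[OF cb[OF mem(1)] cb[OF mem(2)] e w(2-4)]) (use w(5,6) in auto)
  then have w2: "w2 = - w1" by (simp add: add_eq_0_iff)
  define V where "V = - w1"
  define u where "u = \<tau> - (c - 1) * (santalo_point (K a) \<bullet> e) + w1 \<bullet> santalo_point (K a)"
  have V: "V \<bullet> e = 0" unfolding V_def using span_perp[OF e w(3)] by simp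
  have Kb: "K b = shear e c V u ` K a"
    unfolding V_def u_def
    by (rule shear_of_support_equality[OF cb[OF mem(1)] cb[OF mem(2)] e w(2) w(3)]) (use w(5,6) in \<open>simp_all add: w(1) w2\<close>)
  \<comment> \<open>The shear carrying \<open>K a\<close> to \<open>K b\<close>, interpolated
    linearly from the identity at \<open>l = 0\<close>.\<close>
  define L where "L = (\<lambda>l. shear e (1 + l * (c - 1)) (l *\<^sub>R V) (l * u))"
  have kpos: "1 + l * (c - 1) > 0" if "0 \<le> l" "l \<le> 1" for l
  proof -
    have "1 + l * (c - 1) = (1 - l) + l * c" by (simp add: algebra_simps)
    moreover have "(1 - l) + l * c > 0"
    proof (cases "l = 1")
      case False
      then show ?thesis using that w(2) by (intro add_pos_nonneg) auto
    qed (use w(2) in simp)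
    ultimately show ?thesis by simp
  qed
  have lV: "(l *\<^sub>R V) \<bullet> e = 0" for l using V by simp
  have Kt: "K t = L ((t - a) / (b - a)) ` K a" if t: "t \<in> {a..b}" for t
  proof -
    define l where "l = (t - a) / (b - a)"
    have l: "0 \<le> l" "l \<le> 1" unfolding l_def using t ab by auto
    have tl: "t = a + l * (b - a)" unfolding l_def using ab by simp
    have kl: "1 + l * (c - 1) > 0" "1 + l * (c - 1) \<noteq> 0" using kpos[OF l] by simp_all
    have "K t \<subseteq> L l ` K a"
    proof
      fix q assume "q \<in> K t"
      from sys(2)[OF t this] obtain q0 \<tau>' where q: "q0 \<in> K a" "q0 + \<tau>' *\<^sub>R e \<in> K b" "q = q0 + (l * \<tau>') *\<^sub>R e"
        unfolding l_def by blast
      show "q \<in> L l ` K a" unfolding L_def q(3)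
        by (rule shear_interpolate_subset[OF cb[OF mem(1)] e V w(2) l q(1)]) (use q(2) Kb in simp)
    qed
    moreover have "measure lebesgue (K t) = measure lebesgue (L l ` K a)"
    proof -
      \<comment> \<open>Both volumes are affine in \<open>l\<close>; they agree at
        \<open>l = 0\<close> and, by the shear formula for \<open>K b\<close>, at
        \<open>l = 1\<close>.\<close>
      obtain p'' q'' where aff': "\<And>t. t \<in> {a..b} \<Longrightarrow> measure lebesgue (K t) = p'' * t + q''"
        using vol unfolding affine_function_on_def by blast
      have "measure lebesgue (K b) = c * measure lebesgue (K a)"
        unfolding Kb by (rule volume_shear[OF cb[OF mem(1)] e V w(2)])
      then have "p'' * b + q'' = c * (p'' * a + q'')" unfolding aff'[OF mem(1)] aff'[OF mem(2)] .
      then have d: "p'' * (b - a) = (c - 1) * (p'' * a + q'')" by (simp add: algebra_simps)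
      have "measure lebesgue (L l ` K a) = (1 + l * (c - 1)) * (p'' * a + q'')"
        unfolding L_def volume_shear[OF cb[OF mem(1)] e lV kl(1)] aff'[OF mem(1)] ..
      also have "\<dots> = (p'' * a + q'') + l * ((c - 1) * (p'' * a + q''))" by (simp add: algebra_simps)
      also have "\<dots> = p'' * (a + l * (b - a)) + q''" unfolding d[symmetric] by (simp add: algebra_simps)
      finally show ?thesis unfolding aff'[OF t] tl[symmetric] by simp
    qed
    ultimately show ?thesis unfolding l_def[symmetric]
      using convex_body_shear(1)[OF cb[OF mem(1)] e lV kl(2)] by (intro equal_of_subset_volume cb[OF t]) (auto simp: L_def)
  qed
  \<comment> \<open>The velocity \<open>f\<close> has to be rewritten in terms of the position at
    the midpoint, where \<open>f\<close> has been multiplied by \<open>(1 + c) / 2\<close>. Dividing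
    by this factor and by \<open>b - a\<close> gives the rate per unit of time.\<close>
  define \<kappa> where "\<kappa> = 2 / (1 + c) / (b - a)"
  have c1: "1 + c > 0" using w(2) by simp
  have "shear_map e (\<kappa> * (c - 1)) (\<kappa> * u) (\<kappa> *\<^sub>R V) (t - m) (L (1 / 2) x) = L ((t - a) / (b - a)) x" for t x
  proof -
    define l where "l = (t - a) / (b - a)"
    have tm: "t - m = (l - 1 / 2) * (b - a)"
      unfolding l_def m_def using ab by (simp add: field_simps)
    define f where "f = (\<lambda>x. (c - 1) * (x \<bullet> e) + V \<bullet> x + u)"
    have Lx: "L l x = x + (l * f x) *\<^sub>R e" for l x unfolding L_def shear_def f_def by (simp add: algebra_simps)
    have ee: "e \<bullet> e = 1" using e by simp
    have f: "f (x + s *\<^sub>R e) = f x + (c - 1) * s" for s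
      unfolding f_def using ee V by (simp add: inner_add_left inner_add_right algebra_simps)
    have "shear_map e (\<kappa> * (c - 1)) (\<kappa> * u) (\<kappa> *\<^sub>R V) s y = y + (s * \<kappa> * f y) *\<^sub>R e" for s y
      unfolding shear_map_eq[OF e lV[of \<kappa>]] shear_def f_def by (simp add: algebra_simps)
    then have "shear_map e (\<kappa> * (c - 1)) (\<kappa> * u) (\<kappa> *\<^sub>R V) (t - m) (L (1 / 2) x)
        = x + (1 / 2 * f x) *\<^sub>R e + ((t - m) * \<kappa> * (f x + (c - 1) * (1 / 2 * f x))) *\<^sub>R e"
      by (simp only: Lx f)
    also have "(t - m) * \<kappa> * (f x + (c - 1) * (1 / 2 * f x)) = (l - 1 / 2) * f x"
    proof -
      have "f x + (c - 1) * (1 / 2 * f x) = (1 + c) / 2 * f x" by (simp add: field_simps)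
      moreover have "(t - m) * \<kappa> * ((1 + c) / 2) = l - 1 / 2" unfolding tm \<kappa>_def using ab c1 by simp
      ultimately show ?thesis by (metis mult.assoc)
    qed
    also have "x + (1 / 2 * f x) *\<^sub>R e + ((l - 1 / 2) * f x) *\<^sub>R e = x + (l * f x) *\<^sub>R e"
    proof -
      have "1 / 2 * f x + (l - 1 / 2) * f x = l * f x" by (simp add: field_simps)
      then show ?thesis by (simp only: add.assoc scaleR_add_left[symmetric])
    qed
    finally show ?thesis unfolding Lx l_def .
  qed
  then have "K t = shear_map e (\<kappa> * (c - 1)) (\<kappa> * u) (\<kappa> *\<^sub>R V) (t - m) ` K m" if "t \<in> {a..b}" for t
    unfolding Kt[OF that] Kt[OF mem(3)] mh image_image by simp
  then show ?thesis unfolding m_def using lV[of \<kappa>] by blast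
qed

text \<open>Volume and reciprocal polar volume of \<open>K t\<close> are those of the middle body
  times \<open>1 + (t - m) * v\<close>. The shear formulas require this factor to be positive, and
  non-degeneracy supplies that.\<close>

lemma shear_imp_affine_functions:
  fixes K :: "real \<Rightarrow> 'a::euclidean_space set"
  assumes e: "e \<in> Basis" and ab: "a < b" and nd: "nondegenerate_shadow_system {a..b} e K"
    and V: "V \<bullet> e = 0" and K: "\<And>t. t \<in> {a..b} \<Longrightarrow> K t = shear_map e v u V (t - (a + b) / 2) ` K ((a + b) / 2)"
  shows "affine_function_on {a..b} (\<lambda>t. measure lebesgue (K t))"
    and "affine_function_on {a..b} (\<lambda>t. inverse (measure lebesgue (santalo_polar (K t))))"
proof -
  define m where "m = (a + b) / 2"
  have m: "m \<in> {a..b}" unfolding m_def using ab by auto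
  note cb = shadow_system_coupling(1)[OF ab nd]
  have ee: "e \<bullet> e = 1" using e by simp
  have Kt: "K t = shear e (1 + (t - m) * v) ((t - m) *\<^sub>R V) ((t - m) * u) ` K m" if "t \<in> {a..b}" for t
    using K[OF that] unfolding m_def[symmetric] shear_map_eq[OF e V] .
  have sV: "(s *\<^sub>R V) \<bullet> e = 0" for s using V by simp
  have nz: "1 + (t - m) * v \<noteq> 0" if t: "t \<in> {a..b}" for t
  proof
    assume 0: "1 + (t - m) * v = 0"
    \<comment> \<open>If the stretch factor vanished, \<open>K t\<close> would lie in a hyperplane
      with this normal, against non-degeneracy.\<close>
    define d where "d = e - (t - m) *\<^sub>R V"
    have de: "d \<bullet> e = 1" unfolding d_def using ee V by (simp add: inner_diff_left)
    then have d0: "d \<noteq> 0" by auto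
    have "K t \<subseteq> {x. d \<bullet> x = (t - m) * u}"
    proof
      fix x assume "x \<in> K t"
      then obtain y where y: "x = shear e 0 ((t - m) *\<^sub>R V) ((t - m) * u) y" unfolding Kt[OF t] 0 by blast
      have "V \<bullet> x = V \<bullet> y" unfolding y shear_def using V by (simp add: inner_add_right)
      moreover have "e \<bullet> x = (t - m) * (V \<bullet> y) + (t - m) * u"
        using shear_inner[OF e, of 0 "(t - m) *\<^sub>R V" "(t - m) * u" y] unfolding y by (simp add: inner_commute)
      ultimately show "x \<in> {x. d \<bullet> x = (t - m) * u}" unfolding d_def by (simp add: inner_diff_left)
    qed
    then have "interior (K t) \<subseteq> interior {x. d \<bullet> x = (t - m) * u}" by (rule interior_mono)
    also have "\<dots> = {}" by (rule interior_hyperplane[OF d0])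
    finally show False using cb[OF t] unfolding convex_body_def by auto
  qed
  have pos: "1 + (t - m) * v > 0" if t: "t \<in> {a..b}" for t
  proof (rule ccontr)
    assume "\<not> ?thesis"
    then have neg: "1 + (t - m) * v < 0" using nz[OF t] by simp
    \<comment> \<open>A negative factor at \<open>t\<close> would vanish at the intermediate time
      \<open>m + s * (t - m)\<close>.\<close>
    define r s where "r = - ((t - m) * v)" and "s = 1 / r"
    have r: "r > 1" unfolding r_def using neg by simp
    have s: "0 \<le> s" "s \<le> 1" unfolding s_def using r by auto
    have "m + s * (t - m) = (1 - s) * m + s * t" by (simp add: algebra_simps)
    moreover have "(1 - s) * m + s * t \<in> {a..b}"
      using convexD[OF convex_real_interval(5)[of a b] m t, of "1 - s" s] s by simp
    ultimately have "m + s * (t - m) \<in> {a..b}" by simp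
    from nz[OF this] have "1 + s * ((t - m) * v) \<noteq> 0" by (simp add: mult.assoc)
    then have "1 - s * r \<noteq> 0" unfolding r_def by simp
    then show False unfolding s_def using r by simp
  qed
  have vol: "measure lebesgue (K t) = (1 + (t - m) * v) * measure lebesgue (K m)" if t: "t \<in> {a..b}" for t
    using volume_shear[OF cb[OF m] e sV[of "t - m"] pos[OF t], of "(t - m) * u"] unfolding Kt[OF t, symmetric] .
  have pvol: "inverse (measure lebesgue (santalo_polar (K t))) = (1 + (t - m) * v) * inverse (measure lebesgue (santalo_polar (K m)))" if t: "t \<in> {a..b}" for t
    using santalo_polar_volume_shear[OF cb[OF m] e sV[of "t - m"] pos[OF t], of "(t - m) * u"] unfolding Kt[OF t, symmetric]
    by (simp add: divide_inverse mult.commute)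
  have lin: "(1 + (t - m) * v) * x = (v * x) * t + (x - m * v * x)" for t x by (simp add: algebra_simps)
  show "affine_function_on {a..b} (\<lambda>t. measure lebesgue (K t))"
    unfolding affine_function_on_def using vol lin by metis
  show "affine_function_on {a..b} (\<lambda>t. inverse (measure lebesgue (santalo_polar (K t))))"
    unfolding affine_function_on_def using pvol lin by metis
qed

theorem proposition7:
  fixes K :: "real \<Rightarrow> 'a::euclidean_space set" and e :: 'a and a b :: real
  assumes "e \<in> Basis" and "a \<le> b"
    and "nondegenerate_shadow_system {a..b} e K"
  shows "(affine_function_on {a..b} (\<lambda>t. measure lebesgue (K t)) \<and>
          affine_function_on {a..b} (\<lambda>t. inverse (measure lebesgue (santalo_polar (K t)))))
     \<longleftrightarrow>
         (\<exists>v u :: real. \<exists>V :: 'a. V \<bullet> e = 0 \<and>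
            (\<forall>t\<in>{a..b}. K t = shear_map e v u V (t - (a + b) / 2) ` K ((a + b) / 2)))"
proof (cases "a = b")
  case True
  \<comment> \<open>On a one-point interval both sides hold: every function is affine there, and the
    zero parameters give the identity.\<close>
  have "affine_function_on {a..b} f" for f
    unfolding affine_function_on_def True by (intro exI[of _ 0] exI[of _ "f b"]) simp
  moreover have "shear_map e 0 0 0 0 x = x" for x
    unfolding shear_map_def by (simp add: Let_def)
  then have "0 \<bullet> e = 0 \<and> (\<forall>t\<in>{a..b}. K t = shear_map e 0 0 0 (t - (a + b) / 2) ` K ((a + b) / 2))"
    unfolding True by simp
  ultimately show ?thesis by blast
next
  case False
  then have ab: "a < b" using assms(2) by simp
  show ?thesis
  proof (intro iffI, elim conjE)
    assume "affine_function_on {a..b} (\<lambda>t. measure lebesgue (K t))"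
      "affine_function_on {a..b} (\<lambda>t. inverse (measure lebesgue (santalo_polar (K t))))"
    then show "\<exists>v u :: real. \<exists>V :: 'a. V \<bullet> e = 0 \<and>
        (\<forall>t\<in>{a..b}. K t = shear_map e v u V (t - (a + b) / 2) ` K ((a + b) / 2))"
      by (rule affine_functions_imp_shear[OF assms(1) ab assms(3)])
  next
    assume "\<exists>v u :: real. \<exists>V :: 'a. V \<bullet> e = 0 \<and>
        (\<forall>t\<in>{a..b}. K t = shear_map e v u V (t - (a + b) / 2) ` K ((a + b) / 2))"
    then obtain v u :: real and V :: 'a where V: "V \<bullet> e = 0"
      and K: "\<And>t. t \<in> {a..b} \<Longrightarrow> K t = shear_map e v u V (t - (a + b) / 2) ` K ((a + b) / 2)"
      by blast
    show "affine_function_on {a..b} (\<lambda>t. measure lebesgue (K t)) \<and>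
        affine_function_on {a..b} (\<lambda>t. inverse (measure lebesgue (santalo_polar (K t))))"
      using shear_imp_affine_functions[OF assms(1) ab assms(3) V K] by (rule conjI)
  qed
qed

end
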